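(* Let $H$ be a division ring, let $\sigma$ be a ring automorphism of $H$ of finite order, and let $G$ be a finite group. Then there exists an extension of $H(T,\sigma)$ with automorphism group $G$; that is, there is a division ring $E \supseteq H(T,\sigma)$ such that $\mathrm{Aut}(E/H(T,\sigma))$ is isomorphic to $G$.
   Context: A division ring is a not necessarily commutative ring in which every non-zero element is invertible. For division rings $K \subseteq L$, $\mathrm{Aut}(L/K)$ is the group of all ring automorphisms of $L$ fixing $K$ pointwise. The twisted polynomial ring $H[T,\sigma]$ is the ring of polynomials $a_0 + a_1T + \cdots + a_mT^m$ with $m \geq 0$ and $a_0,\dots,a_m \in H$, with componentwise addition and multiplication determined by $Ta = \sigma(a)T$ for $a \in H$. It is a right Ore domain, and $H(T,\sigma)$ denotes its division ring of fractions: the (unique up to isomorphism) division ring which contains $H[T,\sigma]$ and each element of which can be written as $rs^{-1}$ with $r \in H[T,\sigma]$ and $s \in H[T,\sigma]\setminus\{0\}$. *)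

theory Defs
  imports "HOL-Algebra.UnivPoly" "HOL-Algebra.QuotRing" "HOL-Algebra.Bij"
begin

text \<open>Rings are records in the style of HOL-Algebra. The type class \<open>division_ring\<close> of the main library
  speaks about whole types only; the locale below is its counterpart with an explicit carrier.\<close>

locale skew_field = ring R for R (structure) +
  assumes one_not_zero: "\<one> \<noteq> \<zero>"
    and skew_field_Units: "Units R = carrier R - {\<zero>}"

text \<open>\<open>Aut(L/K)\<close> for a subset \<open>K\<close> of the carrier of \<open>L\<close>. As for \<^const>\<open>AutoGroup\<close>, the maps are required to
  be extensional (undefined off the carrier), so that each automorphism is counted exactly once.\<close>

definition relative_auts :: "('a, 'm) ring_scheme \<Rightarrow> 'a set \<Rightarrow> ('a \<Rightarrow> 'a) set" where
  "relative_auts L K = {f \<in> ring_iso L L \<inter> Bij (carrier L). \<forall>x\<in>K. f x = x}"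

definition relative_aut_group :: "('a, 'm) ring_scheme \<Rightarrow> 'a set \<Rightarrow> ('a \<Rightarrow> 'a) monoid" where
  "relative_aut_group L K = BijGroup (carrier L) \<lparr>carrier := relative_auts L K\<rparr>"

definition finite_order_on :: "'a set \<Rightarrow> ('a \<Rightarrow> 'a) \<Rightarrow> bool" where
  "finite_order_on A f \<longleftrightarrow> (\<exists>n>0. \<forall>a\<in>A. (f ^^ n) a = a)"

text \<open>A polynomial \<open>a\<^sub>0 + a\<^sub>1 T + \<dots> + a\<^sub>m T\<^sup>m\<close> is its coefficient sequence, as in \<^const>\<open>UP\<close>. The rule
  \<open>T a = \<sigma>(a) T\<close> gives \<open>(a T\<^sup>i) (b T\<^sup>j) = a \<sigma>\<^sup>i(b) T\<^sup>i\<^sup>+\<^sup>j\<close>, whence the product.\<close>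

definition twisted_poly :: "('a, 'm) ring_scheme \<Rightarrow> ('a \<Rightarrow> 'a) \<Rightarrow> (nat \<Rightarrow> 'a) ring" where
  "twisted_poly H \<sigma> = \<lparr>
     carrier = up H,
     monoid.mult = (\<lambda>p\<in>up H. \<lambda>q\<in>up H. \<lambda>n. \<Oplus>\<^bsub>H\<^esub>i\<in>{..n}. p i \<otimes>\<^bsub>H\<^esub> (\<sigma> ^^ i) (q (n - i))),
     one = (\<lambda>i. if i = 0 then \<one>\<^bsub>H\<^esub> else \<zero>\<^bsub>H\<^esub>),
     zero = (\<lambda>i. \<zero>\<^bsub>H\<^esub>),
     add = (\<lambda>p\<in>up H. \<lambda>q\<in>up H. \<lambda>i. p i \<oplus>\<^bsub>H\<^esub> q i)\<rparr>"

text \<open>\<open>Q\<close>, with the embedding \<open>\<iota>\<close> of \<open>R\<close>, is a division ring of (right) fractions of \<open>R\<close>.\<close>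

definition division_ring_of_fractions ::
    "('a, 'm) ring_scheme \<Rightarrow> ('a \<Rightarrow> 'b) \<Rightarrow> ('b, 'n) ring_scheme \<Rightarrow> bool" where
  "division_ring_of_fractions R \<iota> Q \<longleftrightarrow>
     skew_field Q \<and> \<iota> \<in> ring_hom R Q \<and> inj_on \<iota> (carrier R) \<and>
     (\<forall>x\<in>carrier Q. \<exists>r\<in>carrier R. \<exists>s\<in>carrier R - {\<zero>\<^bsub>R\<^esub>}. x = \<iota> r \<otimes>\<^bsub>Q\<^esub> inv\<^bsub>Q\<^esub> (\<iota> s))"


lemma (in ring) funpow_ring_iso:
  assumes "\<sigma> \<in> ring_iso R R"
  shows "\<sigma> ^^ n \<in> ring_hom R R"
proof (induction n)
  case 0
  show ?case by (auto simp: ring_hom_def)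
next
  case (Suc n)
  then have "\<sigma> \<circ> \<sigma> ^^ n \<in> ring_hom R R"
    using assms ring_hom_trans unfolding ring_iso_def by blast
  then show ?case by (simp only: funpow.simps)
qed

lemma (in ring) ring_hom_finsum:
  assumes h: "h \<in> ring_hom R R" and "finite A" "f \<in> A \<rightarrow> carrier R"
  shows "h (\<Oplus>i\<in>A. f i) = (\<Oplus>i\<in>A. h (f i))"
proof -
  interpret ring_hom_ring R R h
    using h by (simp add: ring_hom_ringI2 ring_axioms)
  show ?thesis using assms(3) by (simp add: hom_finsum comp_def)
qed

theorem twisted_poly_ring:
  assumes "ring H" and sig: "\<sigma> \<in> ring_iso H H"
  shows "ring (twisted_poly H \<sigma>)"
proof -
  interpret ring H by fact
  let ?P = "twisted_poly H \<sigma>"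
  let ?s = "\<lambda>i. \<sigma> ^^ i"
  have hom: "?s i \<in> ring_hom H H" for i
    using funpow_ring_iso[OF sig] .
  have cl [simp]: "?s i a \<in> carrier H" if "a \<in> carrier H" for i a
    using ring_hom_closed[OF hom that] .
  have ad: "?s i (a \<oplus>\<^bsub>H\<^esub> b) = ?s i a \<oplus>\<^bsub>H\<^esub> ?s i b" if "a \<in> carrier H" "b \<in> carrier H" for i a b
    using ring_hom_add[OF hom that] .
  have mu: "?s i (a \<otimes>\<^bsub>H\<^esub> b) = ?s i a \<otimes>\<^bsub>H\<^esub> ?s i b" if "a \<in> carrier H" "b \<in> carrier H" for i a b
    using ring_hom_mult[OF hom that] .
  have on [simp]: "?s i \<one>\<^bsub>H\<^esub> = \<one>\<^bsub>H\<^esub>" for i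
    using ring_hom_one[OF hom] .
  have ze [simp]: "?s i \<zero>\<^bsub>H\<^esub> = \<zero>\<^bsub>H\<^esub>" for i
    using ring_hom_zero[OF hom ring_axioms ring_axioms] .
  have carr: "carrier ?P = up H" and one: "\<one>\<^bsub>?P\<^esub> = (\<lambda>i. if i = 0 then \<one>\<^bsub>H\<^esub> else \<zero>\<^bsub>H\<^esub>)"
    and zero: "\<zero>\<^bsub>?P\<^esub> = (\<lambda>i. \<zero>\<^bsub>H\<^esub>)"
    by (simp_all add: twisted_poly_def)
  have add: "p \<oplus>\<^bsub>?P\<^esub> q = (\<lambda>i. p i \<oplus>\<^bsub>H\<^esub> q i)" if "p \<in> up H" "q \<in> up H" for p q
    using that by (simp add: twisted_poly_def)
  have mult: "p \<otimes>\<^bsub>?P\<^esub> q = (\<lambda>n. \<Oplus>\<^bsub>H\<^esub>i\<in>{..n}. p i \<otimes>\<^bsub>H\<^esub> ?s i (q (n - i)))"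
    if "p \<in> up H" "q \<in> up H" for p q
    using that by (simp add: twisted_poly_def)
  have zero_up: "(\<lambda>i. \<zero>\<^bsub>H\<^esub>) \<in> up H" by auto
  have mult_up: "(\<lambda>n. \<Oplus>\<^bsub>H\<^esub>i\<in>{..n}. p i \<otimes>\<^bsub>H\<^esub> ?s i (q (n - i))) \<in> up H"
    if p: "p \<in> up H" and q: "q \<in> up H" for p q
  proof
    show "(\<Oplus>\<^bsub>H\<^esub>i\<in>{..n}. p i \<otimes>\<^bsub>H\<^esub> ?s i (q (n - i))) \<in> carrier H" for n
      using p q by (simp add: mem_upD funcsetI)
    obtain k l where k: "bound \<zero>\<^bsub>H\<^esub> k p" and l: "bound \<zero>\<^bsub>H\<^esub> l q"
      using p q by blast
    have "(\<Oplus>\<^bsub>H\<^esub>i\<in>{..n}. p i \<otimes>\<^bsub>H\<^esub> ?s i (q (n - i))) = \<zero>\<^bsub>H\<^esub>" if n: "k + l < n" for n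
    proof -
      have "p i \<otimes>\<^bsub>H\<^esub> ?s i (q (n - i)) = \<zero>\<^bsub>H\<^esub>" for i
      proof (cases "k < i")
        case True
        then show ?thesis using k q by (simp add: bound.bound mem_upD)
      next
        case False
        then have "l < n - i" using n by arith
        then show ?thesis using l p by (simp add: bound.bound mem_upD)
      qed
      then show ?thesis by (simp add: Pi_def)
    qed
    then show "\<exists>n. bound \<zero>\<^bsub>H\<^esub> n (\<lambda>n. \<Oplus>\<^bsub>H\<^esub>i\<in>{..n}. p i \<otimes>\<^bsub>H\<^esub> ?s i (q (n - i)))"
      by blast
  qed
  have assoc: "(p \<otimes>\<^bsub>?P\<^esub> q) \<otimes>\<^bsub>?P\<^esub> r = p \<otimes>\<^bsub>?P\<^esub> (q \<otimes>\<^bsub>?P\<^esub> r)"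
    if p: "p \<in> up H" and q: "q \<in> up H" and r: "r \<in> up H" for p q r
  proof -
    have key: "(\<Oplus>\<^bsub>H\<^esub>j\<in>{..k}. (\<Oplus>\<^bsub>H\<^esub>i\<in>{..j}. a i \<otimes>\<^bsub>H\<^esub> b i (j - i)) \<otimes>\<^bsub>H\<^esub> c j (n - j)) =
        (\<Oplus>\<^bsub>H\<^esub>j\<in>{..k}. a j \<otimes>\<^bsub>H\<^esub> (\<Oplus>\<^bsub>H\<^esub>i\<in>{..k - j}. b j i \<otimes>\<^bsub>H\<^esub> c (i + j) (n - j - i)))"
      (is "?eq k")
      if "\<And>i. a i \<in> carrier H" "\<And>i j. b i j \<in> carrier H" "\<And>i j. c i j \<in> carrier H" "k \<le> n"
      for a :: "nat \<Rightarrow> 'a" and b c n k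
      using that(4)
    proof (induction k)
      case 0
      show ?case using that by (simp add: Pi_def m_assoc)
    next
      case (Suc k)
      then have "k \<le> n" by arith
      then have "?eq k" by (rule Suc.IH)
      with that(1-3) Suc.prems show ?case
        by (simp cong: finsum_cong
             add: Suc_diff_le Pi_def l_distr r_distr m_assoc)
           (simp cong: finsum_cong add: Pi_def a_ac finsum_ldistr m_assoc)
    qed
    show ?thesis
    proof
      fix n
      have "((p \<otimes>\<^bsub>?P\<^esub> q) \<otimes>\<^bsub>?P\<^esub> r) n =
          (\<Oplus>\<^bsub>H\<^esub>j\<in>{..n}. (\<Oplus>\<^bsub>H\<^esub>i\<in>{..j}. p i \<otimes>\<^bsub>H\<^esub> ?s i (q (j - i))) \<otimes>\<^bsub>H\<^esub> ?s j (r (n - j)))"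
        by (simp add: mult p q r mult_up)
      also have "\<dots> = (\<Oplus>\<^bsub>H\<^esub>j\<in>{..n}. p j \<otimes>\<^bsub>H\<^esub>
          (\<Oplus>\<^bsub>H\<^esub>i\<in>{..n - j}. ?s j (q i) \<otimes>\<^bsub>H\<^esub> ?s (i + j) (r (n - j - i))))"
        using key[of p "\<lambda>i m. ?s i (q m)" "\<lambda>i m. ?s i (r m)" n n] p q r by (simp add: mem_upD)
      also have "\<dots> = (\<Oplus>\<^bsub>H\<^esub>j\<in>{..n}. p j \<otimes>\<^bsub>H\<^esub>
          ?s j (\<Oplus>\<^bsub>H\<^esub>i\<in>{..n - j}. q i \<otimes>\<^bsub>H\<^esub> ?s i (r (n - j - i))))"
      proof (rule finsum_cong')
        fix j
        have "?s (i + j) x = ?s j (?s i x)" for i x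
          by (metis add.commute comp_apply funpow_add)
        then show "p j \<otimes>\<^bsub>H\<^esub> (\<Oplus>\<^bsub>H\<^esub>i\<in>{..n - j}. ?s j (q i) \<otimes>\<^bsub>H\<^esub> ?s (i + j) (r (n - j - i))) =
            p j \<otimes>\<^bsub>H\<^esub> ?s j (\<Oplus>\<^bsub>H\<^esub>i\<in>{..n - j}. q i \<otimes>\<^bsub>H\<^esub> ?s i (r (n - j - i)))"
          using q r by (subst ring_hom_finsum[OF hom]) (simp_all add: Pi_def mem_upD mu)
      qed (use p q r in \<open>auto simp: Pi_def mem_upD intro!: m_closed cl finsum_closed\<close>)
      also have "\<dots> = (p \<otimes>\<^bsub>?P\<^esub> (q \<otimes>\<^bsub>?P\<^esub> r)) n"
        by (simp add: mult p q r mult_up)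
      finally show "((p \<otimes>\<^bsub>?P\<^esub> q) \<otimes>\<^bsub>?P\<^esub> r) n = (p \<otimes>\<^bsub>?P\<^esub> (q \<otimes>\<^bsub>?P\<^esub> r)) n" .
    qed
  qed
  have l_one: "\<one>\<^bsub>?P\<^esub> \<otimes>\<^bsub>?P\<^esub> p = p" if p: "p \<in> up H" for p
  proof
    fix n
    have "(\<one>\<^bsub>?P\<^esub> \<otimes>\<^bsub>?P\<^esub> p) n = (\<Oplus>\<^bsub>H\<^esub>i\<in>{..n}. if 0 = i then p n else \<zero>\<^bsub>H\<^esub>)"
      unfolding one mult[OF up_one_closed p]
      by (rule finsum_cong') (use p in \<open>auto simp: Pi_def mem_upD\<close>)
    also have "\<dots> = p n"
      using p add.finprod_singleton[of 0 "{..n}" "\<lambda>_. p n"] by (simp add: mem_upD)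
    finally show "(\<one>\<^bsub>?P\<^esub> \<otimes>\<^bsub>?P\<^esub> p) n = p n" .
  qed
  have r_one: "p \<otimes>\<^bsub>?P\<^esub> \<one>\<^bsub>?P\<^esub> = p" if p: "p \<in> up H" for p
  proof
    fix n
    have "(p \<otimes>\<^bsub>?P\<^esub> \<one>\<^bsub>?P\<^esub>) n = (\<Oplus>\<^bsub>H\<^esub>i\<in>{..n}. if n = i then p i else \<zero>\<^bsub>H\<^esub>)"
      unfolding one mult[OF p up_one_closed]
      by (rule finsum_cong') (use p in \<open>auto simp: Pi_def mem_upD\<close>)
    also have "\<dots> = p n"
      using p add.finprod_singleton[of n "{..n}" p] by (simp add: mem_upD)
    finally show "(p \<otimes>\<^bsub>?P\<^esub> \<one>\<^bsub>?P\<^esub>) n = p n" .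
  qed
  show ?thesis
  proof (rule ringI)
    show "abelian_group ?P"
    proof (rule abelian_groupI)
      fix p assume p: "p \<in> carrier ?P"
      then have "(\<lambda>i. \<ominus>\<^bsub>H\<^esub> p i) \<oplus>\<^bsub>?P\<^esub> p = \<zero>\<^bsub>?P\<^esub>"
        by (simp add: carr zero add up_a_inv_closed l_neg mem_upD)
      then show "\<exists>q\<in>carrier ?P. q \<oplus>\<^bsub>?P\<^esub> p = \<zero>\<^bsub>?P\<^esub>"
        using p up_a_inv_closed carr by blast
    qed (auto simp: carr zero add up_add_closed zero_up a_ac mem_upD)
    show "Group.monoid ?P"
    proof (rule monoidI)
      show "\<one>\<^bsub>?P\<^esub> \<in> carrier ?P"
        unfolding carr one by (rule up_one_closed)
    next
      fix p q assume "p \<in> carrier ?P" "q \<in> carrier ?P"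
      then show "p \<otimes>\<^bsub>?P\<^esub> q \<in> carrier ?P"
        by (simp add: carr mult mult_up)
    qed (simp_all only: carr assoc l_one r_one)
  next
    fix p q r assume "p \<in> carrier ?P" "q \<in> carrier ?P" "r \<in> carrier ?P"
    then have pqr: "p \<in> up H" "q \<in> up H" "r \<in> up H" by (simp_all add: carr)
    show "(p \<oplus>\<^bsub>?P\<^esub> q) \<otimes>\<^bsub>?P\<^esub> r = p \<otimes>\<^bsub>?P\<^esub> r \<oplus>\<^bsub>?P\<^esub> q \<otimes>\<^bsub>?P\<^esub> r"
      using pqr by (simp add: add mult mult_up up_add_closed l_distr mem_upD Pi_def)
    show "r \<otimes>\<^bsub>?P\<^esub> (p \<oplus>\<^bsub>?P\<^esub> q) = r \<otimes>\<^bsub>?P\<^esub> p \<oplus>\<^bsub>?P\<^esub> r \<otimes>\<^bsub>?P\<^esub> q"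
      using pqr by (simp add: add mult mult_up up_add_closed ad r_distr mem_upD Pi_def)
  qed
qed

end

theory Submission
  imports Defs "HOL-Algebra.Subrings" "HOL-Computational_Algebra.Primes" "HOL-Library.Nat_Bijection"
    "HOL-Library.Infinite_Set" "HOL-Combinatorics.Permutations"
begin

text \<open>Let \<open>K = H(T,\<sigma>)\<close>. If \<open>\<sigma>\<^sup>n = 1\<close>, then \<open>\<tau> = T\<^sup>n\<close> is central in \<open>K\<close> and not a root of unity, and this is all that is used about \<open>K\<close>. Given distinct primes \<open>q\<^sub>k\<close>, invertible in \<open>K\<close>, a tower over
  a division ring \<open>A\<close> is a sequence of central indeterminates with \<open>y\<^sub>k = y\<^sub>k\<^sub>+\<^sub>1\<^bsup>q\<^sub>k\<^esup> - \<rho>\<^sub>k\<close>, where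
  \<open>\<rho>\<^sub>k = 1, \<tau>, \<theta>\<close> according to \<open>k mod 3\<close>. A tower is rigid: in the division ring \<open>A(y\<^sub>0, y\<^sub>1, \<dots>)\<close> every central
  sequence \<open>u\<^sub>k = u\<^sub>k\<^sub>+\<^sub>1\<^bsup>q\<^sub>k\<^esup> - \<eta>\<^sub>k\<close> of the same shape, with \<open>\<eta>\<^sub>k\<close> in \<open>A\<close>, lies in \<open>A\<close> or is \<open>y\<close> itself. Indeed
  Kummer theory bounds the degree of \<open>u\<^sub>k\<close> as a fraction in \<open>y\<^sub>k\<close>, so once \<open>q\<^sub>k\<close> is large \<open>u\<^sub>k\<close> is a monomial
  \<open>c y\<^sub>k\<^sup>e\<close>; the parameter \<open>1\<close> then forces \<open>c = 1\<close> and the parameter \<open>\<tau>\<close> forces \<open>e = 1\<close>.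

  Adjoin a tower with \<open>\<theta> = 1\<close> for each \<open>s \<in> G\<close>, with bottom \<open>z\<^sub>s\<close> say, and then for each \<open>g \<in> G\<close> a tower with
  \<open>\<theta> = \<Sum>\<^sub>s z\<^sub>s\<^bsup>e(g,s)\<^esup>\<close>, where \<open>e(g,s) > 0\<close> is an injective code of \<open>g\<^sup>-\<^sup>1 s\<close>.
  By rigidity an automorphism over \<open>K\<close> permutes the towers of each kind, preserving \<open>e\<close>; such permutations are
  the left translations by the elements of \<open>G\<close>.

  To have all towers, and the action of the permutations on them, at once, everything takes place in the ring of
  functions from points to \<open>K\<close> modulo those that vanish generically.\<close>

section \<open>Polynomials in a commuting element and left fractions\<close>

text \<open>Every height has its own prime, so a \<open>q k\<close>-th root does not interfere with
  the heights above \<open>k\<close>: once \<open>u k\<close> is a fraction at a height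
  \<open>l > k\<close>, so is \<open>u (Suc k)\<close>. This controls where \<open>u k\<close> lives
  and makes degrees at different heights comparable. The additive constants break homogeneity:
  without them, powers of a tower would be further sequences of the same shape.

  Rigidity rests on degrees, common divisors and units, hence on commutativity. It is proved in the
  center of each stage, over the central part of the stage below; the link is that a central
  fraction can be written with central coefficients.

  Towers of the first kind alone would admit every permutation of \<open>G\<close>. The second kind
  turns the relation between \<open>g\<close> and \<open>s\<close> into exponents, which an
  automorphism has to respect.

  Roots need not exist in \<open>K\<close>, so no point can prescribe a tower at all heights. A
  point fixes the tower at one height, its level, and computes the values below.\<close>

primrec (in ring) pol :: "'a set \<Rightarrow> 'a \<Rightarrow> nat \<Rightarrow> 'a set" where
  "pol S y 0 = {\<zero>}"
| "pol S y (Suc n) = {a \<otimes> y [^] n \<oplus> b | a b. a \<in> S \<and> b \<in> pol S y n}"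

text \<open>Values in the ring, not formal polynomials: uniqueness of coefficients always comes from
  a separate transcendence hypothesis. The bound in \<open>pol S y n\<close> is strict (degree below
  \<open>n\<close>), and coefficients stand on the left.\<close>

definition (in ring) polys :: "'a set \<Rightarrow> 'a \<Rightarrow> 'a set" where
  "polys S y = (\<Union>n. pol S y n)"

text \<open>The non-vanishing is a disjunction, which keeps the condition symmetric and trivial when
  \<open>a\<close> or \<open>b\<close> is zero; \<open>ore_obtain\<close> recovers the usual
  form.\<close>

definition (in ring) left_ore :: "'a set \<Rightarrow> bool" where
  "left_ore S \<longleftrightarrow> (\<forall>a\<in>S. \<forall>b\<in>S. \<exists>c\<in>S. \<exists>d\<in>S. (c \<noteq> \<zero> \<or> d \<noteq> \<zero>) \<and> c \<otimes> a = d \<otimes> b)"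

text \<open>The left fractions \<open>inv a \<otimes> s\<close>, found inside an ambient ring in
  which the non-zero elements of \<open>S\<close> are invertible. No equivalence classes of pairs
  are formed.\<close>

definition (in ring) fracs :: "'a set \<Rightarrow> 'a set" where
  "fracs S = {x \<in> carrier R. \<exists>a\<in>S. a \<noteq> \<zero> \<and> a \<otimes> x \<in> S}"

lemma (in ring) subring_pow:
  assumes "subring T R" "x \<in> T"
  shows "x [^] (n::nat) \<in> T"
  by (induction n) (simp_all add: subringE(3,6)[OF assms(1)] assms(2))

context ring
begin

lemma pol_subset: "S \<subseteq> T \<Longrightarrow> pol S x n \<subseteq> pol T x n"
proof (induction n)
  case (Suc n)
  then show ?case unfolding pol.simps by blast
qed simp

lemma restrict_uminus:
  assumes "subring H R" "b \<in> H"
  shows "\<ominus>\<^bsub>R\<lparr>carrier := H\<rparr>\<^esub> b = \<ominus> b"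
proof -
  interpret H: ring "R\<lparr>carrier := H\<rparr>" using subring_is_ring assms(1) .
  show ?thesis
  proof (rule H.minus_equality)
    show "(\<ominus> b) \<oplus>\<^bsub>R\<lparr>carrier := H\<rparr>\<^esub> b = \<zero>\<^bsub>R\<lparr>carrier := H\<rparr>\<^esub>"
      using subringE(1)[OF assms(1)] assms(2) by (simp add: l_neg subset_iff)
  qed (use assms subringE(5)[OF assms(1)] in auto)
qed

lemma restrict_minus: "subring H R \<Longrightarrow> b \<in> H \<Longrightarrow> a \<ominus>\<^bsub>R\<lparr>carrier := H\<rparr>\<^esub> b = a \<ominus> b"
  by (simp add: a_minus_def restrict_uminus)

lemma restrict_pow: "a [^]\<^bsub>R\<lparr>carrier := H\<rparr>\<^esub> (n::nat) = a [^] n"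
  using nat_pow_consistent by simp

lemma restrict_add_pow: "add_pow (R\<lparr>carrier := H\<rparr>) (n::nat) a = add_pow R n a"
  by (induction n) (simp_all add: add_pow_def nat_pow_def)

lemma restrict_pol:
  assumes "subring H R"
  shows "ring.pol (R\<lparr>carrier := H\<rparr>) S v n = pol S v n"
proof -
  interpret H: ring "R\<lparr>carrier := H\<rparr>" using subring_is_ring assms .
  show ?thesis by (induction n) (simp_all add: restrict_pow)
qed

lemma restrict_polys:
  assumes "subring H R"
  shows "ring.polys (R\<lparr>carrier := H\<rparr>) S v = polys S v"
proof -
  interpret H: ring "R\<lparr>carrier := H\<rparr>" using subring_is_ring assms .
  show ?thesis unfolding H.polys_def polys_def restrict_pol[OF assms] ..
qed

lemma restrict_subring:
  assumes "subring H R" "subring S R" "S \<subseteq> H"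
  shows "subring S (R\<lparr>carrier := H\<rparr>)"
proof -
  interpret H: ring "R\<lparr>carrier := H\<rparr>" using subring_is_ring assms(1) .
  show ?thesis by (rule H.ring_incl_imp_subring) (use assms subring_is_ring[OF assms(2)] in auto)
qed

end

lemma (in monoid) inv_commutes:
  assumes "u \<in> Units G" "x \<in> carrier G" "u \<otimes> x = x \<otimes> u"
  shows "inv u \<otimes> x = x \<otimes> inv u"
proof -
  have c: "u \<in> carrier G" "inv u \<in> carrier G" using assms(1) by auto
  have "inv u \<otimes> x = inv u \<otimes> (x \<otimes> u) \<otimes> inv u" using assms(1,2) c by (simp add: m_assoc)
  also have "\<dots> = inv u \<otimes> u \<otimes> x \<otimes> inv u" unfolding assms(3)[symmetric] using assms(2) c by (simp add: m_assoc)
  also have "\<dots> = x \<otimes> inv u" using assms(1,2) by simp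
  finally show ?thesis .
qed

locale adjoin = ring R for R (structure) +
  fixes S and y
  assumes S: "subring S R" and y [simp]: "y \<in> carrier R"
    and comm: "s \<in> S \<Longrightarrow> s \<otimes> y = y \<otimes> s"
begin

lemma S_carrier [simp]: "s \<in> S \<Longrightarrow> s \<in> carrier R"
  using subringE(1)[OF S] by blast

lemma S_closed [simp]: "\<zero> \<in> S" "\<one> \<in> S" "a \<in> S \<Longrightarrow> \<ominus> a \<in> S"
  "a \<in> S \<Longrightarrow> b \<in> S \<Longrightarrow> a \<otimes> b \<in> S" "a \<in> S \<Longrightarrow> b \<in> S \<Longrightarrow> a \<oplus> b \<in> S"
  using subringE(2,3,5,6,7)[OF S] by auto

lemma comm_pow: "s \<in> S \<Longrightarrow> s \<otimes> y [^] (n::nat) = y [^] n \<otimes> s"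
proof (induction n)
  case (Suc n)
  then have "s \<otimes> y [^] Suc n = y [^] n \<otimes> s \<otimes> y" by (simp flip: m_assoc)
  then show ?case using Suc.prems by (simp add: m_assoc comm)
qed simp

lemma pol_carrier [simp]: "a \<in> pol S y n \<Longrightarrow> a \<in> carrier R"
  by (induction n arbitrary: a) auto

lemma pol_SucI: "a \<in> S \<Longrightarrow> b \<in> pol S y n \<Longrightarrow> a \<otimes> y [^] n \<oplus> b \<in> pol S y (Suc n)"
  by auto

lemma pol_Suc: "a \<in> pol S y n \<Longrightarrow> a \<in> pol S y (Suc n)"
  using pol_SucI[of \<zero> a n] by simp

lemma pol_mono: "a \<in> pol S y n \<Longrightarrow> n \<le> k \<Longrightarrow> a \<in> pol S y k"
  by (induction k) (auto simp: le_Suc_eq intro: pol_Suc simp del: pol.simps)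

lemma pol_zero [simp]: "\<zero> \<in> pol S y n"
  using pol_mono[of \<zero> 0 n] by simp

lemma pol_add: "a \<in> pol S y n \<Longrightarrow> b \<in> pol S y n \<Longrightarrow> a \<oplus> b \<in> pol S y n"
proof (induction n arbitrary: a b)
  case (Suc n)
  from Suc.prems obtain a1 a2 b1 b2 where *: "a1 \<in> S" "b1 \<in> S" "a2 \<in> pol S y n" "b2 \<in> pol S y n"
    "a = a1 \<otimes> y [^] n \<oplus> a2" "b = b1 \<otimes> y [^] n \<oplus> b2" by auto
  then have "a \<oplus> b = (a1 \<oplus> b1) \<otimes> y [^] n \<oplus> (a2 \<oplus> b2)" by (simp add: l_distr a_ac)
  moreover have "a1 \<oplus> b1 \<in> S" "a2 \<oplus> b2 \<in> pol S y n" using * Suc.IH by simp_all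
  ultimately show ?case by (simp only: pol_SucI)
qed simp

lemma pol_lmult: "s \<in> S \<Longrightarrow> a \<in> pol S y n \<Longrightarrow> s \<otimes> a \<in> pol S y n"
proof (induction n arbitrary: a)
  case (Suc n)
  from Suc.prems obtain a1 a2 where *: "a1 \<in> S" "a2 \<in> pol S y n"
    "a = a1 \<otimes> y [^] n \<oplus> a2" by auto
  then have "s \<otimes> a = (s \<otimes> a1) \<otimes> y [^] n \<oplus> (s \<otimes> a2)" using Suc.prems by (simp add: r_distr m_assoc)
  moreover have "s \<otimes> a1 \<in> S" "s \<otimes> a2 \<in> pol S y n" using * Suc by simp_all
  ultimately show ?case by (simp only: pol_SucI)
qed simp

lemma pol_rmult: "s \<in> S \<Longrightarrow> a \<in> pol S y n \<Longrightarrow> a \<otimes> s \<in> pol S y n"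
proof (induction n arbitrary: a)
  case (Suc n)
  from Suc.prems obtain a1 a2 where *: "a1 \<in> S" "a2 \<in> pol S y n"
    "a = a1 \<otimes> y [^] n \<oplus> a2" by auto
  then have "a \<otimes> s = (a1 \<otimes> s) \<otimes> y [^] n \<oplus> (a2 \<otimes> s)" using Suc.prems
    by (simp add: l_distr m_assoc comm_pow)
  moreover have "a1 \<otimes> s \<in> S" "a2 \<otimes> s \<in> pol S y n" using * Suc by simp_all
  ultimately show ?case by (simp only: pol_SucI)
qed simp

lemma pol_neg: "a \<in> pol S y n \<Longrightarrow> \<ominus> a \<in> pol S y n"
  using pol_lmult[of "\<ominus> \<one>" a n] by (simp add: l_minus)

lemma pol_minus: "a \<in> pol S y n \<Longrightarrow> b \<in> pol S y n \<Longrightarrow> a \<ominus> b \<in> pol S y n"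
  by (simp add: a_minus_def pol_add pol_neg)

lemma pol_shift: "a \<in> pol S y n \<Longrightarrow> a \<otimes> y \<in> pol S y (Suc n)"
proof (induction n arbitrary: a)
  case 0
  then show ?case by (auto intro!: exI[of _ \<zero>])
next
  case (Suc n)
  from Suc.prems obtain a1 a2 where *: "a1 \<in> S" "a2 \<in> pol S y n"
    "a = a1 \<otimes> y [^] n \<oplus> a2" by auto
  then have "a \<otimes> y = a1 \<otimes> y [^] Suc n \<oplus> (a2 \<otimes> y)" by (simp add: l_distr m_assoc)
  then show ?case using Suc.IH * by (simp only: pol_SucI)
qed

lemma pol_shifts: "a \<in> pol S y n \<Longrightarrow> a \<otimes> y [^] k \<in> pol S y (n + k)"
proof (induction k)
  case (Suc k)
  then have "(a \<otimes> y [^] k) \<otimes> y \<in> pol S y (Suc (n + k))" by (intro pol_shift) simp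
  then show ?case using Suc by (simp add: m_assoc del: pol.simps)
qed simp

lemma pol_comm: "a \<in> pol S y n \<Longrightarrow> a \<otimes> y = y \<otimes> a"
proof (induction n arbitrary: a)
  case (Suc n)
  from Suc.prems obtain a1 a2 where *: "a1 \<in> S" "a2 \<in> pol S y n"
    "a = a1 \<otimes> y [^] n \<oplus> a2" by auto
  have "y [^] n \<otimes> y = y \<otimes> y [^] n" by (metis nat_pow_Suc nat_pow_Suc2 y)
  then have "a1 \<otimes> y [^] n \<otimes> y = y \<otimes> (a1 \<otimes> y [^] n)"
    using * by (simp add: m_assoc) (simp add: comm flip: m_assoc)
  then show ?case using * Suc.IH by (simp add: l_distr r_distr)
qed simp

lemma pol_comm_pow: "a \<in> pol S y n \<Longrightarrow> a \<otimes> y [^] (k::nat) = y [^] k \<otimes> a"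
proof (induction k)
  case (Suc k)
  then have "a \<otimes> y [^] Suc k = y [^] k \<otimes> a \<otimes> y" by (simp flip: m_assoc)
  then show ?case using Suc.prems by (simp add: m_assoc pol_comm)
qed simp

lemma pol_mult: "a \<in> pol S y n \<Longrightarrow> b \<in> pol S y k \<Longrightarrow> a \<otimes> b \<in> pol S y (n + k)"
proof (induction n arbitrary: a)
  case (Suc n)
  from Suc.prems obtain a1 a2 where *: "a1 \<in> S" "a2 \<in> pol S y n"
    "a = a1 \<otimes> y [^] n \<oplus> a2" by auto
  then have "a \<otimes> b = a1 \<otimes> (b \<otimes> y [^] n) \<oplus> a2 \<otimes> b"
    using Suc.prems by (simp add: l_distr m_assoc pol_comm_pow)
  moreover have "a1 \<otimes> (b \<otimes> y [^] n) \<in> pol S y (Suc n + k)"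
    by (rule pol_mono[of _ "k + n"]) (use * pol_lmult pol_shifts Suc.prems in auto)
  moreover have "a2 \<otimes> b \<in> pol S y (Suc n + k)"
    by (rule pol_mono[of _ "n + k"]) (use * Suc in auto)
  ultimately show ?case by (simp only: pol_add)
qed simp

lemma S_pol: "s \<in> S \<Longrightarrow> s \<in> pol S y (Suc 0)"
  by (auto intro!: exI[of _ s])

lemma polysI: "a \<in> pol S y n \<Longrightarrow> a \<in> polys S y"
  by (auto simp: polys_def)

lemma S_polys: "s \<in> S \<Longrightarrow> s \<in> polys S y"
  using S_pol polysI by blast

lemma y_polys: "y \<in> polys S y"
  using pol_shift[OF S_pol[OF S_closed(2)]] by (auto simp: polys_def simp del: pol.simps)

lemma polys_obtain2:
  assumes "a \<in> polys S y" "b \<in> polys S y"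
  obtains n where "a \<in> pol S y n" "b \<in> pol S y n"
proof -
  obtain i j where "a \<in> pol S y i" "b \<in> pol S y j" using assms by (auto simp: polys_def)
  then have "a \<in> pol S y (max i j)" "b \<in> pol S y (max i j)" using pol_mono by auto
  then show ?thesis using that by blast
qed

lemma polys_subring: "subring (polys S y) R"
proof (rule subringI)
  fix a b assume ab: "a \<in> polys S y" "b \<in> polys S y"
  then show "a \<oplus> b \<in> polys S y" by (metis polys_obtain2 pol_add polysI)
  show "a \<otimes> b \<in> polys S y" by (metis ab polys_obtain2 pol_mult polysI)
next
  fix a assume "a \<in> polys S y"
  then show "\<ominus> a \<in> polys S y" unfolding polys_def using pol_neg by blast
qed (auto simp: S_polys, auto simp: polys_def)

lemma polys_minimal:
  assumes T: "subring T R" "S \<subseteq> T" "y \<in> T"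
  shows "polys S y \<subseteq> T"
proof -
  note cl = subringE(2,3,6,7)[OF T(1)]
  have p: "y [^] (n::nat) \<in> T" for n
    using T(1,3) by (rule subring_pow)
  have "a \<in> T" if "a \<in> pol S y n" for a n
    using that
  proof (induction n arbitrary: a)
    case (Suc n)
    then obtain s b where "s \<in> S" "b \<in> pol S y n" "a = s \<otimes> y [^] n \<oplus> b" by auto
    then show ?case using Suc.IH p cl T(2) by blast
  qed (simp add: cl)
  then show ?thesis by (auto simp: polys_def)
qed

lemma pol_leading:
  assumes "a \<in> pol S y n" "a \<noteq> \<zero>"
  obtains k s b where "k < n" "s \<in> S" "s \<noteq> \<zero>" "b \<in> pol S y k" "a = s \<otimes> y [^] k \<oplus> b"
  using assms
proof (induction n arbitrary: thesis)
  case (Suc n)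
  from Suc.prems(2) obtain a1 a2 where *: "a1 \<in> S" "a2 \<in> pol S y n"
    "a = a1 \<otimes> y [^] n \<oplus> a2" by auto
  show ?case
  proof (cases "a1 = \<zero>")
    case True
    then have "a \<in> pol S y n" using * by simp
    then show ?thesis using Suc.IH Suc.prems by (metis less_Suc_eq)
  next
    case False
    then show ?thesis using * Suc.prems(1) by blast
  qed
qed simp

text \<open>The recursion of \<open>pol\<close> peels off the top coefficient; arguments about the
  order at \<open>y = 0\<close> need the bottom one.\<close>

lemma pol_const:
  assumes "a \<in> pol S y (Suc n)"
  obtains c g where "c \<in> S" "g \<in> pol S y n" "a = c \<oplus> g \<otimes> y"
  using assms
proof (induction n arbitrary: a thesis)
  case 0
  then obtain s where "s \<in> S" "a = s \<otimes> \<one> \<oplus> \<zero>" by auto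
  then show ?case using 0(1)[of s \<zero>] by simp
next
  case (Suc n)
  obtain s b where sb: "s \<in> S" "b \<in> pol S y (Suc n)" "a = s \<otimes> y [^] Suc n \<oplus> b"
    using Suc.prems(2) by (subst (asm) (2) pol.simps) blast
  obtain c g where cg: "c \<in> S" "g \<in> pol S y n" "b = c \<oplus> g \<otimes> y" using Suc.IH sb(2) by blast
  have "a = c \<oplus> (s \<otimes> y [^] n \<oplus> g) \<otimes> y"
    using sb(1) cg(1,2) unfolding sb(3) cg(3) by (simp add: l_distr m_assoc a_ac)
  moreover have "s \<otimes> y [^] n \<oplus> g \<in> pol S y (Suc n)" using sb cg pol_SucI by blast
  ultimately show ?case using Suc.prems(1) cg(1) by blast
qed

text \<open>The exponent \<open>e\<close> is the order of vanishing at \<open>y = 0\<close>.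
  Dividing by \<open>y\<close> while the constant term is zero lowers the degree bound, so the
  process stops.\<close>

lemma pol_order:
  assumes "a \<in> pol S y n" "a \<noteq> \<zero>"
  obtains e c g where "c \<in> S" "c \<noteq> \<zero>" "g \<in> polys S y" "a = (c \<oplus> g \<otimes> y) \<otimes> y [^] (e::nat)"
  using assms
proof (induction n arbitrary: a thesis)
  case (Suc n)
  obtain c g where cg: "c \<in> S" "g \<in> pol S y n" "a = c \<oplus> g \<otimes> y" using Suc.prems(2) pol_const by blast
  show ?case
  proof (cases "c = \<zero>")
    case True
    then have "a = g \<otimes> y" "g \<noteq> \<zero>" using cg Suc.prems(3) by auto
    then obtain c' g' e where *: "c' \<in> S" "c' \<noteq> \<zero>" "g' \<in> polys S y"
      "g = (c' \<oplus> g' \<otimes> y) \<otimes> y [^] (e::nat)" using Suc.IH[OF _ cg(2)] by blast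
    have "a = (c' \<oplus> g' \<otimes> y) \<otimes> y [^] Suc e"
      using *(1,3) subringE(1)[OF polys_subring] unfolding \<open>a = g \<otimes> y\<close> *(4)
      by (simp add: m_assoc subset_iff)
    then show ?thesis using Suc.prems(1) * by blast
  next
    case False
    have "a = (c \<oplus> g \<otimes> y) \<otimes> y [^] (0::nat)" using cg by simp
    then show ?thesis using Suc.prems(1) cg False polysI by blast
  qed
qed simp

text \<open>Pseudo-division: a left multiple of \<open>a\<close> is reduced modulo a left multiple of \<open>b\<close>
  by matching leading coefficients with the Ore condition of \<open>S\<close>.\<close>

lemma ore_polys:
  assumes "left_ore S" and units: "polys S y - {\<zero>} \<subseteq> Units R" and one: "\<one> \<noteq> \<zero>"
  shows "left_ore (polys S y)"
proof -
  interpret P: subring "polys S y" R by (rule polys_subring)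
  note Pcl = subringE[OF polys_subring]
  have dom: "a \<otimes> b \<noteq> \<zero>" if "a \<in> polys S y" "b \<in> polys S y" "a \<noteq> \<zero>" "b \<noteq> \<zero>" for a b
  proof
    assume "a \<otimes> b = \<zero>"
    have "a \<in> Units R" using that units by blast
    moreover have "b \<in> carrier R" using that Pcl(1) by blast
    ultimately have "inv a \<otimes> (a \<otimes> b) = b" by (simp add: Units_closed flip: m_assoc)
    with \<open>a \<otimes> b = \<zero>\<close> \<open>a \<in> Units R\<close> that show False by simp
  qed
  define W where "W a b \<longleftrightarrow> (\<exists>c\<in>polys S y. \<exists>d\<in>polys S y. (c \<noteq> \<zero> \<or> d \<noteq> \<zero>) \<and> c \<otimes> a = d \<otimes> b)" for a b
  have W_sym: "W a b \<longleftrightarrow> W b a" for a b unfolding W_def by metis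
  \<comment> \<open>Induction on a bound for the sum of the two degree bounds; each reduction lowers
    the larger one.\<close>
  have main: "W a b" if "a \<in> pol S y i" "b \<in> pol S y j" "j \<le> i" "i + j \<le> n" for a b i j n
    using that
  proof (induction n arbitrary: a b i j rule: less_induct)
    case (less n)
    have IH: "W a' b'" if "a' \<in> pol S y i'" "b' \<in> pol S y j'" "i' + j' < i + j" for a' b' i' j'
    proof (cases "j' \<le> i'")
      case True
      then show ?thesis using less.IH[of "i' + j'" a' i' b' j'] that less.prems by auto
    next
      case False
      then have "W b' a'" using less.IH[of "i' + j'" b' j' a' i'] that less.prems by auto
      then show ?thesis using W_sym by blast
    qed
    show ?case
    proof (cases "a = \<zero> \<or> b = \<zero>")
      case True
      have "a \<in> carrier R" "b \<in> carrier R" using less.prems(1,2) by simp_all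
      then have "\<one> \<otimes> a = \<zero> \<otimes> b \<or> \<zero> \<otimes> a = \<one> \<otimes> b" using True by auto
      then show ?thesis unfolding W_def using Pcl(2,3) one by metis
    next
      case False
      obtain k s a' where a: "k < i" "s \<in> S" "s \<noteq> \<zero>" "a' \<in> pol S y k" "a = s \<otimes> y [^] k \<oplus> a'"
        using pol_leading less.prems(1) False by metis
      obtain l t b' where b: "l < j" "t \<in> S" "t \<noteq> \<zero>" "b' \<in> pol S y l" "b = t \<otimes> y [^] l \<oplus> b'"
        using pol_leading less.prems(2) False by metis
      \<comment> \<open>Stated for fresh variables, so that it also applies with the roles of the
        two polynomials exchanged.\<close>
      have step: "W a b" if ll: "l \<le> k" "k < i" "l < j" "i + j \<le> n0"
          and a: "s \<in> S" "s \<noteq> \<zero>" "a' \<in> pol S y k" "a = s \<otimes> y [^] k \<oplus> a'"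
          and b: "t \<in> S" "t \<noteq> \<zero>" "b' \<in> pol S y l" "b = t \<otimes> y [^] l \<oplus> b'"
          and IH: "\<And>a' b'. a' \<in> pol S y k \<Longrightarrow> b' \<in> pol S y (Suc l) \<Longrightarrow> W a' b'"
        for k l s t a a' b b' i j n0
      proof -
        obtain c d where cd: "c \<in> S" "d \<in> S" "c \<noteq> \<zero> \<or> d \<noteq> \<zero>" "c \<otimes> s = d \<otimes> t"
          using assms(1) a b unfolding left_ore_def by blast
        define a1 where "a1 = c \<otimes> a \<oplus> \<ominus> (d \<otimes> y [^] (k - l) \<otimes> b)"
        have ca[simp]: "a \<in> carrier R" "b \<in> carrier R" "c \<in> carrier R" "d \<in> carrier R"
          "s \<in> carrier R" "t \<in> carrier R" "a' \<in> carrier R" "b' \<in> carrier R"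
          using a b cd by simp_all
        have yy: "y [^] (k - l) \<otimes> (t \<otimes> y [^] l) = t \<otimes> y [^] k"
        proof -
          have "y [^] (k - l) \<otimes> (t \<otimes> y [^] l) = (t \<otimes> y [^] (k - l)) \<otimes> y [^] l"
            by (simp only: comm_pow[OF b(1), of "k - l"]) (simp add: m_assoc)
          also have "\<dots> = t \<otimes> y [^] k" using ll by (simp add: m_assoc nat_pow_mult)
          finally show ?thesis .
        qed
        have "d \<otimes> y [^] (k - l) \<otimes> b = d \<otimes> (y [^] (k - l) \<otimes> (t \<otimes> y [^] l)) \<oplus> d \<otimes> (b' \<otimes> y [^] (k - l))"
          unfolding b by (simp add: m_assoc r_distr pol_comm_pow[OF b(3)])
        also have "\<dots> = c \<otimes> s \<otimes> y [^] k \<oplus> d \<otimes> (b' \<otimes> y [^] (k - l))"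
          unfolding yy by (simp add: cd(4) flip: m_assoc)
        finally have e1: "d \<otimes> y [^] (k - l) \<otimes> b = c \<otimes> s \<otimes> y [^] k \<oplus> d \<otimes> (b' \<otimes> y [^] (k - l))" .
        have "c \<otimes> a = c \<otimes> s \<otimes> y [^] k \<oplus> c \<otimes> a'"
          unfolding a by (simp add: m_assoc r_distr)
        then have "a1 = c \<otimes> a' \<oplus> \<ominus> (d \<otimes> (b' \<otimes> y [^] (k - l)))"
          unfolding a1_def e1 by (simp add: minus_add a_ac r_neg2)
        moreover have "b' \<otimes> y [^] (k - l) \<in> pol S y k"
          using pol_shifts[OF b(3), of "k - l"] ll by simp
        ultimately have "a1 \<in> pol S y k" using cd a by (simp add: pol_add pol_neg pol_lmult)
        moreover have "b \<in> pol S y (Suc l)" using b by auto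
        ultimately have "W a1 b" by (rule IH)
        then obtain c' d' where c'd': "c' \<in> polys S y" "d' \<in> polys S y" "c' \<noteq> \<zero> \<or> d' \<noteq> \<zero>"
          "c' \<otimes> a1 = d' \<otimes> b" unfolding W_def by blast
        have [simp]: "c' \<in> carrier R" "d' \<in> carrier R" using c'd' Pcl(1) by auto
        have ypow: "y [^] (k - l) \<in> polys S y"
          by (rule subring_pow[OF polys_subring y_polys])
        have "c' \<otimes> c \<otimes> a = c' \<otimes> a1 \<oplus> c' \<otimes> (d \<otimes> y [^] (k - l) \<otimes> b)"
          unfolding a1_def by (simp add: r_distr r_minus a_ac m_assoc r_neg1)
             (simp add: r_neg)
        also have "\<dots> = (d' \<oplus> c' \<otimes> (d \<otimes> y [^] (k - l))) \<otimes> b"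
          by (simp add: c'd' l_distr m_assoc)
        finally have eq: "c' \<otimes> c \<otimes> a = (d' \<oplus> c' \<otimes> (d \<otimes> y [^] (k - l))) \<otimes> b" .
        have c0: "c \<noteq> \<zero>"
        proof
          assume "c = \<zero>"
          then have "d \<otimes> t = \<zero>" using cd by simp
          then show False using dom[of d t] cd b \<open>c = \<zero>\<close> S_polys by auto
        qed
        \<comment> \<open>If \<open>c'\<close> vanishes, the second coefficient is just
          \<open>d'\<close>, which is then non-zero; otherwise \<open>c' \<otimes> c\<close> is a
          product of non-zero elements.\<close>
        have "c' \<otimes> c \<noteq> \<zero> \<or> d' \<oplus> c' \<otimes> (d \<otimes> y [^] (k - l)) \<noteq> \<zero>"
          using dom[of c' c] c0 c'd' cd S_polys by (cases "c' = \<zero>") auto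
        moreover have "c' \<otimes> c \<in> polys S y" "d' \<oplus> c' \<otimes> (d \<otimes> y [^] (k - l)) \<in> polys S y"
          using c'd' cd S_polys ypow by (auto intro!: Pcl)
        ultimately show ?thesis unfolding W_def using eq by blast
      qed
      show ?thesis
      proof (cases "l \<le> k")
        case True
        show ?thesis
        proof (rule step[OF True a(1) b(1) less.prems(4) a(2-5) b(2-5)])
          show "W a' b'" if "a' \<in> pol S y k" "b' \<in> pol S y (Suc l)" for a' b'
            using IH[OF that] a(1) b(1) by simp
        qed
      next
        case False
        have "W b a"
        proof (rule step[OF _ b(1) a(1) _ b(2-5) a(2-5)])
          show "W a' b'" if "a' \<in> pol S y l" "b' \<in> pol S y (Suc k)" for a' b'
          proof -
            have "W b' a'" using IH[OF that(2,1)] a(1) b(1) by simp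
            then show ?thesis using W_sym by blast
          qed
          show "k \<le> l" "j + i \<le> n" using False less.prems by simp_all
        qed
        then show ?thesis using W_sym by blast
      qed
    qed
  qed
  show ?thesis unfolding left_ore_def
  proof (intro ballI)
    fix a b assume "a \<in> polys S y" "b \<in> polys S y"
    then obtain n where "a \<in> pol S y n" "b \<in> pol S y n" by (rule polys_obtain2)
    then have "W a b" using main by blast
    then show "\<exists>c\<in>polys S y. \<exists>d\<in>polys S y. (c \<noteq> \<zero> \<or> d \<noteq> \<zero>) \<and> c \<otimes> a = d \<otimes> b"
      unfolding W_def .
  qed
qed

end

section \<open>Division rings of left fractions inside a ring\<close>

locale ore_set = ring R for R (structure) +
  fixes S
  assumes S: "subring S R" and ore: "left_ore S"
    and units: "s \<in> S \<Longrightarrow> s \<noteq> \<zero> \<Longrightarrow> s \<in> Units R" and one_not_zero: "\<one> \<noteq> \<zero>"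
begin

lemma S_carrier [simp]: "s \<in> S \<Longrightarrow> s \<in> carrier R"
  using subringE(1)[OF S] by blast

lemma S_closed [simp]: "\<zero> \<in> S" "\<one> \<in> S" "a \<in> S \<Longrightarrow> \<ominus> a \<in> S"
  "a \<in> S \<Longrightarrow> b \<in> S \<Longrightarrow> a \<otimes> b \<in> S" "a \<in> S \<Longrightarrow> b \<in> S \<Longrightarrow> a \<oplus> b \<in> S"
  using subringE(2,3,5,6,7)[OF S] by auto

lemma cancel_zero:
  assumes "a \<in> S" "a \<noteq> \<zero>" "x \<in> carrier R" "a \<otimes> x = \<zero>"
  shows "x = \<zero>"
proof -
  have "a \<in> Units R" using assms units by blast
  then have "x = inv a \<otimes> (a \<otimes> x)" using assms(1-3) by (simp flip: m_assoc)
  also have "\<dots> = \<zero>" using assms(4) \<open>a \<in> Units R\<close> by simp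
  finally show ?thesis .
qed

lemma ore_obtain:
  assumes "a \<in> S" "b \<in> S" "a \<noteq> \<zero>"
  obtains c d where "c \<in> S" "d \<in> S" "c \<noteq> \<zero>" "c \<otimes> b = d \<otimes> a"
proof -
  obtain c d where *: "c \<in> S" "d \<in> S" "c \<noteq> \<zero> \<or> d \<noteq> \<zero>" "c \<otimes> b = d \<otimes> a"
    using ore assms unfolding left_ore_def by blast
  moreover have "c \<noteq> \<zero>"
  proof
    assume "c = \<zero>"
    then have "d \<noteq> \<zero>" "d \<otimes> a = \<zero>" using *(3,4) assms(2) by (simp_all flip: *(4))
    then show False using cancel_zero[of d a] *(2) assms by simp
  qed
  ultimately show ?thesis using that by blast
qed

lemma fracs_carrier: "fracs S \<subseteq> carrier R"
  by (auto simp: fracs_def)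

lemma S_fracs: "s \<in> S \<Longrightarrow> s \<in> fracs S"
  using one_not_zero by (auto simp: fracs_def intro!: bexI[of _ \<one>])

lemma fracs_subring: "subring (fracs S) R"
proof (rule subringI)
  fix x assume "x \<in> fracs S"
  then show "\<ominus> x \<in> fracs S" by (auto simp: fracs_def r_minus)
next
  fix x x' assume "x \<in> fracs S" "x' \<in> fracs S"
  then obtain a a' where a: "x \<in> carrier R" "x' \<in> carrier R" "a \<in> S" "a \<noteq> \<zero>" "a \<otimes> x \<in> S"
    "a' \<in> S" "a' \<noteq> \<zero>" "a' \<otimes> x' \<in> S" by (auto simp: fracs_def)
  \<comment> \<open>The Ore condition produces a common left denominator
    \<open>c \<otimes> a = d \<otimes> a'\<close> for the sum.\<close>
  obtain c d where cd: "c \<in> S" "d \<in> S" "c \<noteq> \<zero>" "c \<otimes> a = d \<otimes> a'"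
    using ore_obtain[of a' a] a by metis
  have "c \<otimes> a \<noteq> \<zero>" using cancel_zero[of c a] a(3,4) cd(1,3) by auto
  moreover have "(c \<otimes> a) \<otimes> (x \<oplus> x') = c \<otimes> (a \<otimes> x) \<oplus> d \<otimes> (a' \<otimes> x')"
    using a cd by (simp add: r_distr m_assoc) (simp flip: m_assoc)
  ultimately show "x \<oplus> x' \<in> fracs S"
    using a cd by (auto simp: fracs_def intro!: bexI[of _ "c \<otimes> a"])
  \<comment> \<open>For the product, the numerator \<open>a \<otimes> x\<close> has to be moved past
    the denominator \<open>a'\<close> of \<open>x'\<close>.\<close>
  obtain c d where cd: "c \<in> S" "d \<in> S" "c \<noteq> \<zero>" "c \<otimes> (a \<otimes> x) = d \<otimes> a'"
    using ore_obtain[of a' "a \<otimes> x"] a by metis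
  have "c \<otimes> a \<noteq> \<zero>" using cancel_zero[of c a] a(3,4) cd(1,3) by auto
  moreover have "(c \<otimes> a) \<otimes> (x \<otimes> x') = d \<otimes> (a' \<otimes> x')"
  proof -
    have "(c \<otimes> a) \<otimes> (x \<otimes> x') = (c \<otimes> (a \<otimes> x)) \<otimes> x'"
      using a cd(1) by (simp add: m_assoc)
    also have "\<dots> = d \<otimes> (a' \<otimes> x')" unfolding cd(4) using a cd(2) by (simp add: m_assoc)
    finally show ?thesis .
  qed
  ultimately show "x \<otimes> x' \<in> fracs S"
    using a cd by (auto simp: fracs_def intro!: bexI[of _ "c \<otimes> a"])
qed (use S_fracs fracs_carrier in auto)

text \<open>With a denominator \<open>a\<close>, the element \<open>x\<close> is the product of the
  units \<open>inv a\<close> and \<open>a \<otimes> x\<close>, and \<open>a \<otimes> x\<close> is a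
  denominator of its inverse.\<close>

lemma fracs_unit:
  assumes "x \<in> fracs S" "x \<noteq> \<zero>"
  shows "x \<in> Units R" "inv x \<in> fracs S"
proof -
  obtain a where a: "x \<in> carrier R" "a \<in> S" "a \<noteq> \<zero>" "a \<otimes> x \<in> S"
    using assms by (auto simp: fracs_def)
  have nz: "a \<otimes> x \<noteq> \<zero>" using cancel_zero[of a x] a assms by blast
  have ua: "a \<in> Units R" and ub: "a \<otimes> x \<in> Units R" using units a nz by auto
  have x: "x = inv a \<otimes> (a \<otimes> x)" using a ua by (simp flip: m_assoc)
  have "inv a \<otimes> (a \<otimes> x) \<in> Units R" using ua ub by (rule Units_m_closed[OF Units_inv_Units])
  then show ux: "x \<in> Units R" by (subst x)
  have "(a \<otimes> x) \<otimes> inv x = a" using a ux by (simp add: m_assoc)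
  then show "inv x \<in> fracs S" using nz a ux unfolding fracs_def
    by (intro CollectI conjI bexI[of _ "a \<otimes> x"]) auto
qed

abbreviation "Q \<equiv> R\<lparr>carrier := fracs S\<rparr>"

lemma fracs_inv:
  assumes "x \<in> fracs S" "x \<noteq> \<zero>"
  shows "inv\<^bsub>Q\<^esub> x = inv x" "x \<in> Units Q"
proof -
  interpret Q: ring Q using subring_is_ring fracs_subring .
  have *: "x \<in> Units R" "inv x \<in> fracs S" using fracs_unit assms by auto
  then show "inv\<^bsub>Q\<^esub> x = inv x" using Q.inv_unique'[of x "inv x"] assms by simp
  show "x \<in> Units Q" unfolding Units_def using * assms by (auto intro!: bexI[of _ "inv x"])
qed

lemma fracs_skew_field: "skew_field Q"
proof -
  interpret Q: ring Q using subring_is_ring fracs_subring .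
  have "\<zero> \<notin> Units Q"
    using Q.Units_r_inv[of \<zero>] Q.Units_inv_closed[of \<zero>] Q.l_null one_not_zero by auto
  then have "Units Q = fracs S - {\<zero>}" using fracs_inv(2) by (auto simp: Units_def)
  then show ?thesis using one_not_zero by unfold_locales simp_all
qed

text \<open>Denominators are cleared coefficient by coefficient: \<open>s\<close> clears the lower
  terms, \<open>r\<close> clears \<open>s \<otimes> a\<close>, and left multiplication by
  \<open>r\<close> keeps the lower terms clear. This transports transcendence from \<open>S\<close>
  to its fractions.\<close>

lemma pol_denominator:
  assumes ad: "adjoin R S y" and "b \<in> pol (fracs S) y n"
  shows "\<exists>s\<in>S. s \<noteq> \<zero> \<and> s \<otimes> b \<in> pol S y n"
  using assms(2)
proof (induction n arbitrary: b)
  case 0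
  then show ?case using one_not_zero by (auto intro: bexI[of _ \<one>])
next
  case (Suc n)
  interpret adjoin R S y by (rule ad)
  obtain a b' where ab: "a \<in> fracs S" "b' \<in> pol (fracs S) y n" "b = a \<otimes> y [^] n \<oplus> b'" using Suc.prems by auto
  obtain s where s: "s \<in> S" "s \<noteq> \<zero>" "s \<otimes> b' \<in> pol S y n" using Suc.IH ab(2) by blast
  have ac: "a \<in> carrier R" using ab(1) fracs_carrier by blast
  have b'c: "b' \<in> carrier R"
  proof -
    have "pol (fracs S) y n \<subseteq> carrier R"
    proof (induction n)
      case (Suc n)
      then show ?case using fracs_carrier by (auto simp: subset_iff)
    qed simp
    then show ?thesis using ab(2) by blast
  qed
  have "s \<otimes> a \<in> fracs S" using subringE(6)[OF fracs_subring S_fracs[OF s(1)] ab(1)] .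
  then obtain r where r: "r \<in> S" "r \<noteq> \<zero>" "r \<otimes> (s \<otimes> a) \<in> S" unfolding fracs_def by blast
  have "r \<otimes> s \<noteq> \<zero>" using cancel_zero[OF r(1,2), of s] s by auto
  moreover have "r \<otimes> s \<otimes> b = (r \<otimes> (s \<otimes> a)) \<otimes> y [^] n \<oplus> r \<otimes> (s \<otimes> b')"
    unfolding ab(3) using r(1) s(1) ac b'c by (simp add: r_distr m_assoc)
  moreover have "r \<otimes> (s \<otimes> b') \<in> pol S y n" using pol_lmult[OF r(1) s(3)] .
  ultimately show ?case using r s pol_SucI by (intro bexI[of _ "r \<otimes> s"]) auto
qed

end

section \<open>Rigidity of towers over a field\<close>

text \<open>Transcendence is expressed through the leading coefficient, in the shape in which
  \<open>pol\<close> is defined. The condition \<open>q_char\<close> keeps the factor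
  \<open>r\<close> that appears on differentiating an \<open>r\<close>-th power from vanishing when
  \<open>r = q k\<close>.\<close>

locale field_tower = field L for L (structure) +
  fixes F and y :: "nat \<Rightarrow> 'a" and q :: "nat \<Rightarrow> nat" and \<rho> :: "nat \<Rightarrow> 'a"
  assumes F: "subfield F L" and y [simp]: "y k \<in> carrier L"
    and \<rho>: "\<rho> k \<in> F" "\<rho> k \<noteq> \<zero>"
    and y_rec: "y k = y (Suc k) [^] q k \<ominus> \<rho> k"
    and q_prime: "prime (q k)" and q_inj: "inj q" and q_char: "add_pow L (q k) \<one> \<noteq> \<zero>"
    and transc: "\<lbrakk>a \<in> F; b \<in> pol F (y k) n; a \<otimes> y k [^] n \<oplus> b = \<zero>\<rbrakk> \<Longrightarrow> a = \<zero>"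
begin

abbreviation "B k \<equiv> polys F (y k)"

lemma F_subring: "subring F L"
  using subfieldE(1)[OF F] subcring.axioms(1) by blast

lemma F_carrier [simp]: "a \<in> F \<Longrightarrow> a \<in> carrier L"
  using subfieldE(3)[OF F] by blast

sublocale adj: adjoin L F "y k" for k
  by (intro adjoin.intro adjoin_axioms.intro ring_axioms F_subring y) (simp add: m_comm)

lemma F_inv: "a \<in> F \<Longrightarrow> a \<noteq> \<zero> \<Longrightarrow> inv a \<in> F \<and> inv a \<noteq> \<zero> \<and> inv a \<otimes> a = \<one>"
  using subfield_m_inv[OF F] by auto

lemma F_pow: "a \<in> F \<Longrightarrow> a [^] (n::nat) \<in> F"
  using subring_pow[OF F_subring] .

lemmas B_closed = subringE(2,3,5,6,7)[OF adj.polys_subring]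

lemma B_carrier [simp]: "a \<in> B k \<Longrightarrow> a \<in> carrier L"
  using subringE(1)[OF adj.polys_subring] by blast

lemma B_pow: "a \<in> B k \<Longrightarrow> a [^] (n::nat) \<in> B k"
  using subring_pow[OF adj.polys_subring] .

lemma B_minus: "a \<in> B k \<Longrightarrow> b \<in> B k \<Longrightarrow> a \<ominus> b \<in> B k"
  by (simp add: a_minus_def B_closed)

lemma y_pow: "y (Suc k) [^] q k = y k \<oplus> \<rho> k"
  using y_rec[of k] \<rho>(1)[of k] by (simp add: a_minus_def a_assoc l_neg)

lemma y_pow_B: "y (Suc k) [^] q k \<in> B k"
  unfolding y_pow using \<rho>(1) by (intro B_closed adj.y_polys adj.S_polys)

section \<open>Degrees and leading coefficients\<close>

definition lead :: "nat \<Rightarrow> 'a \<Rightarrow> nat \<Rightarrow> 'a \<Rightarrow> bool" where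
  "lead k a n s \<longleftrightarrow> s \<in> F \<and> s \<noteq> \<zero> \<and> (\<exists>b\<in>pol F (y k) n. a = s \<otimes> y k [^] n \<oplus> b)"

lemma lead_pol: "lead k a n s \<Longrightarrow> a \<in> pol F (y k) (Suc n)"
  unfolding lead_def by auto

lemma lead_B: "lead k a n s \<Longrightarrow> a \<in> B k"
  using lead_pol adj.polysI by blast

lemma lead_obtain:
  assumes "a \<in> B k" "a \<noteq> \<zero>"
  obtains n s where "lead k a n s"
proof -
  obtain n where "a \<in> pol F (y k) n" using assms by (auto simp: polys_def)
  with assms show ?thesis using adj.pol_leading[of a k n] that unfolding lead_def by metis
qed

text \<open>If \<open>n\<close> were at least \<open>m\<close>, then \<open>a \<ominus> a\<close>
  would exhibit zero as a polynomial with leading coefficient \<open>s\<close>, against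
  transcendence.\<close>

lemma lead_deg_bound:
  assumes "lead k a n s" "a \<in> pol F (y k) m"
  shows "n < m"
proof (rule ccontr)
  assume "\<not> n < m"
  then have a: "a \<in> pol F (y k) n" using assms(2) adj.pol_mono by simp
  obtain b where b: "s \<in> F" "s \<noteq> \<zero>" "b \<in> pol F (y k) n" "a = s \<otimes> y k [^] n \<oplus> b"
    using assms(1) unfolding lead_def by blast
  have "s \<otimes> y k [^] n \<oplus> (b \<ominus> a) = \<zero>"
    using b(1,3) unfolding b(4) by (simp add: a_minus_def minus_add a_ac r_neg1 r_neg r_neg2)
  moreover have "b \<ominus> a \<in> pol F (y k) n" using a b(3) by (rule adj.pol_minus[rotated])
  ultimately show False using transc b(1,2) by blast
qed

lemma lead_nonzero: "lead k a n s \<Longrightarrow> a \<noteq> \<zero>"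
  using lead_deg_bound[of k \<zero> n s 0] by auto

lemma lead_unique:
  assumes "lead k a n s" "lead k a m t"
  shows "n = m" "s = t"
proof -
  show nm: "n = m"
    using lead_deg_bound[OF assms(1) lead_pol[OF assms(2)]]
      lead_deg_bound[OF assms(2) lead_pol[OF assms(1)]] by simp
  obtain b where b: "s \<in> F" "b \<in> pol F (y k) n" "a = s \<otimes> y k [^] n \<oplus> b"
    using assms(1) unfolding lead_def by blast
  obtain c where c: "t \<in> F" "c \<in> pol F (y k) n" "a = t \<otimes> y k [^] n \<oplus> c"
    using assms(2) nm unfolding lead_def by blast
  have cc [simp]: "b \<in> carrier L" "c \<in> carrier L" "s \<in> carrier L" "t \<in> carrier L"
    using b c adj.pol_carrier by auto
  have "(s \<ominus> t) \<otimes> y k [^] n \<oplus> (b \<ominus> c) = (s \<otimes> y k [^] n \<oplus> b) \<ominus> (t \<otimes> y k [^] n \<oplus> c)"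
    by (simp add: a_minus_def minus_add l_distr l_minus a_ac)
  also have "\<dots> = \<zero>" using b(3) c(3) by (metis a_minus_def cc add.m_closed m_closed nat_pow_closed r_neg y)
  finally have "s \<ominus> t = \<zero>"
    using transc[of "s \<ominus> t" "b \<ominus> c" k n] b c by (simp add: a_minus_def adj.pol_add adj.pol_neg)
  then show "s = t" by simp
qed

lemma lead_const: "a \<in> F \<Longrightarrow> a \<noteq> \<zero> \<Longrightarrow> lead k a 0 a"
  unfolding lead_def by simp

lemma lead_0: "lead k a 0 s \<Longrightarrow> a \<in> F \<and> a = s"
  unfolding lead_def by auto

lemma lead_y: "lead k (y k) 1 \<one>"
proof -
  have "y k = \<one> \<otimes> y k [^] (1::nat) \<oplus> \<zero>" by simp
  then show ?thesis unfolding lead_def using adj.pol_zero adj.S_closed(2) one_not_zero by blast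
qed

lemma lead_add:
  assumes "lead k a n s" "b \<in> pol F (y k) n"
  shows "lead k (a \<oplus> b) n s"
proof -
  obtain c where c: "s \<in> F" "s \<noteq> \<zero>" "c \<in> pol F (y k) n" "a = s \<otimes> y k [^] n \<oplus> c"
    using assms(1) unfolding lead_def by blast
  then have "a \<oplus> b = s \<otimes> y k [^] n \<oplus> (c \<oplus> b)" using assms(2) by (simp add: a_assoc)
  moreover have "c \<oplus> b \<in> pol F (y k) n" using c(3) assms(2) by (rule adj.pol_add)
  ultimately show ?thesis using c unfolding lead_def by blast
qed

lemma lead_mult:
  assumes "lead k a n s" "lead k b m t"
  shows "lead k (a \<otimes> b) (n + m) (s \<otimes> t)"
proof -
  obtain a' where a: "s \<in> F" "s \<noteq> \<zero>" "a' \<in> pol F (y k) n" "a = s \<otimes> y k [^] n \<oplus> a'"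
    using assms(1) unfolding lead_def by blast
  obtain b' where b: "t \<in> F" "t \<noteq> \<zero>" "b' \<in> pol F (y k) m" "b = t \<otimes> y k [^] m \<oplus> b'"
    using assms(2) unfolding lead_def by blast
  have cc [simp]: "a' \<in> carrier L" "b' \<in> carrier L" "s \<in> carrier L" "t \<in> carrier L"
    using a b adj.pol_carrier by auto
  have e: "a \<otimes> b = (s \<otimes> t) \<otimes> y k [^] (n + m) \<oplus>
      ((s \<otimes> (b' \<otimes> y k [^] n) \<oplus> t \<otimes> (a' \<otimes> y k [^] m)) \<oplus> a' \<otimes> b')"
    unfolding a(4) b(4) by (simp add: l_distr r_distr m_ac a_ac flip: nat_pow_mult)
  have "s \<otimes> (b' \<otimes> y k [^] n) \<in> pol F (y k) (n + m)"
    using adj.pol_lmult[OF a(1) adj.pol_shifts[OF b(3), of n]] by (simp add: add.commute)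
  moreover have "t \<otimes> (a' \<otimes> y k [^] m) \<in> pol F (y k) (n + m)"
    using adj.pol_lmult[OF b(1) adj.pol_shifts[OF a(3), of m]] by simp
  moreover have "a' \<otimes> b' \<in> pol F (y k) (n + m)" using adj.pol_mult[OF a(3) b(3)] .
  ultimately have "(s \<otimes> (b' \<otimes> y k [^] n) \<oplus> t \<otimes> (a' \<otimes> y k [^] m)) \<oplus> a' \<otimes> b' \<in> pol F (y k) (n + m)"
    by (intro adj.pol_add)
  moreover have "s \<otimes> t \<noteq> \<zero>" using a b integral by force
  ultimately show ?thesis using e a(1) b(1) unfolding lead_def by auto
qed

lemma lead_pow: "lead k a n s \<Longrightarrow> lead k (a [^] (r::nat)) (r * n) (s [^] r)"
proof (induction r)
  case 0
  then show ?case using lead_const[of \<one> k] by simp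
next
  case (Suc r)
  then show ?case using lead_mult[of k "a [^] r" "r * n" "s [^] r" a n s] by (simp add: add.commute)
qed

lemma q_pos: "0 < q k"
  using q_prime prime_gt_0_nat by blast

lemma lead_step_y: "lead (Suc k) (y k) (q k) \<one>"
proof -
  have "lead (Suc k) (y (Suc k) [^] q k) (q k * 1) (\<one> [^] q k)" by (rule lead_pow[OF lead_y])
  moreover have "\<ominus> \<rho> k \<in> pol F (y (Suc k)) (q k)"
    by (rule adj.pol_mono[OF adj.S_pol]) (use \<rho> q_pos[of k] in auto)
  ultimately show ?thesis using lead_add[of "Suc k" _ "q k"] y_rec[of k] by (simp add: a_minus_def)
qed

lemma pol_step: "a \<in> pol F (y k) n \<Longrightarrow> a \<in> pol F (y (Suc k)) (q k * n)"
proof (induction n arbitrary: a)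
  case (Suc n)
  then obtain s b where sb: "s \<in> F" "b \<in> pol F (y k) n" "a = s \<otimes> y k [^] n \<oplus> b" by auto
  have "y k [^] n \<in> pol F (y (Suc k)) (Suc (n * q k))"
    using lead_pol[OF lead_pow[OF lead_step_y]] .
  then have "s \<otimes> y k [^] n \<in> pol F (y (Suc k)) (q k * Suc n)"
    by (rule adj.pol_mono[OF adj.pol_lmult[OF sb(1)]]) (use q_pos[of k] in auto)
  moreover have "b \<in> pol F (y (Suc k)) (q k * Suc n)"
    by (rule adj.pol_mono[OF Suc.IH[OF sb(2)]]) auto
  ultimately show ?case unfolding sb(3) by (rule adj.pol_add)
qed simp

text \<open>\<open>y k\<close> is monic of degree \<open>q k\<close> in \<open>y (Suc k)\<close>.
  Comparing degrees at two successive heights is what yields divisibility by \<open>q k\<close>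
  later on.\<close>

lemma lead_step:
  assumes "lead k a n s"
  shows "lead (Suc k) a (q k * n) s"
proof -
  obtain b where b: "s \<in> F" "s \<noteq> \<zero>" "b \<in> pol F (y k) n" "a = s \<otimes> y k [^] n \<oplus> b"
    using assms unfolding lead_def by blast
  have "lead (Suc k) (s \<otimes> y k [^] n) (0 + n * q k) (s \<otimes> \<one> [^] n)"
    using lead_mult[OF lead_const[OF b(1,2)] lead_pow[OF lead_step_y]] .
  then have "lead (Suc k) (s \<otimes> y k [^] n) (q k * n) s" using b(1) by (simp add: mult.commute)
  then show ?thesis unfolding b(4) by (rule lead_add[OF _ pol_step[OF b(3)]])
qed

lemma B_step: "B k \<subseteq> B (Suc k)"
  using pol_step by (auto simp: polys_def)

lemma B_mono: "k \<le> l \<Longrightarrow> B k \<subseteq> B l"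
  by (induction rule: dec_induct) (use B_step in blast)+

text \<open>Degrees add, so two factors of one both have degree zero.\<close>

lemma B_unit:
  assumes "a \<in> B k" "b \<in> B k" "a \<otimes> b = \<one>"
  shows "a \<in> F" "a \<noteq> \<zero>"
proof -
  have nz: "a \<noteq> \<zero>" "b \<noteq> \<zero>" using assms by auto
  obtain n s m t where "lead k a n s" "lead k b m t" using lead_obtain assms nz by metis
  from lead_mult[OF this] lead_const[of \<one> k] assms(3) have "n + m = 0"
    by (intro lead_unique(1)) auto
  with \<open>lead k a n s\<close> show "a \<in> F" using lead_0 by simp
  show "a \<noteq> \<zero>" by (fact nz)
qed

section \<open>Constant terms and orders of vanishing\<close>

definition cst :: "nat \<Rightarrow> 'a \<Rightarrow> 'a \<Rightarrow> bool" where
  "cst k a c \<longleftrightarrow> c \<in> F \<and> (\<exists>g\<in>B k. a = c \<oplus> g \<otimes> y k)"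

lemma cst_B: "cst k a c \<Longrightarrow> a \<in> B k"
  unfolding cst_def using B_closed(4,5) adj.S_polys adj.y_polys by blast

lemma cst_carrier: "cst k a c \<Longrightarrow> a \<in> carrier L \<and> c \<in> carrier L"
  using B_carrier[OF cst_B[of k a c]] by (auto simp: cst_def)

text \<open>A non-zero constant cannot equal a multiple of \<open>y k\<close>, whose degree is
  positive.\<close>

lemma cst_0_unique:
  assumes "cst k \<zero> c"
  shows "c = \<zero>"
proof (rule ccontr)
  assume c: "c \<noteq> \<zero>"
  obtain g where g: "c \<in> F" "g \<in> B k" "\<zero> = c \<oplus> g \<otimes> y k" using assms unfolding cst_def by blast
  have "c = \<ominus> g \<otimes> y k" using g by (metis B_carrier F_carrier l_minus m_closed minus_equality y)
  then have "lead k (\<ominus> g \<otimes> y k) 0 c" using lead_const g c by metis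
  moreover have "\<ominus> g \<noteq> \<zero>" using \<open>c = \<ominus> g \<otimes> y k\<close> c by auto
  then obtain n s where "lead k (\<ominus> g) n s" using lead_obtain[of "\<ominus> g" k] g B_closed by blast
  then have "lead k (\<ominus> g \<otimes> y k) (n + 1) (s \<otimes> \<one>)" using lead_mult lead_y by blast
  ultimately show False using lead_unique(1) by fastforce
qed

lemma cst_F: "c \<in> F \<Longrightarrow> cst k c c"
  unfolding cst_def by (auto intro!: bexI[of _ \<zero>] B_closed)

lemma cst_mult_y: "g \<in> B k \<Longrightarrow> cst k (g \<otimes> y k) \<zero>"
  unfolding cst_def by auto

lemma cst_add:
  assumes "cst k a c" "cst k b d"
  shows "cst k (a \<oplus> b) (c \<oplus> d)"
proof -
  obtain g h where "c \<in> F" "d \<in> F" "g \<in> B k" "h \<in> B k" "a = c \<oplus> g \<otimes> y k" "b = d \<oplus> h \<otimes> y k"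
    using assms unfolding cst_def by blast
  moreover from this have "a \<oplus> b = (c \<oplus> d) \<oplus> (g \<oplus> h) \<otimes> y k" by (simp add: l_distr a_ac)
  ultimately show ?thesis unfolding cst_def by (auto intro!: B_closed)
qed

lemma cst_mult:
  assumes "cst k a c" "cst k b d"
  shows "cst k (a \<otimes> b) (c \<otimes> d)"
proof -
  obtain g h where *: "c \<in> F" "d \<in> F" "g \<in> B k" "h \<in> B k" "a = c \<oplus> g \<otimes> y k" "b = d \<oplus> h \<otimes> y k"
    using assms unfolding cst_def by blast
  moreover from this have "a \<otimes> b = c \<otimes> d \<oplus> (c \<otimes> h \<oplus> g \<otimes> b) \<otimes> y k"
    by (simp add: l_distr r_distr a_ac m_ac)
  moreover have "c \<otimes> h \<oplus> g \<otimes> b \<in> B k" using * cst_B[OF assms(2)] adj.S_polys by (auto intro!: B_closed)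
  ultimately show ?thesis unfolding cst_def by auto
qed

lemma cst_neg: "cst k a c \<Longrightarrow> cst k (\<ominus> a) (\<ominus> c)"
  using cst_mult[OF cst_F[of "\<ominus> \<one>"], of k a c] cst_B[of k a c] by (simp add: l_minus cst_def)

lemma cst_unique:
  assumes "cst k a c" "cst k a d"
  shows "c = d"
proof -
  have "a \<in> carrier L" "c \<in> carrier L" "d \<in> carrier L" using assms cst_B by (auto simp: cst_def)
  moreover have "cst k (a \<oplus> \<ominus> a) (c \<oplus> \<ominus> d)" using cst_add cst_neg assms by blast
  ultimately show ?thesis using cst_0_unique by (simp add: r_neg) (metis a_minus_def r_right_minus_eq)
qed

lemma cst_pow: "cst k a c \<Longrightarrow> cst k (a [^] (r::nat)) (c [^] r)"
  by (induction r) (auto intro: cst_mult cst_F)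

lemma cst_ex:
  assumes "a \<in> B k"
  obtains c where "cst k a c"
proof -
  obtain n where "a \<in> pol F (y k) n" using assms by (auto simp: polys_def)
  then have "a \<in> pol F (y k) (Suc n)" by (rule adj.pol_Suc)
  then show ?thesis using that adj.pol_const adj.polysI unfolding cst_def by metis
qed

lemma y_pow_nonzero: "y k [^] (n::nat) \<noteq> \<zero>"
  using lead_nonzero[OF lead_pow[OF lead_y]] .

lemma pow_cancel:
  assumes "i \<le> (j::nat)" "a \<otimes> y k [^] i = b \<otimes> y k [^] j" "a \<in> carrier L" "b \<in> carrier L"
  shows "a = b \<otimes> y k [^] (j - i)"
proof -
  have "y k [^] i \<noteq> \<zero>" by (rule y_pow_nonzero)
  moreover have "(b \<otimes> y k [^] (j - i)) \<otimes> y k [^] i = b \<otimes> y k [^] j"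
    using assms by (simp add: m_assoc nat_pow_mult)
  ultimately show ?thesis using assms m_rcancel by (metis m_closed nat_pow_closed y)
qed

text \<open>If the exponents differed, cancelling the smaller power would make one cofactor
  divisible by \<open>y k\<close>, against its non-zero constant term.\<close>

lemma order_unique:
  assumes "cst k a c" "cst k b d" "c \<noteq> \<zero>" "d \<noteq> \<zero>" "a \<otimes> y k [^] (i::nat) = b \<otimes> y k [^] (j::nat)"
  shows "i = j \<and> a = b"
proof -
  have *: "i = j \<and> a = b" if "cst k a c" "cst k b d" "c \<noteq> \<zero>" "d \<noteq> \<zero>" "i \<le> j"
    "a \<otimes> y k [^] (i::nat) = b \<otimes> y k [^] (j::nat)" for a b c d i j
  proof -
    have B: "a \<in> B k" "b \<in> B k" using that cst_B by blast+
    then have a: "a = b \<otimes> y k [^] (j - i)" using pow_cancel[OF that(5,6)] by simp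
    have "j - i = 0"
    proof (rule ccontr)
      assume "j - i \<noteq> 0"
      then obtain n where n: "j - i = Suc n" by (metis not0_implies_Suc)
      have "a = (b \<otimes> y k [^] n) \<otimes> y k" unfolding a n using B by (simp add: m_assoc)
      then have "cst k a \<zero>" using cst_mult_y[of "b \<otimes> y k [^] n" k] B B_closed B_pow adj.y_polys by metis
      then show False using cst_unique that by blast
    qed
    then show ?thesis using a that(5) B by simp
  qed
  show ?thesis
  proof (cases "i \<le> j")
    case True
    then show ?thesis using * assms by blast
  next
    case False
    then have "j = i \<and> b = a" using *[OF assms(2,1,4,3), of j i] assms(5) by simp
    then show ?thesis by simp
  qed
qed

text \<open>\<open>y (Suc k) [^] q k\<close> is \<open>y k\<close> translated by a constant. Hence
  \<open>B k\<close> sits in \<open>B (Suc k)\<close> as the ring of polynomials in the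
  \<open>q k\<close>-th power of the variable, the setting of Kummer theory.\<close>

lemma polys_z: "polys F (y (Suc k) [^] q k) = B k"
proof -
  let ?z = "y (Suc k) [^] q k"
  interpret z: adjoin L F ?z
    by (intro adjoin.intro adjoin_axioms.intro ring_axioms F_subring) (simp_all add: m_comm)
  have z: "?z = y k \<oplus> \<rho> k" using y_rec[of k] \<rho>(1)[of k] by (simp add: a_minus_def a_assoc l_neg)
  have "?z \<in> B k" unfolding z using \<rho> by (intro B_closed adj.y_polys adj.S_polys)
  then have "polys F ?z \<subseteq> B k"
    using adj.S_polys by (intro z.polys_minimal adj.polys_subring) auto
  moreover have "y k \<in> polys F ?z" using y_rec[of k] \<rho>(1)[of k] z.S_polys z.y_polys
      subringE(5,7)[OF z.polys_subring] by (simp add: a_minus_def)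
  then have "B k \<subseteq> polys F ?z"
    using z.S_polys by (intro adj.polys_minimal z.polys_subring) auto
  ultimately show ?thesis by blast
qed

text \<open>The order is taken at \<open>y (Suc k) = 0\<close>, which lies over
  \<open>y k = - \<rho> k\<close> and not over zero. A polynomial in
  \<open>y (Suc k) [^] q k\<close> has an order there divisible by \<open>q k\<close>.\<close>

lemma B_order_step:
  assumes "a \<in> B k" "a \<noteq> \<zero>"
  obtains e c g where "g \<in> B k" "cst (Suc k) g c" "c \<noteq> \<zero>" "a = g \<otimes> y (Suc k) [^] (q k * e)"
proof -
  let ?z = "y (Suc k) [^] q k"
  interpret z: adjoin L F ?z
    by (intro adjoin.intro adjoin_axioms.intro ring_axioms F_subring) (simp_all add: m_comm)
  obtain n where "a \<in> pol F ?z n" using assms(1) unfolding polys_z[symmetric] by (auto simp: polys_def)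
  then obtain e c g where *: "c \<in> F" "c \<noteq> \<zero>" "g \<in> B k" "a = (c \<oplus> g \<otimes> ?z) \<otimes> ?z [^] (e::nat)"
    using z.pol_order assms(2) polys_z by metis
  have z: "?z \<in> B k" using z.y_polys polys_z by simp
  obtain p where p: "q k = Suc p" using q_pos[of k] not0_implies_Suc by blast
  have g: "g \<in> B (Suc k)" using *(3) B_step by blast
  have "c \<oplus> g \<otimes> ?z = c \<oplus> (g \<otimes> y (Suc k) [^] p) \<otimes> y (Suc k)" unfolding p using *(3) by (simp add: m_assoc)
  moreover have "g \<otimes> y (Suc k) [^] p \<in> B (Suc k)" using g by (intro B_closed B_pow adj.y_polys)
  ultimately have "cst (Suc k) (c \<oplus> g \<otimes> ?z) c" unfolding cst_def using *(1) by blast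
  moreover have "c \<oplus> g \<otimes> ?z \<in> B k"
    by (rule B_closed(5)[OF adj.S_polys[OF *(1)] B_closed(4)[OF *(3) z]])
  moreover have "a = (c \<oplus> g \<otimes> ?z) \<otimes> y (Suc k) [^] (q k * e)" using *(4) by (simp add: nat_pow_pow)
  ultimately show ?thesis using that *(2) by blast
qed

text \<open>\<open>e\<close> is the least exponent occurring in \<open>a\<close> that is not
  divisible by \<open>q k\<close>. The terms below it form \<open>h\<close>, and all later terms, of
  either kind, are absorbed into \<open>g\<close>, whose constant term they leave alone.\<close>

lemma B_decompose:
  assumes "a \<in> pol F (y (Suc k)) n"
  shows "a \<in> B k \<or> (\<exists>h\<in>B k. \<exists>g\<in>B (Suc k). \<exists>e c. e < n \<and> \<not> q k dvd e \<and> cst (Suc k) g c \<and> c \<noteq> \<zero> \<and>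
    a = h \<oplus> g \<otimes> y (Suc k) [^] e)"
  using assms
proof (induction n arbitrary: a)
  case 0
  then show ?case using B_closed by simp
next
  case (Suc n)
  let ?Y = "y (Suc k)"
  obtain s b where sb: "s \<in> F" "b \<in> pol F ?Y n" "a = s \<otimes> ?Y [^] n \<oplus> b" using Suc.prems by auto
  from Suc.IH[OF sb(2)] show ?case
  proof (elim disjE)
    assume b: "b \<in> B k"
    show ?thesis
    proof (cases "s = \<zero> \<or> q k dvd n")
      case True
      have "s \<otimes> ?Y [^] n \<in> B k"
      proof (cases "s = \<zero>")
        case False
        then obtain l where "n = q k * l" using True by blast
        then have "?Y [^] n = (?Y [^] q k) [^] l" by (simp add: nat_pow_pow)
        then show ?thesis using sb(1) y_pow_B by (metis B_closed(4) B_pow adj.S_polys)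
      qed (use B_closed in simp)
      then show ?thesis using b B_closed sb(3) by blast
    next
      case False
      have "a = b \<oplus> s \<otimes> ?Y [^] n" unfolding sb(3) using sb(1,2) by (simp add: a_comm)
      then show ?thesis using False b sb(1) cst_F cst_B by blast
    qed
  next
    assume "\<exists>h\<in>B k. \<exists>g\<in>B (Suc k). \<exists>e c. e < n \<and> \<not> q k dvd e \<and> cst (Suc k) g c \<and> c \<noteq> \<zero> \<and>
      b = h \<oplus> g \<otimes> ?Y [^] e"
    then obtain h g e c where *: "h \<in> B k" "g \<in> B (Suc k)" "e < n" "\<not> q k dvd e" "cst (Suc k) g c" "c \<noteq> \<zero>"
      "b = h \<oplus> g \<otimes> ?Y [^] e" by blast
    then obtain d where d: "n = Suc d + e" by (metis add.commute less_iff_Suc_add add_Suc_right add_Suc)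
    let ?g = "(s \<otimes> ?Y [^] d) \<otimes> ?Y \<oplus> g"
    have "s \<otimes> ?Y [^] d \<in> B (Suc k)" using sb(1) by (intro B_closed B_pow adj.S_polys adj.y_polys)
    then have "cst (Suc k) ?g (\<zero> \<oplus> c)" using *(5) by (intro cst_add cst_mult_y)
    then have "cst (Suc k) ?g c" using *(5) by (simp add: cst_def)
    moreover have "a = h \<oplus> ?g \<otimes> ?Y [^] e"
      unfolding sb(3) *(7) d using sb(1) *(1,2) by (simp add: l_distr m_assoc a_ac flip: nat_pow_mult) (simp add: m_ac)
    ultimately show ?thesis using *(1,3,4,6) cst_B less_SucI by blast
  qed
qed

text \<open>\<open>w\<close> is the sum of the products of \<open>f [^] i\<close> and
  \<open>h [^] (r - 1 - i)\<close> for \<open>i < r\<close>, and each of these \<open>r\<close>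
  summands has constant term \<open>c [^] (r - 1)\<close>. So if that multiple is non-zero,
  \<open>f [^] r\<close> and \<open>h [^] r\<close> are exactly as close at zero as \<open>f\<close>
  and \<open>h\<close>.\<close>

lemma pow_diff:
  assumes "cst k f c" "cst k h c"
  shows "\<exists>w. cst k w (add_pow L (r::nat) (c [^] (r - 1))) \<and> f [^] r \<ominus> h [^] r = (f \<ominus> h) \<otimes> w"
proof (induction r)
  case 0
  have "f \<in> carrier L" "h \<in> carrier L" using assms cst_carrier by blast+
  then show ?case using cst_F[of \<zero> k] by (intro exI[of _ \<zero>]) (simp add: a_minus_def r_neg)
next
  case (Suc r)
  have cc: "f \<in> carrier L" "h \<in> carrier L" "c \<in> carrier L" using assms cst_carrier by blast+
  from Suc obtain w where w: "cst k w (add_pow L r (c [^] (r - 1)))" "f [^] r \<ominus> h [^] r = (f \<ominus> h) \<otimes> w"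
    by blast
  have wc: "w \<in> carrier L" using w cst_carrier by blast
  have "f [^] Suc r \<ominus> h [^] Suc r = f \<otimes> (f [^] r \<ominus> h [^] r) \<oplus> (f \<ominus> h) \<otimes> h [^] r"
    using cc by (simp add: a_minus_def l_distr r_distr l_minus r_minus m_ac a_ac r_neg2 r_neg1)
  also have "\<dots> = (f \<ominus> h) \<otimes> (f \<otimes> w \<oplus> h [^] r)"
    unfolding w(2) using cc wc by (simp add: r_distr m_ac)
  finally have e: "f [^] Suc r \<ominus> h [^] Suc r = (f \<ominus> h) \<otimes> (f \<otimes> w \<oplus> h [^] r)" .
  have "cst k (f \<otimes> w \<oplus> h [^] r) (c \<otimes> add_pow L r (c [^] (r - 1)) \<oplus> c [^] r)"
    using w assms by (intro cst_add cst_mult cst_pow)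
  moreover have "c \<otimes> add_pow L r (c [^] (r - 1)) \<oplus> c [^] r = add_pow L (Suc r) (c [^] (Suc r - 1))"
  proof (cases r)
    case 0
    then show ?thesis using cc by simp
  next
    case (Suc r')
    then show ?thesis using cc by (simp add: add_pow_rdistr m_comm r_distr)
  qed
  ultimately show ?case using e by auto
qed

text \<open>The Kummer-theoretic core. If \<open>f = h + Y\<^sup>e g\<close> with \<open>h\<close> a polynomial in \<open>Y\<^sup>q\<close> and \<open>q\<close> not dividing \<open>e\<close>,
  then \<open>f\<^sup>r - h\<^sup>r\<close> has order exactly \<open>e\<close> at \<open>Y = 0\<close>, so it is not a polynomial in \<open>Y\<^sup>q\<close>.
  No roots of unity are needed.\<close>

lemma kummer:
  assumes f: "f \<in> B (Suc k)" and r: "add_pow L r \<one> \<noteq> \<zero>" and fr: "f [^] (r::nat) \<in> B k"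
  shows "\<exists>h\<in>B k. \<exists>e. f = h \<otimes> y (Suc k) [^] (e::nat)"
proof (cases "f = \<zero>")
  case True
  then show ?thesis using B_closed(1)[of k] by (intro bexI[of _ \<zero>]) auto
next
  case False
  let ?Y = "y (Suc k)"
  have r0: "r \<noteq> 0" using r by (metis add.nat_pow_0)
  obtain n where "f \<in> pol F ?Y n" using f by (auto simp: polys_def)
  then obtain c0 g0 e where *: "c0 \<in> F" "c0 \<noteq> \<zero>" "g0 \<in> B (Suc k)" "f = (c0 \<oplus> g0 \<otimes> ?Y) \<otimes> ?Y [^] (e::nat)"
    using adj.pol_order False by metis
  let ?f = "c0 \<oplus> g0 \<otimes> ?Y"
  have f0: "cst (Suc k) ?f c0" unfolding cst_def using * by blast
  have fB: "?f \<in> B (Suc k)" using f0 cst_B by blast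
  have frn: "f [^] r = ?f [^] r \<otimes> ?Y [^] (e * r)"
    unfolding *(4) using *(1,3) by (simp add: nat_pow_distrib nat_pow_pow)
  have "f [^] r \<noteq> \<zero>" using False f lead_obtain lead_pow lead_nonzero by metis
  then obtain e' c g where g: "g \<in> B k" "cst (Suc k) g c" "c \<noteq> \<zero>" "f [^] r = g \<otimes> ?Y [^] (q k * e')"
    using B_order_step[OF fr] by blast
  have cr: "c0 [^] i \<noteq> \<zero>" for i :: nat using *(1,2) lead_const lead_pow lead_nonzero by metis
  \<comment> \<open>Two factorisations of \<open>f [^] r\<close> into a power of the variable and a
    cofactor not vanishing at zero coincide; this moves the hypothesis from \<open>f\<close> to its
    cofactor.\<close>
  have "e * r = q k * e' \<and> ?f [^] r = g"
    by (rule order_unique[OF cst_pow[OF f0] g(2) cr g(3)]) (use g(4) frn in simp)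
  then have frB: "?f [^] r \<in> B k" using g by simp
  obtain m where m: "?f \<in> pol F ?Y m" using fB by (auto simp: polys_def)
  have "?f \<in> B k"
  proof (rule ccontr)
    assume "?f \<notin> B k"
    with B_decompose[OF m] obtain h g i c where h: "h \<in> B k" "g \<in> B (Suc k)" "\<not> q k dvd i"
      "cst (Suc k) g c" "c \<noteq> \<zero>" "?f = h \<oplus> g \<otimes> ?Y [^] i" by blast
    have hS: "h \<in> B (Suc k)" using h B_step by blast
    obtain p where p: "i = Suc p" using h(3) by (cases i) auto
    have "g \<otimes> ?Y [^] p \<in> B (Suc k)" using h by (intro B_closed B_pow adj.y_polys)
    then have gp: "cst (Suc k) (g \<otimes> ?Y [^] p \<otimes> ?Y) \<zero>" by (rule cst_mult_y)
    obtain d where d: "cst (Suc k) h d" using cst_ex hS by blast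
    have "?f = h \<oplus> g \<otimes> ?Y [^] p \<otimes> ?Y" unfolding h(6) p using h(2) by (simp add: m_assoc)
    then have "cst (Suc k) ?f (d \<oplus> \<zero>)" using cst_add[OF d gp] by simp
    \<comment> \<open>Since \<open>i > 0\<close>, the polynomial and \<open>h\<close> have the same
      constant term, as \<open>pow_diff\<close> requires.\<close>
    then have "c0 = d \<oplus> \<zero>" by (rule cst_unique[OF f0])
    then have "d = c0" using d by (simp add: cst_def)
    then obtain w where w: "cst (Suc k) w (add_pow L r (c0 [^] (r - 1)))"
      "?f [^] r \<ominus> h [^] r = (?f \<ominus> h) \<otimes> w"
      using pow_diff[OF f0, of h r] d by blast
    have hc: "h \<in> carrier L" "g \<in> carrier L" "w \<in> carrier L" using h(1) B_carrier cst_carrier[OF h(4)] cst_carrier[OF w(1)] by auto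
    have "?f \<ominus> h = g \<otimes> ?Y [^] i" unfolding h(6) using hc
      by (simp add: a_minus_def a_ac r_neg2)
    then have e1: "?f [^] r \<ominus> h [^] r = (g \<otimes> w) \<otimes> ?Y [^] i" using w hc by (simp add: m_ac)
    have gw: "cst (Suc k) (g \<otimes> w) (c \<otimes> add_pow L r (c0 [^] (r - 1)))" using h w cst_mult by blast
    have "add_pow L r (c0 [^] (r - 1)) = add_pow L r \<one> \<otimes> c0 [^] (r - 1)"
      using *(1) by (simp add: add_pow_ldistr)
    then have nz: "c \<otimes> add_pow L r (c0 [^] (r - 1)) \<noteq> \<zero>" using r cr h(4,5) *(1)
      by (simp add: integral_iff cst_def)
    have "g \<otimes> w \<noteq> \<zero>" using cst_unique[OF gw, of \<zero>] cst_F[of \<zero>] nz by auto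
    then have "?f [^] r \<ominus> h [^] r \<noteq> \<zero>" unfolding e1 using hc lead_nonzero[OF lead_pow[OF lead_y]]
      by (simp add: integral_iff)
    moreover have "?f [^] r \<ominus> h [^] r \<in> B k" by (rule B_minus[OF frB B_pow[OF h(1)]])
    ultimately obtain e2 c2 g2 where g2: "cst (Suc k) g2 c2" "c2 \<noteq> \<zero>"
      "?f [^] r \<ominus> h [^] r = g2 \<otimes> ?Y [^] (q k * e2)" using B_order_step by metis
    \<comment> \<open>The same difference has order \<open>i\<close> by \<open>pow_diff\<close>, and
      an order divisible by \<open>q k\<close> because it lies in \<open>B k\<close>.\<close>
    then have "i = q k * e2" using order_unique[OF gw g2(1) nz g2(2)] e1 by simp
    then show False using h(3) by simp
  qed
  then show ?thesis using *(4) by blast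
qed

text \<open>By \<open>kummer\<close> only a power of \<open>y (Suc k)\<close> stands between
  \<open>f\<close> and \<open>B k\<close>. Since \<open>r\<close> times the degree of
  \<open>f\<close> is a multiple of \<open>q k\<close>, coprimality makes the degree, and with it
  that exponent, a multiple of \<open>q k\<close>.\<close>

lemma kummer_pure:
  assumes f: "f \<in> B (Suc k)" and r: "add_pow L r \<one> \<noteq> \<zero>" "coprime r (q k)" and fr: "f [^] (r::nat) \<in> B k"
  shows "f \<in> B k"
proof (cases "f = \<zero>")
  case True
  then show ?thesis using B_closed(1) by simp
next
  case False
  obtain h e where h: "h \<in> B k" "f = h \<otimes> y (Suc k) [^] (e::nat)" using kummer f r fr by blast
  obtain n s where n: "lead (Suc k) f n s" using lead_obtain f False by blast
  have frn: "lead (Suc k) (f [^] r) (r * n) (s [^] r)" using n by (rule lead_pow)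
  obtain n' s' where "lead k (f [^] r) n' s'" using lead_obtain[OF fr] lead_nonzero[OF frn] by blast
  then have "r * n = q k * n'" using lead_unique(1)[OF frn lead_step] by blast
  then have qn: "q k dvd n" using r(2) by (metis coprime_commute coprime_dvd_mult_right_iff dvd_triv_left)
  have "h \<noteq> \<zero>" using h False by auto
  then obtain m t where "lead k h m t" using lead_obtain h by blast
  then have "lead (Suc k) f (q k * m + e * 1) (t \<otimes> \<one> [^] e)"
    unfolding h(2) by (intro lead_mult lead_step lead_pow lead_y)
  then have "n = q k * m + e" using lead_unique(1)[OF n] by simp
  then obtain l where "e = q k * l" using qn dvd_add_right_iff dvd_triv_left by blast
  then have "y (Suc k) [^] e = (y (Suc k) [^] q k) [^] l" by (simp add: nat_pow_pow)
  then have "y (Suc k) [^] e \<in> B k" using B_pow[OF y_pow_B] by simp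
  then show ?thesis using h B_closed by blast
qed

section \<open>Bezout relations and reduced fractions\<close>

definition bez :: "nat \<Rightarrow> 'a \<Rightarrow> 'a \<Rightarrow> bool" where
  "bez k a b \<longleftrightarrow> (\<exists>s\<in>B k. \<exists>t\<in>B k. s \<otimes> a \<oplus> t \<otimes> b = \<one>)"

text \<open>The reason for expressing coprimality by an identity: it survives enlarging the
  polynomial ring.\<close>

lemma bez_mono: "bez k a b \<Longrightarrow> k \<le> l \<Longrightarrow> bez l a b"
  unfolding bez_def using B_mono by blast

lemma bez_sym: "bez k a b \<Longrightarrow> a \<in> B k \<Longrightarrow> b \<in> B k \<Longrightarrow> bez k b a"
  unfolding bez_def by (metis B_carrier a_comm m_closed)

lemma bez_mult:
  assumes "a \<in> B k" "b \<in> B k" "c \<in> B k" "bez k a c" "bez k b c"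
  shows "bez k (a \<otimes> b) c"
proof -
  obtain s t s' t' where *: "s \<in> B k" "t \<in> B k" "s' \<in> B k" "t' \<in> B k"
    "s \<otimes> a \<oplus> t \<otimes> c = \<one>" "s' \<otimes> b \<oplus> t' \<otimes> c = \<one>"
    using assms unfolding bez_def by blast
  have "(s \<otimes> s') \<otimes> (a \<otimes> b) \<oplus> (s \<otimes> a \<otimes> t' \<oplus> t \<otimes> s' \<otimes> b \<oplus> t \<otimes> t' \<otimes> c) \<otimes> c =
      (s \<otimes> a \<oplus> t \<otimes> c) \<otimes> (s' \<otimes> b \<oplus> t' \<otimes> c)"
    using *(1-4) assms(1-3) by (simp add: l_distr r_distr m_ac a_ac)
  also have "\<dots> = \<one>" using * by simp
  finally have "(s \<otimes> s') \<otimes> (a \<otimes> b) \<oplus> (s \<otimes> a \<otimes> t' \<oplus> t \<otimes> s' \<otimes> b \<oplus> t \<otimes> t' \<otimes> c) \<otimes> c = \<one>" .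
  moreover have "s \<otimes> s' \<in> B k" "s \<otimes> a \<otimes> t' \<oplus> t \<otimes> s' \<otimes> b \<oplus> t \<otimes> t' \<otimes> c \<in> B k"
    using *(1-4) assms(1-3) by (simp_all add: B_closed)
  ultimately show ?thesis unfolding bez_def by blast
qed

lemma bez_one: "b \<in> B k \<Longrightarrow> bez k \<one> b"
  unfolding bez_def using B_closed(1,2)[of k] by (intro bexI[of _ \<one>] bexI[of _ \<zero>]) auto

lemma bez_pow1: "a \<in> B k \<Longrightarrow> b \<in> B k \<Longrightarrow> bez k a b \<Longrightarrow> bez k (a [^] (r::nat)) b"
  by (induction r) (auto intro: bez_one bez_mult B_pow)

lemma bez_pow: "a \<in> B k \<Longrightarrow> b \<in> B k \<Longrightarrow> bez k a b \<Longrightarrow> bez k (a [^] (r::nat)) (b [^] r)"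
  by (meson B_pow bez_pow1 bez_sym)

lemma division:
  assumes "lead k b m t" "a \<in> pol F (y k) n"
  shows "\<exists>h\<in>B k. a \<ominus> h \<otimes> b \<in> pol F (y k) m"
  using assms(2)
proof (induction n arbitrary: a)
  case 0
  then show ?case using B_closed(1)[of k] lead_B[OF assms(1)] by (intro bexI[of _ \<zero>]) (auto simp: a_minus_def)
next
  case (Suc n)
  show ?case
  proof (cases "m \<le> n")
    case False
    then have "a \<in> pol F (y k) m" using Suc.prems adj.pol_mono by (metis not_less_eq_eq)
    moreover have "a \<ominus> \<zero> \<otimes> b = a" using adj.pol_carrier[OF Suc.prems] lead_B[OF assms(1)]
      by (simp add: a_minus_def)
    ultimately show ?thesis using B_closed(1)[of k] by metis
  next
    case True
    obtain b' where b: "t \<in> F" "t \<noteq> \<zero>" "b' \<in> pol F (y k) m" "b = t \<otimes> y k [^] m \<oplus> b'"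
      using assms(1) unfolding lead_def by blast
    obtain s a' where a: "s \<in> F" "a' \<in> pol F (y k) n" "a = s \<otimes> y k [^] n \<oplus> a'" using Suc.prems by auto
    let ?i = "inv t"
    have i: "?i \<in> F" "?i \<otimes> t = \<one>" using F_inv b by auto
    let ?h = "(s \<otimes> ?i) \<otimes> y k [^] (n - m)"
    have cc [simp]: "s \<in> carrier L" "t \<in> carrier L" "?i \<in> carrier L" "a' \<in> carrier L" "b' \<in> carrier L" "b \<in> carrier L"
      using a b i adj.pol_carrier lead_B[OF assms(1)] by auto
    have "?h \<otimes> (t \<otimes> y k [^] m) = s \<otimes> (?i \<otimes> t) \<otimes> (y k [^] (n - m) \<otimes> y k [^] m)"
      by (simp add: m_ac del: i(2))
    also have "\<dots> = s \<otimes> y k [^] n" using True i by (simp add: nat_pow_mult)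
    finally have "?h \<otimes> b = s \<otimes> y k [^] n \<oplus> (s \<otimes> ?i) \<otimes> (b' \<otimes> y k [^] (n - m))"
      unfolding b(4) by (simp add: r_distr) (simp add: m_ac)
    then have "a \<ominus> ?h \<otimes> b = a' \<ominus> (s \<otimes> ?i) \<otimes> (b' \<otimes> y k [^] (n - m))"
      unfolding a(3) by (simp add: a_minus_def minus_add a_ac r_neg2 r_neg1)
    moreover have "b' \<otimes> y k [^] (n - m) \<in> pol F (y k) n" using adj.pol_shifts[OF b(3), of "n - m"] True by simp
    ultimately have "a \<ominus> ?h \<otimes> b \<in> pol F (y k) n" using a(1,2) i(1) by (simp add: adj.pol_minus adj.pol_lmult)
    then obtain h' where h': "h' \<in> B k" "a \<ominus> ?h \<otimes> b \<ominus> h' \<otimes> b \<in> pol F (y k) m" using Suc.IH by blast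
    have hB: "?h \<in> B k" using a i by (simp add: B_closed B_pow adj.S_polys adj.y_polys)
    have "a \<in> carrier L" using adj.pol_carrier Suc.prems by blast
    then have "a \<ominus> (?h \<oplus> h') \<otimes> b = a \<ominus> ?h \<otimes> b \<ominus> h' \<otimes> b"
      using h'(1) by (simp add: a_minus_def l_distr minus_add a_ac)
    then show ?thesis using h' hB B_closed(5) by metis
  qed
qed

text \<open>Euclid's algorithm, by induction on the degree bound of \<open>b\<close>; the Bezout
  identity of the cofactors is carried back through each division.\<close>

lemma coprime_parts:
  assumes "a \<in> B k" "b \<in> pol F (y k) m"
  shows "\<exists>d\<in>B k. \<exists>a'\<in>B k. \<exists>b'\<in>B k. a = d \<otimes> a' \<and> b = d \<otimes> b' \<and> bez k a' b'"
  using assms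
proof (induction m arbitrary: a b rule: less_induct)
  case (less m)
  show ?case
  proof (cases "b = \<zero>")
    case True
    then show ?thesis using less.prems B_closed(1,2)[of k] bez_one
      by (intro bexI[of _ a] bexI[of _ \<one>] bexI[of _ \<zero>]) auto
  next
    case False
    have bB: "b \<in> B k" using less.prems adj.polysI by blast
    then obtain n t where n: "lead k b n t" using lead_obtain False by blast
    have nm: "n < m" using lead_deg_bound[OF n less.prems(2)] .
    obtain i where "a \<in> pol F (y k) i" using less.prems by (auto simp: polys_def)
    then obtain h where h: "h \<in> B k" "a \<ominus> h \<otimes> b \<in> pol F (y k) n" using division n by blast
    obtain d a' b' where *: "d \<in> B k" "a' \<in> B k" "b' \<in> B k" "b = d \<otimes> a'" "a \<ominus> h \<otimes> b = d \<otimes> b'" "bez k a' b'"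
      using less.IH[OF nm bB h(2)] by blast
    have cc: "a \<in> carrier L" "b \<in> carrier L" using less.prems bB by auto
    have "a = (a \<ominus> h \<otimes> b) \<oplus> h \<otimes> b" using cc h by (simp add: a_minus_def a_assoc l_neg)
    also have "\<dots> = d \<otimes> (b' \<oplus> h \<otimes> a')" unfolding *(5) unfolding *(4) using * h by (simp add: r_distr m_ac)
    finally have a: "a = d \<otimes> (b' \<oplus> h \<otimes> a')" .
    obtain s t where st: "s \<in> B k" "t \<in> B k" "s \<otimes> a' \<oplus> t \<otimes> b' = \<one>" using *(6) unfolding bez_def by blast
    have "t \<otimes> (b' \<oplus> h \<otimes> a') \<oplus> (s \<ominus> t \<otimes> h) \<otimes> a' = s \<otimes> a' \<oplus> t \<otimes> b'"
      using st(1,2) * h by (simp add: a_minus_def l_distr r_distr l_minus r_minus m_ac a_ac r_neg2 r_neg1 r_neg)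
    moreover have "s \<ominus> t \<otimes> h \<in> B k" using st h by (simp add: B_minus B_closed)
    ultimately have "bez k (b' \<oplus> h \<otimes> a') a'" unfolding bez_def using st by metis
    moreover have "b' \<oplus> h \<otimes> a' \<in> B k" using * h by (simp add: B_closed)
    ultimately show ?thesis using a * by blast
  qed
qed

definition rat :: "nat \<Rightarrow> 'a \<Rightarrow> 'a \<Rightarrow> 'a \<Rightarrow> bool" where
  "rat k x f g \<longleftrightarrow> f \<in> B k \<and> g \<in> B k \<and> g \<noteq> \<zero> \<and> g \<otimes> x = f \<and> bez k f g"

lemma rat_reduce:
  assumes "f \<in> B k" "g \<in> B k" "g \<noteq> \<zero>" "g \<otimes> x = f" "x \<in> carrier L"
  obtains f' g' where "rat k x f' g'"
proof -
  obtain m where "g \<in> pol F (y k) m" using assms by (auto simp: polys_def)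
  then obtain d f' g' where *: "d \<in> B k" "f' \<in> B k" "g' \<in> B k" "f = d \<otimes> f'" "g = d \<otimes> g'" "bez k f' g'"
    using coprime_parts assms by blast
  have nz: "d \<noteq> \<zero>" "g' \<noteq> \<zero>" using *(1,3,5) assms(3) by auto
  have "d \<otimes> (g' \<otimes> x) = d \<otimes> f'" using * assms(4,5) by (metis B_carrier m_assoc)
  then have "g' \<otimes> x = f'" using nz * assms(5) m_lcancel by simp
  then show ?thesis using that * nz unfolding rat_def by blast
qed

lemma rat_mono: "rat k x f g \<Longrightarrow> k \<le> l \<Longrightarrow> rat l x f g"
  unfolding rat_def using B_mono bez_mono by blast

lemma rat_add:
  assumes "rat k x f g" "c \<in> F" "x \<in> carrier L"
  shows "rat k (x \<oplus> c) (f \<oplus> c \<otimes> g) g"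
proof -
  have fg: "f \<in> B k" "g \<in> B k" "c \<in> B k" using assms adj.S_polys unfolding rat_def by auto
  obtain s t where st: "s \<in> B k" "t \<in> B k" "s \<otimes> f \<oplus> t \<otimes> g = \<one>" using assms unfolding rat_def bez_def by blast
  have "s \<otimes> (f \<oplus> c \<otimes> g) \<oplus> (t \<ominus> s \<otimes> c) \<otimes> g = s \<otimes> f \<oplus> t \<otimes> g"
    using st(1,2) fg by (simp add: a_minus_def l_distr r_distr l_minus r_minus m_ac a_ac r_neg2 r_neg1 r_neg)
  moreover have "t \<ominus> s \<otimes> c \<in> B k" using st fg by (simp add: B_minus B_closed)
  ultimately have "bez k (f \<oplus> c \<otimes> g) g" unfolding bez_def using st by metis
  moreover have "g \<otimes> (x \<oplus> c) = f \<oplus> c \<otimes> g" using assms fg unfolding rat_def by (auto simp: r_distr m_comm)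
  ultimately show ?thesis using assms fg unfolding rat_def by (simp add: B_closed)
qed

text \<open>Powers of a reduced fraction stay reduced, and two reduced fractions of one element
  differ by a unit of \<open>B k\<close>, that is, by a non-zero constant.\<close>

lemma rat_assoc:
  assumes "rat k x f g" "rat k w a b" "x [^] (r::nat) = w" "x \<in> carrier L"
  obtains v where "v \<in> F" "v \<noteq> \<zero>" "f [^] r = v \<otimes> a" "g [^] r = v \<otimes> b"
proof -
  have c: "f \<in> B k" "g \<in> B k" "a \<in> B k" "b \<in> B k" "b \<noteq> \<zero>" "w \<in> carrier L" using assms unfolding rat_def by auto
  have fr: "g [^] r \<otimes> w = f [^] r" using assms c unfolding rat_def by (metis B_carrier nat_pow_distrib)
  have bw: "b \<otimes> w = a" using assms unfolding rat_def by blast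
  obtain s t where st: "s \<in> B k" "t \<in> B k" "s \<otimes> f [^] r \<oplus> t \<otimes> g [^] r = \<one>"
    using bez_pow[of f k g r] c assms unfolding rat_def bez_def by blast
  obtain s' t' where st': "s' \<in> B k" "t' \<in> B k" "s' \<otimes> a \<oplus> t' \<otimes> b = \<one>"
    using assms unfolding rat_def bez_def by blast
  have cc [simp]: "f [^] r \<in> carrier L" "g [^] r \<in> carrier L" using c by simp_all
  \<comment> \<open>Cross-multiplication turns the two Bezout identities into
    \<open>b = i \<otimes> g [^] r\<close> and \<open>g [^] r = v \<otimes> b\<close>, so
    \<open>i\<close> and \<open>v\<close> are mutually inverse.\<close>
  define i where "i = s \<otimes> a \<oplus> t \<otimes> b"
  define v where "v = s' \<otimes> f [^] r \<oplus> t' \<otimes> g [^] r"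
  have iv: "i \<in> B k" "v \<in> B k" unfolding i_def v_def using st st' c by (simp_all add: B_closed B_pow)
  have cross: "b \<otimes> f [^] r = a \<otimes> g [^] r" unfolding fr[symmetric] bw[symmetric] using c by (simp add: m_ac)
  have b: "b = i \<otimes> g [^] r"
  proof -
    have "b = (s \<otimes> f [^] r \<oplus> t \<otimes> g [^] r) \<otimes> b" using st c by simp
    also have "\<dots> = s \<otimes> (b \<otimes> f [^] r) \<oplus> t \<otimes> g [^] r \<otimes> b" using st(1,2) c by (simp add: l_distr r_distr m_ac)
    also have "\<dots> = i \<otimes> g [^] r" unfolding cross i_def using st(1,2) c by (simp add: l_distr r_distr m_ac)
    finally show ?thesis .
  qed
  have g: "g [^] r = v \<otimes> b"
  proof -
    have "g [^] r = (s' \<otimes> a \<oplus> t' \<otimes> b) \<otimes> g [^] r" using st' c by simp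
    also have "\<dots> = s' \<otimes> (a \<otimes> g [^] r) \<oplus> t' \<otimes> b \<otimes> g [^] r" using st'(1,2) c by (simp add: l_distr r_distr m_ac)
    also have "\<dots> = v \<otimes> b" unfolding cross[symmetric] v_def using st'(1,2) c by (simp add: l_distr r_distr m_ac)
    finally show ?thesis .
  qed
  have "v \<otimes> i \<otimes> b = \<one> \<otimes> b" using b g c iv by (metis B_carrier cc(2) l_one m_assoc m_comm)
  then have "v \<otimes> i = \<one>" using c(4,5) iv m_rcancel[of b "v \<otimes> i" \<one>] by simp
  then have "v \<in> F" "v \<noteq> \<zero>" using B_unit iv by auto
  moreover have "f [^] r = v \<otimes> a" unfolding fr[symmetric] bw[symmetric] g using c iv by (simp add: m_assoc)
  ultimately show ?thesis using that g by blast
qed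

text \<open>Up to constants, the \<open>r\<close>-th powers of the numerator and denominator of
  \<open>x\<close> are those of \<open>w\<close>, which lie low in the tower.
  \<open>kummer_pure\<close> then brings the numerator and denominator down one height at a
  time.\<close>

lemma rat_descend:
  assumes "rat N x f g" "x \<in> carrier L" "x [^] (r::nat) = w" "rat n w a b" "add_pow L r \<one> \<noteq> \<zero>"
    "\<And>i. n \<le> i \<Longrightarrow> coprime r (q i)"
  shows "\<exists>f g. rat n x f g"
  using assms(1)
proof (induction N arbitrary: f g)
  case 0
  then show ?case using rat_mono by blast
next
  case (Suc N)
  show ?case
  proof (cases "Suc N \<le> n")
    case True
    then show ?thesis using Suc.prems rat_mono by blast
  next
    case False
    then have nN: "n \<le> N" by simp
    have w: "rat N w a b" using assms(4) nN rat_mono by blast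
    obtain v where v: "v \<in> F" "v \<noteq> \<zero>" "f [^] r = v \<otimes> a" "g [^] r = v \<otimes> b"
      using rat_assoc[OF Suc.prems _ assms(3,2), of a b] rat_mono[OF w, of "Suc N"] by auto
    have "f [^] r \<in> B N" "g [^] r \<in> B N" unfolding v using v(1) w unfolding rat_def
      by (auto intro: B_closed adj.S_polys)
    then have "f \<in> B N" "g \<in> B N"
      using kummer_pure assms(5) assms(6)[OF nN] Suc.prems unfolding rat_def by auto
    then obtain f' g' where "rat N x f' g'" using rat_reduce Suc.prems assms(2) unfolding rat_def by metis
    then show ?thesis by (rule Suc.IH)
  qed
qed

text \<open>Raising to the power \<open>q k\<close> multiplies degrees by \<open>q k\<close>, and so
  does rewriting \<open>y k\<close> in terms of \<open>y (Suc k)\<close>. The two factors cancel, so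
  one bound can serve at all heights.\<close>

lemma pow_degree:
  assumes "f \<in> B (Suc k)" "f [^] q k = v \<otimes> a" "v \<in> F" "v \<noteq> \<zero>" "a \<in> pol F (y k) (Suc d)"
  shows "f \<in> pol F (y (Suc k)) (Suc d)"
proof (cases "f = \<zero>")
  case False
  obtain n s where n: "lead (Suc k) f n s" using lead_obtain assms False by blast
  then have fn: "lead (Suc k) (v \<otimes> a) (q k * n) (s [^] q k)" using lead_pow assms(2) by metis
  have aB: "a \<in> B k" using assms(5) adj.polysI by blast
  have "a \<noteq> \<zero>" using lead_nonzero[OF fn] assms(3) by auto
  then obtain m t where m: "lead k a m t" using lead_obtain aB by blast
  have "lead (Suc k) (v \<otimes> a) (q k * (0 + m)) (v \<otimes> t)"
    by (intro lead_step lead_mult lead_const assms m)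
  then have "q k * n = q k * m" using lead_unique(1)[OF fn] by simp
  then have "n = m" using q_pos[of k] by simp
  moreover have "m < Suc d" using lead_deg_bound[OF m assms(5)] .
  ultimately have "Suc n \<le> Suc d" by simp
  then show ?thesis by (rule adj.pol_mono[OF lead_pol[OF n]])
qed (simp only: adj.pol_zero)

text \<open>In \<open>f = h \<otimes> y (Suc k) [^] e\<close> with \<open>h\<close> from
  \<open>B k\<close>, a non-constant \<open>h\<close> would already contribute degree at least
  \<open>q k\<close>, which exceeds \<open>d\<close>.\<close>

lemma pow_monomial:
  assumes "f \<in> B (Suc k)" "f [^] q k \<in> B k" "f \<in> pol F (y (Suc k)) (Suc d)" "d < q k"
  shows "\<exists>c\<in>F. \<exists>e. f = c \<otimes> y (Suc k) [^] (e::nat)"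
proof (cases "f = \<zero>")
  case True
  then show ?thesis by (intro bexI[of _ \<zero>]) auto
next
  case False
  obtain h e where h: "h \<in> B k" "f = h \<otimes> y (Suc k) [^] (e::nat)" using kummer assms q_char by blast
  then have "h \<noteq> \<zero>" using False by auto
  then obtain m t where m: "lead k h m t" using lead_obtain h by blast
  then have "lead (Suc k) f (q k * m + e * 1) (t \<otimes> \<one> [^] e)"
    unfolding h(2) by (intro lead_mult lead_step lead_pow lead_y)
  then have "q k * m + e < Suc d" using lead_deg_bound assms(3) by fastforce
  then have "m = 0" using assms(4) by (cases m) auto
  then show ?thesis using lead_0 m h by blast
qed

end

text \<open>At heights congruent to 2 modulo 3 the parameters \<rho> and \<eta> may differ a priori;
  their equality is part of what is to be proved. The height at which \<open>u k\<close> is a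
  fraction is not bounded in advance.\<close>

locale root_sequence = field_tower +
  fixes u \<eta> :: "nat \<Rightarrow> 'a" and \<tau>
  assumes u [simp]: "u k \<in> carrier L" and \<eta>: "\<eta> k \<in> F"
    and u_rat: "\<exists>n f g. rat n (u k) f g"
    and u_rec: "u k = u (Suc k) [^] q k \<ominus> \<eta> k"
    and par0: "k mod 3 = 0 \<Longrightarrow> \<rho> k = \<one> \<and> \<eta> k = \<one>"
    and par1: "k mod 3 = 1 \<Longrightarrow> \<rho> k = \<tau> \<and> \<eta> k = \<tau>"
    and per: "\<rho> (k + 3) = \<rho> k" "\<eta> (k + 3) = \<eta> k"
    and \<tau>: "n > 0 \<Longrightarrow> \<tau> [^] (n::nat) \<noteq> \<one>"
begin

lemma u_pow: "u (Suc k) [^] q k = u k \<oplus> \<eta> k"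
  using u_rec[of k] \<eta>[of k] by (simp add: a_minus_def a_assoc l_neg)

lemma coprime_q: "i \<noteq> j \<Longrightarrow> coprime (q i) (q j)"
  using q_prime q_inj primes_coprime by (metis injD)

text \<open>\<open>u (Suc k)\<close> is a \<open>q k\<close>-th root of a fraction of height
  \<open>l > k\<close>, while the steps from \<open>l\<close> upwards use only the primes
  \<open>q i\<close> with \<open>i \<ge> l\<close>. These are coprime to \<open>q k\<close>, so
  \<open>rat_descend\<close> keeps \<open>u (Suc k)\<close> at height \<open>l\<close>. From some
  index on, sequence and tower therefore rise together.\<close>

lemma u_level: "\<exists>n. \<forall>k\<ge>n. \<exists>f g. rat k (u k) f g"
proof -
  obtain n where n: "\<exists>f g. rat n (u 0) f g" using u_rat by blast
  have step_up: "\<exists>f g. rat l (u (Suc k)) f g" if ex: "\<exists>f g. rat l (u k) f g" and kl: "k < l" for k l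
  proof -
    obtain f g where "rat l (u k) f g" using ex by blast
    then have "rat l (u k \<oplus> \<eta> k) (f \<oplus> \<eta> k \<otimes> g) g" using rat_add \<eta> u by blast
    moreover obtain N f' g' where "rat N (u (Suc k)) f' g'" using u_rat by blast
    ultimately show ?thesis
      using rat_descend[OF _ u u_pow _ q_char] coprime_q kl by (metis leD)
  qed
  have a: "\<exists>f g. rat n (u k) f g" if "k \<le> n" for k
    using that by (induction k) (use n step_up in auto)
  have "\<exists>f g. rat k (u k) f g" if "k \<ge> n" for k
    using that
  proof (induction rule: dec_induct)
    case base
    then show ?case using a by blast
  next
    case (step k)
    then have "\<exists>f g. rat (Suc k) (u k) f g" using rat_mono by (metis le_SucI le_refl)
    then show ?case using step_up by blast
  qed
  then show ?thesis by blast
qed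

text \<open>\<open>rat_assoc\<close> expresses the \<open>q k\<close>-th powers of the new numerator
  and denominator by the old ones; adding a multiple of the denominator does not raise the bound,
  and \<open>pow_degree\<close> preserves it.\<close>

lemma u_degree: "\<exists>n d. \<forall>k\<ge>n. \<exists>f g. rat k (u k) f g \<and> f \<in> pol F (y k) (Suc d) \<and> g \<in> pol F (y k) (Suc d)"
proof -
  obtain n where n: "\<And>k. k \<ge> n \<Longrightarrow> \<exists>f g. rat k (u k) f g" using u_level by blast
  obtain f0 g0 where fg: "rat n (u n) f0 g0" using n by blast
  then obtain d' where "f0 \<in> pol F (y n) d'" "g0 \<in> pol F (y n) d'"
    using adj.polys_obtain2 unfolding rat_def by blast
  then obtain d where d: "f0 \<in> pol F (y n) (Suc d)" "g0 \<in> pol F (y n) (Suc d)" using adj.pol_Suc by blast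
  have "\<exists>f g. rat k (u k) f g \<and> f \<in> pol F (y k) (Suc d) \<and> g \<in> pol F (y k) (Suc d)" if "k \<ge> n" for k
    using that
  proof (induction rule: dec_induct)
    case base
    then show ?case using fg d by blast
  next
    case (step k)
    then obtain f g where *: "rat k (u k) f g" "f \<in> pol F (y k) (Suc d)" "g \<in> pol F (y k) (Suc d)" by blast
    have w: "rat k (u k \<oplus> \<eta> k) (f \<oplus> \<eta> k \<otimes> g) g" using rat_add * \<eta> u by blast
    obtain f' g' where r: "rat (Suc k) (u (Suc k)) f' g'" using n step by (meson le_SucI)
    obtain v where v: "v \<in> F" "v \<noteq> \<zero>" "f' [^] q k = v \<otimes> (f \<oplus> \<eta> k \<otimes> g)" "g' [^] q k = v \<otimes> g"
      using rat_assoc[OF r rat_mono[OF w] u_pow u] by (metis le_SucI le_refl)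
    have fg: "f' \<in> B (Suc k)" "g' \<in> B (Suc k)" using r unfolding rat_def by auto
    have "f \<oplus> \<eta> k \<otimes> g \<in> pol F (y k) (Suc d)" using * \<eta> by (intro adj.pol_add adj.pol_lmult)
    then show ?case using pow_degree[OF fg(1) v(3,1,2)] pow_degree[OF fg(2) v(4,1,2) *(3)] r by blast
  qed
  then show ?thesis by blast
qed

text \<open>Once \<open>q k\<close> exceeds the uniform degree bound, \<open>pow_monomial\<close>
  applies to both numerator and denominator. The second alternative stands for a negative
  exponent.\<close>

lemma u_monomial: "\<exists>n. \<forall>k\<ge>n. \<exists>c\<in>F. \<exists>e::nat. u k = c \<otimes> y k [^] e \<or> (c \<noteq> \<zero> \<and> u k \<otimes> y k [^] e = c)"
proof -
  obtain n d where n: "\<And>k. k \<ge> n \<Longrightarrow> \<exists>f g. rat k (u k) f g \<and> f \<in> pol F (y k) (Suc d) \<and> g \<in> pol F (y k) (Suc d)"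
    using u_degree by blast
  \<comment> \<open>Distinct primes are eventually larger than \<open>d\<close>.\<close>
  have "finite (q -` {..d})" using q_inj by (intro finite_vimageI) auto
  then obtain m where m: "\<And>k. q k \<le> d \<Longrightarrow> k < m" by (metis finite_nat_set_iff_bounded vimageI atMost_iff)
  have "\<exists>c\<in>F. \<exists>e::nat. u (Suc k) = c \<otimes> y (Suc k) [^] e \<or> (c \<noteq> \<zero> \<and> u (Suc k) \<otimes> y (Suc k) [^] e = c)"
    if "k \<ge> max n m" for k
  proof -
    obtain f g where *: "rat k (u k) f g" using n \<open>k \<ge> max n m\<close> by (meson max.boundedE)
    have w: "rat k (u k \<oplus> \<eta> k) (f \<oplus> \<eta> k \<otimes> g) g" using rat_add * \<eta> u by blast
    obtain f' g' where r: "rat (Suc k) (u (Suc k)) f' g'" and d: "f' \<in> pol F (y (Suc k)) (Suc d)"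
      "g' \<in> pol F (y (Suc k)) (Suc d)" using n[of "Suc k"] \<open>k \<ge> max n m\<close> by auto
    obtain v where v: "v \<in> F" "v \<noteq> \<zero>" "f' [^] q k = v \<otimes> (f \<oplus> \<eta> k \<otimes> g)" "g' [^] q k = v \<otimes> g"
      using rat_assoc[OF r rat_mono[OF w] u_pow u] by (metis le_SucI le_refl)
    have fg: "f' \<in> B (Suc k)" "g' \<in> B (Suc k)" "g' \<noteq> \<zero>" "g' \<otimes> u (Suc k) = f'" using r unfolding rat_def by auto
    have "f' [^] q k \<in> B k" "g' [^] q k \<in> B k" unfolding v using w v(1) adj.S_polys unfolding rat_def
      by (auto intro: B_closed(4))
    moreover have "d < q k" using m[of k] \<open>k \<ge> max n m\<close> by force
    ultimately obtain c e c' e' where c: "c \<in> F" "f' = c \<otimes> y (Suc k) [^] (e::nat)"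
      "c' \<in> F" "g' = c' \<otimes> y (Suc k) [^] (e'::nat)" using pow_monomial[OF _ _ _ \<open>d < q k\<close>] fg d by metis
    have c'0: "c' \<noteq> \<zero>" using fg c by auto
    have inv: "inv c' \<in> F" "inv c' \<noteq> \<zero>" "inv c' \<otimes> c' = \<one>" using F_inv c(3) c'0 by auto
    have "c' \<otimes> (u (Suc k) \<otimes> y (Suc k) [^] e') = c \<otimes> y (Suc k) [^] e"
      using fg(4) c(1,3) unfolding c(2,4) by (simp add: m_ac)
    then have "(inv c' \<otimes> c') \<otimes> (u (Suc k) \<otimes> y (Suc k) [^] e') = (inv c' \<otimes> c) \<otimes> y (Suc k) [^] e"
      using inv(1) c(1,3) by (simp add: m_assoc)
    then have main: "u (Suc k) \<otimes> y (Suc k) [^] e' = (inv c' \<otimes> c) \<otimes> y (Suc k) [^] e"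
      unfolding inv(3) by simp
    have icF: "inv c' \<otimes> c \<in> F" using inv(1) c(1) by (rule adj.S_closed)
    show ?thesis
    proof (cases "e' = 0")
      case True
      then show ?thesis using main icF by auto
    next
      case False
      then obtain p' where p': "e' = Suc p'" using not0_implies_Suc by blast
      obtain s t where st: "s \<in> B (Suc k)" "t \<in> B (Suc k)" "s \<otimes> f' \<oplus> t \<otimes> g' = \<one>"
        using r unfolding rat_def bez_def by blast
      have Yp: "x \<otimes> y (Suc k) [^] (p::nat) \<in> B (Suc k)" if "x \<in> B (Suc k)" for x p
        using that by (intro B_closed(4) B_pow adj.y_polys)
      have z: "cst (Suc k) (x \<otimes> y (Suc k) [^] Suc p) \<zero>" if "x \<in> B (Suc k)" for x p
        using cst_mult_y[OF Yp[OF that, of p]] that by (simp add: m_assoc)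
      have tg: "cst (Suc k) (t \<otimes> g') \<zero>"
        using z[of "t \<otimes> c'" p'] st c unfolding c(4) p' by (simp add: m_assoc B_closed(4) adj.S_polys)
      \<comment> \<open>With \<open>e' > 0\<close> the denominator vanishes at zero, so by the
        Bezout identity the numerator does not, which forces \<open>e = 0\<close>.\<close>
      have ncst: "\<not> cst (Suc k) (s \<otimes> f') \<zero>"
      proof
        assume "cst (Suc k) (s \<otimes> f') \<zero>"
        then have "cst (Suc k) \<one> (\<zero> \<oplus> \<zero>)" using cst_add[OF _ tg] st(3) by metis
        then show False using cst_unique[of "Suc k" \<one> "\<zero> \<oplus> \<zero>" \<one>] cst_F[of \<one>] by simp
      qed
      have "e = 0"
      proof (rule ccontr)
        assume "e \<noteq> 0"
        then obtain p where p: "e = Suc p" using not0_implies_Suc by blast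
        have "cst (Suc k) (s \<otimes> f') \<zero>"
          using z[of "s \<otimes> c" p] st c unfolding c(2) p by (simp add: m_assoc B_closed(4) adj.S_polys)
        with ncst show False by blast
      qed
      moreover have "c \<noteq> \<zero>" using ncst cst_F[of \<zero> "Suc k"] st(1) unfolding c(2) by auto
      ultimately have "u (Suc k) \<otimes> y (Suc k) [^] e' = inv c' \<otimes> c" "inv c' \<otimes> c \<noteq> \<zero>"
        using main icF inv(1,2) c(1) by (simp_all add: integral_iff)
      then show ?thesis using icF by blast
    qed
  qed
  then have "\<forall>k\<ge>Suc (max n m). \<exists>c\<in>F. \<exists>e::nat. u k = c \<otimes> y k [^] e \<or> (c \<noteq> \<zero> \<and> u k \<otimes> y k [^] e = c)"
    by (metis Suc_le_D Suc_le_mono)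
  then show ?thesis by blast
qed

text \<open>In \<open>u (Suc k) [^] q k = u k \<oplus> \<eta> k\<close> both sides are explicit in
  \<open>y k\<close>: the left is a constant times a positive or negative power of
  \<open>y k \<oplus> \<rho> k\<close>, the right is \<eta> plus a monomial with positive or
  negative exponent. Constant terms and degrees exclude three of the four sign combinations; in the
  fourth they equate the exponents and coefficients and determine \<open>\<eta> k\<close>.\<close>

lemma u_monomial_pos:
  assumes "u i \<notin> F"
  shows "\<exists>n. \<forall>k\<ge>n. \<exists>c\<in>F. \<exists>e>0. c \<noteq> \<zero> \<and> u k = c \<otimes> y k [^] (e::nat) \<and> \<eta> k = c \<otimes> \<rho> k [^] e \<and>
    u (Suc k) [^] q k = c \<otimes> (y k \<oplus> \<rho> k) [^] e"
proof -
  obtain n0 where n0: "\<And>k. k \<ge> n0 \<Longrightarrow> \<exists>c\<in>F. \<exists>e::nat. u k = c \<otimes> y k [^] e \<or> (c \<noteq> \<zero> \<and> u k \<otimes> y k [^] e = c)"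
    using u_monomial by blast
  \<comment> \<open>The recursion keeps \<open>F\<close> stable downwards, so lying outside
    \<open>F\<close> propagates upwards from \<open>i\<close>.\<close>
  have nF: "u k \<notin> F" if "i \<le> k" for k
    using that
  proof (induction rule: dec_induct)
    case (step k)
    then show ?case using u_rec[of k] F_pow \<eta>[of k] adj.S_closed by (metis a_minus_def)
  qed (fact assms)
  have shape: "\<exists>c\<in>F. \<exists>e>0. c \<noteq> \<zero> \<and> (u k = c \<otimes> y k [^] (e::nat) \<or> u k \<otimes> y k [^] e = c)"
    if ki: "k \<ge> max n0 i" for k
  proof -
    obtain c e where ce: "c \<in> F" "u k = c \<otimes> y k [^] (e::nat) \<or> (c \<noteq> \<zero> \<and> u k \<otimes> y k [^] e = c)"
      using n0 ki by (meson max.boundedE)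
    have "u k \<notin> F" using nF ki by simp
    then have "e \<noteq> 0" using ce by (metis F_carrier nat_pow_0 r_one u)
    moreover have "c \<noteq> \<zero>" using ce \<open>u k \<notin> F\<close> adj.S_closed(1) by (metis l_null nat_pow_closed y)
    ultimately show ?thesis using ce by blast
  qed
  have "\<exists>c\<in>F. \<exists>e>0. c \<noteq> \<zero> \<and> u k = c \<otimes> y k [^] (e::nat) \<and> \<eta> k = c \<otimes> \<rho> k [^] e \<and>
      u (Suc k) [^] q k = c \<otimes> (y k \<oplus> \<rho> k) [^] e" if ki: "k \<ge> max n0 i" for k
  proof -
    let ?z = "y k \<oplus> \<rho> k"
    note z = y_pow[of k, symmetric]
    obtain c e where ce: "c \<in> F" "e > 0" "c \<noteq> \<zero>" "u k = c \<otimes> y k [^] (e::nat) \<or> u k \<otimes> y k [^] e = c"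
      using shape ki by blast
    obtain c' e' where ce': "c' \<in> F" "e' > 0" "c' \<noteq> \<zero>"
      "u (Suc k) = c' \<otimes> y (Suc k) [^] (e'::nat) \<or> u (Suc k) \<otimes> y (Suc k) [^] e' = c'"
      using shape[of "Suc k"] ki by auto
    define C where "C = c' [^] q k"
    have C: "C \<in> F" "C \<noteq> \<zero>" using ce' F_pow lead_const lead_pow lead_nonzero unfolding C_def by metis+
    have zp: "?z [^] e' = (y (Suc k) [^] e') [^] q k" unfolding z by (simp add: nat_pow_pow mult.commute)
    have zc: "?z \<in> carrier L" using \<rho>[of k] by simp
    have up: "u (Suc k) [^] q k = C \<otimes> ?z [^] e' \<or> u (Suc k) [^] q k \<otimes> ?z [^] e' = C"
      using ce' unfolding zp C_def by (metis F_carrier nat_pow_closed nat_pow_distrib u y)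
    have lz: "lead k (?z [^] e') (e' * 1) (\<one> [^] e')"
      by (intro lead_pow lead_add[OF lead_y]) (use adj.S_pol \<rho> in simp)
    have cz: "cst k (?z [^] e') ((\<zero> \<oplus> \<rho> k) [^] e')"
      using cst_mult_y[of \<one> k] B_closed(2) \<rho> by (intro cst_pow cst_add cst_F) auto
    have cy: "cst k (y k [^] n) \<zero>" if "n > 0" for n :: nat
    proof -
      obtain m where "n = Suc m" using \<open>n > 0\<close> gr0_implies_Suc by blast
      then show ?thesis using cst_mult_y[of "y k [^] m" k] B_pow adj.y_polys by simp
    qed
    have \<rho>p: "\<rho> k [^] (n::nat) \<noteq> \<zero>" for n using \<rho>[of k] lead_const lead_pow lead_nonzero by metis
    note cc [simp] = F_carrier[OF ce(1)] F_carrier[OF ce'(1)] F_carrier[OF C(1)] F_carrier[OF \<eta>[of k]] F_carrier[OF \<rho>(1)[of k]]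
    from ce(4) show ?thesis
    proof
      assume neg: "u k \<otimes> y k [^] e = c"
      then have mul: "u (Suc k) [^] q k \<otimes> y k [^] e = c \<oplus> \<eta> k \<otimes> y k [^] e" unfolding u_pow by (simp add: l_distr)
      have cl: "cst k (c \<oplus> \<eta> k \<otimes> y k [^] e) (c \<oplus> \<eta> k \<otimes> \<zero>)"
        by (intro cst_add cst_mult cst_F cy ce \<eta>)
      from up show ?thesis
      proof
        assume "u (Suc k) [^] q k = C \<otimes> ?z [^] e'"
        then have "c \<oplus> \<eta> k \<otimes> y k [^] e = C \<otimes> ?z [^] e' \<otimes> y k [^] e" using mul by simp
        moreover have "cst k (C \<otimes> ?z [^] e' \<otimes> y k [^] e) (C \<otimes> (\<zero> \<oplus> \<rho> k) [^] e' \<otimes> \<zero>)"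
          by (intro cst_mult cst_F C cz cy ce)
        ultimately have "c \<oplus> \<eta> k \<otimes> \<zero> = C \<otimes> (\<zero> \<oplus> \<rho> k) [^] e' \<otimes> \<zero>" using cl cst_unique by metis
        then show ?thesis using ce by simp
      next
        assume "u (Suc k) [^] q k \<otimes> ?z [^] e' = C"
        then have "(u (Suc k) [^] q k \<otimes> y k [^] e) \<otimes> ?z [^] e' = C \<otimes> y k [^] e" using zc by (simp add: m_ac flip: \<open>_ = C\<close>)
        then have "(c \<oplus> \<eta> k \<otimes> y k [^] e) \<otimes> ?z [^] e' = C \<otimes> y k [^] e" unfolding mul .
        moreover have "cst k ((c \<oplus> \<eta> k \<otimes> y k [^] e) \<otimes> ?z [^] e') ((c \<oplus> \<eta> k \<otimes> \<zero>) \<otimes> (\<zero> \<oplus> \<rho> k) [^] e')"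
          by (intro cst_mult cl cz)
        moreover have "cst k (C \<otimes> y k [^] e) (C \<otimes> \<zero>)" by (intro cst_mult cst_F C cy ce)
        ultimately have "(c \<oplus> \<eta> k \<otimes> \<zero>) \<otimes> (\<zero> \<oplus> \<rho> k) [^] e' = C \<otimes> \<zero>" using cst_unique by metis
        then show ?thesis using ce(3) \<rho>p by (simp add: integral_iff)
      qed
    next
      assume pos: "u k = c \<otimes> y k [^] e"
      have lc: "lead k (c \<otimes> y k [^] e \<oplus> \<eta> k) (0 + e * 1) (c \<otimes> \<one> [^] e)"
        by (intro lead_add lead_mult lead_const lead_pow lead_y ce adj.pol_mono[OF adj.S_pol[OF \<eta>]])
          (use ce in simp)
      have cl: "cst k (c \<otimes> y k [^] e \<oplus> \<eta> k) (c \<otimes> \<zero> \<oplus> \<eta> k)"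
        by (intro cst_add cst_mult cst_F cy ce \<eta>)
      from up show ?thesis
      proof
        assume eq: "u (Suc k) [^] q k = C \<otimes> ?z [^] e'"
        then have eq': "c \<otimes> y k [^] e \<oplus> \<eta> k = C \<otimes> ?z [^] e'" using u_pow pos by simp
        have "lead k (C \<otimes> ?z [^] e') (0 + e' * 1) (C \<otimes> \<one> [^] e')" by (intro lead_mult lead_const C lz)
        then have "e = e'" "c = C" using lead_unique[OF lc] eq' by simp_all
        moreover have "cst k (C \<otimes> ?z [^] e') (C \<otimes> (\<zero> \<oplus> \<rho> k) [^] e')" by (intro cst_mult cst_F C cz)
        then have "\<eta> k = C \<otimes> \<rho> k [^] e'" using cst_unique[OF cl] eq' by simp
        ultimately show ?thesis using pos ce eq by blast
      next
        assume "u (Suc k) [^] q k \<otimes> ?z [^] e' = C"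
        then have eq': "(c \<otimes> y k [^] e \<oplus> \<eta> k) \<otimes> ?z [^] e' = C" using u_pow pos by simp
        have "lead k ((c \<otimes> y k [^] e \<oplus> \<eta> k) \<otimes> ?z [^] e') (0 + e * 1 + e' * 1) (c \<otimes> \<one> [^] e \<otimes> \<one> [^] e')"
          by (intro lead_mult lc lz)
        then have "0 + e * 1 + e' * 1 = 0" unfolding eq' using lead_unique(1) lead_const C by blast
        then show ?thesis using ce(2) by simp
      qed
    qed
  qed
  then show ?thesis by blast
qed

text \<open>Among \<open>k\<close>, \<open>Suc k\<close> and \<open>Suc (Suc k)\<close> one has
  residue \<open>r\<close>, and a property known there is carried down to \<open>k\<close>.\<close>

lemma mod_3_descend:
  fixes n k r :: nat
  assumes "r < 3" "n \<le> k"
    and base: "\<And>k. n \<le> k \<Longrightarrow> k mod 3 = r \<Longrightarrow> P k" and step: "\<And>k. n \<le> k \<Longrightarrow> P (Suc k) \<Longrightarrow> P k"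
  shows "P k"
proof -
  have "k mod 3 = r \<or> Suc k mod 3 = r \<or> Suc (Suc k) mod 3 = r"
    using assms(1) mod_less_divisor[of 3 k] by (auto simp: mod_Suc simp del: mod_less_divisor)
  then show ?thesis
    using assms(2) base[of k] base[of "Suc k"] base[of "Suc (Suc k)"] step[of k] step[of "Suc k"] by auto
qed

theorem root_sequence_unique: "(\<forall>k. u k \<in> F) \<or> (\<forall>k. u k = y k \<and> \<eta> k = \<rho> k)"
proof (rule disjCI, rule ccontr)
  assume n2: "\<not> (\<forall>k. u k = y k \<and> \<eta> k = \<rho> k)" and "\<not> (\<forall>k. u k \<in> F)"
  then obtain i where "u i \<notin> F" by blast
  then obtain n c e where *: "\<And>k. k \<ge> n \<Longrightarrow> c k \<in> F \<and> e k > 0 \<and> c k \<noteq> \<zero> \<and> u k = c k \<otimes> y k [^] (e k::nat) \<and>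
     \<eta> k = c k \<otimes> \<rho> k [^] e k \<and> u (Suc k) [^] q k = c k \<otimes> (y k \<oplus> \<rho> k) [^] e k"
    using u_monomial_pos by metis
  have c1: "c k = \<one>" if "k \<ge> n" "k mod 3 = 0" for k
  proof -
    have "c k \<in> carrier L" using *[OF that(1)] by simp
    then show ?thesis using *[OF that(1)] par0[OF that(2)] by (metis nat_pow_one r_one)
  qed
  \<comment> \<open>Both sides are the leading coefficient of \<open>u (Suc k) [^] q k\<close>, read
    off from the monomial at height \<open>Suc k\<close> and from a constant times a power of the
    monic \<open>y k \<oplus> \<rho> k\<close>. The degrees are compared in the same way for
    \<open>estep\<close>.\<close>
  have cstep: "c k = c (Suc k) [^] q k" if k: "k \<ge> n" for k
  proof -
    have k': "Suc k \<ge> n" using k by simp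
    note zz = y_pow[of k, symmetric]
    have "lead (Suc k) (u (Suc k) [^] q k) (q k * (0 + e (Suc k) * 1)) ((c (Suc k) \<otimes> \<one> [^] e (Suc k)) [^] q k)"
      using *[OF k'] by (simp only:) (intro lead_pow lead_mult lead_const lead_y, auto)
    moreover have "lead (Suc k) (u (Suc k) [^] q k) (0 + e k * (q k * 1)) (c k \<otimes> (\<one> [^] q k) [^] e k)"
      using *[OF k] unfolding zz by (simp only:) (intro lead_pow lead_mult lead_const lead_y, auto)
    ultimately have "(c (Suc k) \<otimes> \<one> [^] e (Suc k)) [^] q k = c k \<otimes> (\<one> [^] q k) [^] e k" by (rule lead_unique(2))
    moreover have "c k \<in> carrier L" "c (Suc k) \<in> carrier L" using *[OF k] *[OF k'] by simp_all
    ultimately show ?thesis by simp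
  qed
  have "c k = \<one>" if "k \<ge> n" for k
  proof (rule mod_3_descend[OF _ that, where r = 0 and P = "\<lambda>k. c k = \<one>"])
    show "c j = \<one>" if "n \<le> j" "c (Suc j) = \<one>" for j unfolding cstep[OF that(1)] that(2) by simp
  qed (simp_all add: c1)
  then have all1: "u k = y k [^] e k \<and> \<eta> k = \<rho> k [^] e k \<and> u (Suc k) [^] q k = (y k \<oplus> \<rho> k) [^] e k" if "k \<ge> n" for k
    using *[OF that] that \<rho>(1)[of k] by simp
  have estep: "e k = e (Suc k)" if k: "k \<ge> n" for k
  proof -
    have k': "Suc k \<ge> n" using k by simp
    note zz = y_pow[of k, symmetric]
    have "lead (Suc k) (u (Suc k) [^] q k) (q k * (e (Suc k) * 1)) ((\<one> [^] e (Suc k)) [^] q k)"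
      using all1[OF k'] by (simp only:) (intro lead_pow lead_y)
    moreover have "lead (Suc k) (u (Suc k) [^] q k) (e k * (q k * 1)) ((\<one> [^] q k) [^] e k)"
      using all1[OF k] unfolding zz by (simp only:) (intro lead_pow lead_y)
    ultimately have "q k * (e (Suc k) * 1) = e k * (q k * 1)" by (rule lead_unique(1))
    then show ?thesis using q_pos[of k] by (simp add: mult.commute)
  qed
  have e1: "e k = 1" if k: "k \<ge> n" "k mod 3 = 1" for k
  proof -
    have t: "\<tau> = \<tau> [^] e k" "\<tau> \<in> F" "\<tau> \<noteq> \<zero>" using all1[OF k(1)] par1[OF k(2)] \<rho>[of k] by auto
    obtain m where m: "e k = Suc m" using *[OF k(1)] gr0_implies_Suc by blast
    have "\<one> \<otimes> \<tau> = \<tau> [^] m \<otimes> \<tau>" using t unfolding m by simp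
    then have "\<one> = \<tau> [^] m" using t(2,3) m_rcancel[of \<tau> \<one> "\<tau> [^] m"] by auto
    then have "m = 0" using \<tau>[of m] by force
    then show ?thesis using m by simp
  qed
  have big: "u k = y k \<and> \<eta> k = \<rho> k" if k: "k \<ge> n" for k
  proof -
    have "e k = 1"
    proof (rule mod_3_descend[OF _ k, where r = 1 and P = "\<lambda>k. e k = 1"])
      show "e j = 1" if "n \<le> j" "e (Suc j) = 1" for j unfolding estep[OF that(1)] that(2) ..
    qed (simp_all add: e1)
    then show ?thesis using all1[OF k] \<rho>(1)[of k] by simp
  qed
  \<comment> \<open>Equality is so far known only from height \<open>n\<close> on. Periodicity
    carries the parameters back to small heights, and the recursion then carries back the
    values.\<close>
  have per': "\<rho> (k + 3 * j) = \<rho> k \<and> \<eta> (k + 3 * j) = \<eta> k" for k j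
  proof (induction j)
    case (Suc j)
    then show ?case using per[of "k + 3 * j"] by (simp add: add.assoc add.commute[of 3])
  qed simp
  have eq: "\<eta> k = \<rho> k" for k using per'[of k n] big[of "k + 3 * n"] by auto
  have "u k = y k" if "k \<le> n" for k
    using that
  proof (induction rule: inc_induct)
    case base
    then show ?case using big by blast
  next
    case (step k)
    then show ?case using u_rec[of k] y_rec[of k] eq by simp
  qed
  then have "u k = y k" for k using big by (cases "k \<le> n") auto
  with eq n2 show False by blast
qed

end

section \<open>Rigidity of towers over a division ring\<close>

context skew_field
begin

definition center :: "'a set" where
  "center = {z \<in> carrier R. \<forall>x\<in>carrier R. z \<otimes> x = x \<otimes> z}"

lemma nonzero_unit: "x \<in> carrier R \<Longrightarrow> x \<noteq> \<zero> \<Longrightarrow> x \<in> Units R"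
  using skew_field_Units by blast

lemma prod_zero:
  assumes "x \<in> carrier R" "z \<in> carrier R" "x \<otimes> z = \<zero>"
  shows "x = \<zero> \<or> z = \<zero>"
proof (rule ccontr)
  assume "\<not> (x = \<zero> \<or> z = \<zero>)"
  then have "x \<otimes> z \<in> Units R" using assms nonzero_unit by blast
  with assms(3) show False using skew_field_Units by simp
qed

lemma cancel_l: "a \<in> carrier R \<Longrightarrow> a \<noteq> \<zero> \<Longrightarrow> x \<in> carrier R \<Longrightarrow> z \<in> carrier R \<Longrightarrow> a \<otimes> x = a \<otimes> z \<Longrightarrow> x = z"
  using nonzero_unit Units_l_cancel by blast

lemma center_carrier: "z \<in> center \<Longrightarrow> z \<in> carrier R"
  unfolding center_def by blast

lemma center_comm: "z \<in> center \<Longrightarrow> x \<in> carrier R \<Longrightarrow> z \<otimes> x = x \<otimes> z"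
  unfolding center_def by blast

lemma center_subring: "subring center R"
proof (rule subringI)
  fix a b assume "a \<in> center" "b \<in> center"
  then have ab: "a \<in> carrier R" "b \<in> carrier R" "\<And>x. x \<in> carrier R \<Longrightarrow> a \<otimes> x = x \<otimes> a"
    "\<And>x. x \<in> carrier R \<Longrightarrow> b \<otimes> x = x \<otimes> b" unfolding center_def by auto
  then show "a \<oplus> b \<in> center" unfolding center_def by (auto simp: l_distr r_distr)
  have "(a \<otimes> b) \<otimes> x = x \<otimes> (a \<otimes> b)" if x: "x \<in> carrier R" for x
  proof -
    have "(a \<otimes> b) \<otimes> x = a \<otimes> (x \<otimes> b)" using ab(1,2) ab(4)[OF x] x by (simp add: m_assoc)
    also have "\<dots> = (x \<otimes> a) \<otimes> b" unfolding ab(3)[OF x, symmetric] using ab(1,2) x by (simp add: m_assoc)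
    also have "\<dots> = x \<otimes> (a \<otimes> b)" using ab(1,2) x by (simp add: m_assoc)
    finally show ?thesis .
  qed
  then show "a \<otimes> b \<in> center" unfolding center_def using ab by blast
qed (auto simp: center_def l_minus r_minus)

lemma center_inv:
  assumes "z \<in> center" "z \<noteq> \<zero>"
  shows "inv z \<in> center"
proof -
  have "z \<in> Units R" using assms center_carrier nonzero_unit by blast
  then show ?thesis unfolding center_def using inv_commutes center_comm[OF assms(1)] by simp
qed

abbreviation "Z \<equiv> R\<lparr>carrier := center\<rparr>"

lemma center_field: "field Z"
proof (rule cring.cring_fieldI2)
  have "ring Z" using subring_is_ring center_subring by blast
  moreover have "comm_monoid Z"
    using center_comm center_carrier monoid.monoid_comm_monoidI[OF ring.is_monoid[OF \<open>ring Z\<close>]] by auto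
  ultimately show "cring Z" unfolding cring_def by blast
  show "\<zero>\<^bsub>Z\<^esub> \<noteq> \<one>\<^bsub>Z\<^esub>" using one_not_zero by simp
  fix a assume a: "a \<in> carrier Z" "a \<noteq> \<zero>\<^bsub>Z\<^esub>"
  then have "inv a \<in> center" "a \<otimes> inv a = \<one>" using center_inv center_carrier nonzero_unit by auto
  then show "\<exists>b\<in>carrier Z. a \<otimes>\<^bsub>Z\<^esub> b = \<one>\<^bsub>Z\<^esub>" by auto
qed

end

text \<open>\<open>gen\<close> says that the ring consists of left fractions of polynomials over the
  division ring \<open>A\<close> in some \<open>y k\<close>. Its center will be a
  \<open>field_tower\<close> over the central part of \<open>A\<close>.\<close>

locale skew_tower = skew_field R for R (structure) +
  fixes A and y :: "nat \<Rightarrow> 'a" and q :: "nat \<Rightarrow> nat" and \<rho> :: "nat \<Rightarrow> 'a"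
  assumes A: "subring A R" and A_inv: "a \<in> A \<Longrightarrow> a \<noteq> \<zero> \<Longrightarrow> inv a \<in> A"
    and y: "y k \<in> center"
    and \<rho>: "\<rho> k \<in> A" "\<rho> k \<in> center" "\<rho> k \<noteq> \<zero>"
    and y_rec: "y k = y (Suc k) [^] q k \<ominus> \<rho> k"
    and q_prime: "prime (q k)" and q_inj: "inj q" and q_char: "add_pow R (q k) \<one> \<noteq> \<zero>"
    and transc: "\<lbrakk>a \<in> A; b \<in> pol A (y k) n; a \<otimes> y k [^] n \<oplus> b = \<zero>\<rbrakk> \<Longrightarrow> a = \<zero>"
    and gen: "x \<in> carrier R \<Longrightarrow> \<exists>k. \<exists>a\<in>polys A (y k). a \<noteq> \<zero> \<and> a \<otimes> x \<in> polys A (y k)"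
begin

abbreviation "F \<equiv> A \<inter> center"

lemma y_carrier [simp]: "y k \<in> carrier R"
  using y center_carrier by blast

sublocale adj: adjoin R A "y k" for k
  by (intro adjoin.intro adjoin_axioms.intro ring_axioms A y_carrier)
    (metis y center_comm subringE(1)[OF A] subset_iff)

lemma commutes_pol:
  assumes "s \<in> carrier R" "\<And>a. a \<in> A \<Longrightarrow> s \<otimes> a = a \<otimes> s" "x \<in> pol A (y k) n"
  shows "s \<otimes> x = x \<otimes> s"
  using assms(3)
proof (induction n arbitrary: x)
  case (Suc n)
  then obtain a b where ab: "a \<in> A" "b \<in> pol A (y k) n" "x = a \<otimes> y k [^] n \<oplus> b" by auto
  have "y k [^] n \<in> center" using subring_pow[OF center_subring y] .
  then have yn: "s \<otimes> y k [^] n = y k [^] n \<otimes> s" using center_comm assms(1) by simp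
  have "s \<otimes> (a \<otimes> y k [^] n) = a \<otimes> (s \<otimes> y k [^] n)"
    using assms(1) assms(2)[OF ab(1)] ab(1) by (simp flip: m_assoc)
  then have "s \<otimes> (a \<otimes> y k [^] n) = (a \<otimes> y k [^] n) \<otimes> s" unfolding yn using assms(1) ab(1) by (simp add: m_assoc)
  then show ?case using Suc.IH[OF ab(2)] ab assms(1) by (simp add: l_distr r_distr)
qed (use assms(1) in simp)

text \<open>The \<open>y k\<close> are central, so commuting with \<open>A\<close> gives commuting
  with polynomials, and after cancelling a denominator with all fractions.\<close>

lemma commutes_center:
  assumes s: "s \<in> carrier R" "\<And>a. a \<in> A \<Longrightarrow> s \<otimes> a = a \<otimes> s"
  shows "s \<in> center"
proof -
  have "s \<otimes> x = x \<otimes> s" if x: "x \<in> carrier R" for x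
  proof -
    obtain k a where a: "a \<in> polys A (y k)" "a \<noteq> \<zero>" "a \<otimes> x \<in> polys A (y k)" using gen x by blast
    have ac: "a \<in> carrier R" using a subringE(1)[OF adj.polys_subring] by blast
    have "s \<otimes> a = a \<otimes> s" "s \<otimes> (a \<otimes> x) = (a \<otimes> x) \<otimes> s"
      using commutes_pol[OF s] a unfolding polys_def by auto
    then have "a \<otimes> (s \<otimes> x) = a \<otimes> (x \<otimes> s)" using s x ac by (metis m_assoc)
    then show ?thesis using cancel_l[OF ac a(2)] s x by simp
  qed
  then show ?thesis unfolding center_def using s by blast
qed

text \<open>Commutation with \<open>e\<close> can be tested on coefficients: the commutator is again
  a polynomial, with the commutators of the coefficients as coefficients, and transcendence
  annihilates them.\<close>

lemma commuting_pol:
  assumes "x \<in> pol A (y k) n" "\<And>e. e \<in> A \<Longrightarrow> e \<otimes> x = x \<otimes> e"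
  shows "x \<in> pol F (y k) n"
  using assms
proof (induction n arbitrary: x)
  case (Suc n)
  then obtain s b where sb: "s \<in> A" "b \<in> pol A (y k) n" "x = s \<otimes> y k [^] n \<oplus> b" by auto
  have bc: "b \<in> carrier R" using sb adj.pol_carrier by blast
  have both: "e \<otimes> s = s \<otimes> e \<and> e \<otimes> b = b \<otimes> e" if e: "e \<in> A" for e
  proof -
    have ec: "e \<in> carrier R" "s \<in> carrier R" using e sb by auto
    have "e \<otimes> x \<ominus> x \<otimes> e = (e \<otimes> s \<ominus> s \<otimes> e) \<otimes> y k [^] n \<oplus> (e \<otimes> b \<ominus> b \<otimes> e)"
    proof -
      have "(s \<otimes> y k [^] n) \<otimes> e = (s \<otimes> e) \<otimes> y k [^] n" using ec adj.comm_pow[OF e, of k n] by (simp add: m_assoc)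
      then show ?thesis unfolding sb(3) using ec bc
        by (simp add: a_minus_def l_distr r_distr minus_add l_minus a_ac m_assoc)
    qed
    moreover have "e \<otimes> x \<ominus> x \<otimes> e = \<zero>" using Suc.prems(2)[OF e] ec Suc.prems(1) adj.pol_carrier
      by (simp add: a_minus_def r_neg del: pol.simps)
    ultimately have z: "(e \<otimes> s \<ominus> s \<otimes> e) \<otimes> y k [^] n \<oplus> (e \<otimes> b \<ominus> b \<otimes> e) = \<zero>" by simp
    have "e \<otimes> b \<ominus> b \<otimes> e \<in> pol A (y k) n" using e sb by (simp add: adj.pol_minus adj.pol_lmult adj.pol_rmult)
    moreover have "e \<otimes> s \<ominus> s \<otimes> e \<in> A" using e sb by (simp add: a_minus_def)
    ultimately have es: "e \<otimes> s \<ominus> s \<otimes> e = \<zero>" using transc z by blast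
    have "e \<otimes> b \<ominus> b \<otimes> e = \<zero>" using z[unfolded es] ec bc by simp
    then show ?thesis using es ec bc by simp
  qed
  have "s \<in> center" by (rule commutes_center) (use sb both in auto)
  moreover have "b \<in> pol F (y k) n" using Suc.IH sb both by blast
  ultimately show ?case using sb by auto
qed simp

text \<open>A monic left denominator of minimal degree is invariant under conjugation, so the denominator
  of a central fraction can be chosen with central coefficients.\<close>

lemma center_fraction:
  assumes u: "u \<in> center"
  shows "\<exists>k. \<exists>a\<in>polys F (y k). a \<noteq> \<zero> \<and> a \<otimes> u \<in> polys F (y k)"
proof -
  have uc: "u \<in> carrier R" using u center_carrier by blast
  obtain k a where a: "a \<in> polys A (y k)" "a \<noteq> \<zero>" "a \<otimes> u \<in> polys A (y k)" using gen uc by blast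
  note cl = subringE[OF adj.polys_subring[of k]]
  let ?M = "\<lambda>n. \<exists>b\<in>pol A (y k) n. (y k [^] n \<oplus> b) \<otimes> u \<in> polys A (y k)"
  \<comment> \<open>Any denominator becomes monic on left multiplication by the inverse of its
    leading coefficient. Its degree \<open>m\<close> is below the strict bound
    \<open>n\<close>.\<close>
  have normal: "\<exists>m<n. ?M m" if x: "x \<in> pol A (y k) n" "x \<noteq> \<zero>" "x \<otimes> u \<in> polys A (y k)" for x n
  proof -
    obtain m s b where *: "m < n" "s \<in> A" "s \<noteq> \<zero>" "b \<in> pol A (y k) m" "x = s \<otimes> y k [^] m \<oplus> b"
      using adj.pol_leading x by blast
    have i: "inv s \<in> A" "inv s \<otimes> s = \<one>" using A_inv nonzero_unit * by auto
    have c: "inv s \<in> carrier R" "s \<in> carrier R" "b \<in> carrier R" using i * adj.pol_carrier by auto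
    have "inv s \<otimes> x = (inv s \<otimes> s) \<otimes> y k [^] m \<oplus> inv s \<otimes> b" unfolding *(5) using c by (simp add: r_distr m_assoc)
    then have "inv s \<otimes> x = y k [^] m \<oplus> inv s \<otimes> b" unfolding i by simp
    moreover have "inv s \<otimes> x \<otimes> u \<in> polys A (y k)"
      using cl(6)[OF adj.S_polys[OF i(1)] x(3)] c uc adj.pol_carrier[OF x(1)] by (simp add: m_assoc)
    ultimately show ?thesis using *(1) adj.pol_lmult[OF i(1) *(4)] by auto
  qed
  have "\<exists>n. ?M n" using normal[of a] a unfolding polys_def by blast
  then obtain n where n: "?M n" and min: "\<And>m. m < n \<Longrightarrow> \<not> ?M m" using exists_least_iff[of ?M] by auto
  obtain b where b: "b \<in> pol A (y k) n" "(y k [^] n \<oplus> b) \<otimes> u \<in> polys A (y k)" using n by blast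
  have bc: "b \<in> carrier R" using b adj.pol_carrier by blast
  have comm: "e \<otimes> b = b \<otimes> e" if e: "e \<in> A" for e
  proof (cases "e = \<zero>")
    case False
    have i: "inv e \<in> A" "e \<in> Units R" using A_inv nonzero_unit e False by auto
    have ec: "e \<in> carrier R" "inv e \<in> carrier R" using e i by auto
    \<comment> \<open>The conjugated denominator is again monic of degree \<open>n\<close>, and
      still a denominator because \<open>u\<close> is central. The difference has lower degree, so
      minimality makes it vanish.\<close>
    let ?d = "e \<otimes> b \<otimes> inv e \<ominus> b"
    have dp: "?d \<in> pol A (y k) n" using e i b by (simp add: adj.pol_minus adj.pol_lmult adj.pol_rmult)
    have "(e \<otimes> y k [^] n) \<otimes> inv e = y k [^] n"
      using adj.comm_pow[OF e, of k n] ec i by (simp add: m_assoc)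
    then have "(y k [^] n \<oplus> e \<otimes> b \<otimes> inv e) = e \<otimes> (y k [^] n \<oplus> b) \<otimes> inv e"
      using ec bc by (simp add: r_distr l_distr)
    then have "(y k [^] n \<oplus> e \<otimes> b \<otimes> inv e) \<otimes> u = e \<otimes> ((y k [^] n \<oplus> b) \<otimes> u) \<otimes> inv e"
      using ec bc uc center_comm[OF u, of "inv e"] by (simp add: m_assoc)
    also have "\<dots> \<in> polys A (y k)"
      by (rule cl(6)[OF cl(6)[OF adj.S_polys[OF e] b(2)] adj.S_polys[OF i(1)]])
    finally have "(y k [^] n \<oplus> e \<otimes> b \<otimes> inv e) \<otimes> u \<ominus> (y k [^] n \<oplus> b) \<otimes> u \<in> polys A (y k)"
      unfolding a_minus_def by (rule cl(7)[OF _ cl(5)[OF b(2)]])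
    also have "(y k [^] n \<oplus> e \<otimes> b \<otimes> inv e) \<otimes> u \<ominus> (y k [^] n \<oplus> b) \<otimes> u = ?d \<otimes> u"
    proof -
      have "(v \<oplus> f) \<otimes> u \<ominus> (v \<oplus> b) \<otimes> u = (f \<ominus> b) \<otimes> u" if "v \<in> carrier R" "f \<in> carrier R" for v f
        using that bc uc by algebra
      then show ?thesis using ec bc by simp
    qed
    finally have "?d \<otimes> u \<in> polys A (y k)" .
    then have "?d = \<zero>" using normal[OF dp] min by blast
    then have "e \<otimes> b \<otimes> inv e = b" using ec bc by simp
    then have "e \<otimes> b \<otimes> inv e \<otimes> e = b \<otimes> e" by simp
    then show ?thesis using ec bc i by (simp add: m_assoc)
  qed (use bc in simp)
  let ?a = "y k [^] n \<oplus> b"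
  have ap: "?a \<in> pol A (y k) (Suc n)" using adj.pol_SucI[OF _ b(1), of \<one>] by simp
  have ac: "?a \<in> carrier R" using bc by simp
  have acomm: "e \<otimes> ?a = ?a \<otimes> e" if e: "e \<in> A" for e
    using e comm[OF e] adj.comm_pow[OF e, of k n] bc by (simp add: l_distr r_distr)
  have "?a \<in> polys F (y k)" using commuting_pol[OF ap acomm] unfolding polys_def by blast
  \<comment> \<open>The numerator is treated like the denominator: it commutes with
    \<open>A\<close>, hence has central coefficients.\<close>
  moreover have "e \<otimes> (?a \<otimes> u) = (?a \<otimes> u) \<otimes> e" if e: "e \<in> A" for e
    using acomm[OF e] center_comm[OF u, of e] ac uc e by (metis adj.S_carrier m_assoc)
  then have "?a \<otimes> u \<in> polys F (y k)" using commuting_pol b(2) unfolding polys_def by blast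
  moreover have "?a \<noteq> \<zero>"
  proof
    assume "?a = \<zero>"
    then have "\<one> \<otimes> y k [^] n \<oplus> b = \<zero>" by simp
    then show False using transc[OF _ b(1)] one_not_zero by simp
  qed
  ultimately show ?thesis by blast
qed

lemma field_tower_center: "field_tower Z F y q \<rho>"
proof -
  interpret Z: field Z by (rule center_field)
  have sub: "subring F R" using A center_subring subring_inter by blast
  have sf: "subfield F Z"
  proof (rule Z.subfieldI')
    show "subring F Z"
      by (rule Z.ring_incl_imp_subring) (use subring_is_ring[OF sub] in auto)
    fix k assume k: "k \<in> F - {\<zero>\<^bsub>Z\<^esub>}"
    then have "inv k \<in> F" "k \<in> Units R" using A_inv center_inv nonzero_unit center_carrier by auto
    moreover have "inv k = inv\<^bsub>Z\<^esub> k"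
      by (rule Z.inv_unique') (use \<open>inv k \<in> F\<close> \<open>k \<in> Units R\<close> k in auto)
    ultimately show "inv\<^bsub>Z\<^esub> k \<in> F" by simp
  qed
  have tr: "a = \<zero>\<^bsub>Z\<^esub>" if "a \<in> F" "b \<in> ring.pol Z F (y k) n" "a \<otimes>\<^bsub>Z\<^esub> y k [^]\<^bsub>Z\<^esub> n \<oplus>\<^bsub>Z\<^esub> b = \<zero>\<^bsub>Z\<^esub>"
    for a b k n
  proof -
    have "pol F (y k) n \<subseteq> pol A (y k) n" by (rule pol_subset) blast
    then show ?thesis using that transc[of a b k n] unfolding restrict_pol[OF center_subring] restrict_pow by auto
  qed
  show ?thesis
  proof (intro field_tower.intro field_tower_axioms.intro center_field sf)
    show "y k = y (Suc k) [^]\<^bsub>Z\<^esub> q k \<ominus>\<^bsub>Z\<^esub> \<rho> k" for k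
      using y_rec[of k] by (simp only: restrict_pow restrict_minus[OF center_subring \<rho>(2)])
    show "add_pow Z (q k) \<one>\<^bsub>Z\<^esub> \<noteq> \<zero>\<^bsub>Z\<^esub>" for k
      using q_char[of k] by (simp add: restrict_add_pow)
  qed (use y \<rho> q_prime q_inj tr in auto)
qed

text \<open>The whole sequence lies in the field \<open>center\<close>, where
  \<open>center_fraction\<close> supplies the rationality hypothesis of the commutative
  theorem.\<close>

theorem root_sequence_unique:
  assumes u: "\<And>k. u k \<in> center" and \<eta>: "\<And>k. \<eta> k \<in> A" "\<And>k. \<eta> k \<in> center"
    and u_rec: "\<And>k. u k = u (Suc k) [^] q k \<ominus> \<eta> k"
    and par0: "\<And>k. k mod 3 = 0 \<Longrightarrow> \<rho> k = \<one> \<and> \<eta> k = \<one>"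
    and par1: "\<And>k. k mod 3 = 1 \<Longrightarrow> \<rho> k = \<tau> \<and> \<eta> k = \<tau>"
    and per: "\<And>k. \<rho> (k + 3) = \<rho> k" "\<And>k. \<eta> (k + 3) = \<eta> k"
    and \<tau>: "\<And>n::nat. n > 0 \<Longrightarrow> \<tau> [^] n \<noteq> \<one>"
  shows "(\<forall>k. u k \<in> A) \<or> (\<forall>k. u k = y k \<and> \<eta> k = \<rho> k)"
proof -
  interpret T: field_tower Z F y q \<rho> by (rule field_tower_center)
  interpret S: root_sequence Z F y q \<rho> u \<eta> \<tau>
  proof unfold_locales
    fix k
    obtain n a where a: "a \<in> T.B n" "a \<noteq> \<zero>" "a \<otimes> u k \<in> T.B n"
      using center_fraction[OF u] unfolding restrict_polys[OF center_subring] by blast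
    then show "\<exists>n f g. T.rat n (u k) f g" using T.rat_reduce[of "a \<otimes> u k" n a "u k"] u[of k]
      by simp blast
    show "u k = u (Suc k) [^]\<^bsub>Z\<^esub> q k \<ominus>\<^bsub>Z\<^esub> \<eta> k"
      using u_rec[of k] by (simp only: restrict_pow restrict_minus[OF center_subring \<eta>(2)])
    show "\<tau> [^]\<^bsub>Z\<^esub> n \<noteq> \<one>\<^bsub>Z\<^esub>" if "n > 0" for n :: nat
      using \<tau>[OF that] by (simp only: restrict_pow) simp
  qed (use u \<eta> par0 par1 per in auto)
  show ?thesis using S.root_sequence_unique by auto
qed

end

section \<open>Polynomial functions in central coordinates\<close>

definition fun_ring :: "('a, 'm) ring_scheme \<Rightarrow> ('i \<Rightarrow> 'a) ring" where
  "fun_ring K = \<lparr>carrier = {f. \<forall>j. f j \<in> carrier K}, monoid.mult = (\<lambda>f g j. f j \<otimes>\<^bsub>K\<^esub> g j),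
     one = (\<lambda>_. \<one>\<^bsub>K\<^esub>), zero = (\<lambda>_. \<zero>\<^bsub>K\<^esub>), add = (\<lambda>f g j. f j \<oplus>\<^bsub>K\<^esub> g j)\<rparr>"

lemma fun_ring_simps [simp]:
  "f \<in> carrier (fun_ring K) \<longleftrightarrow> (\<forall>j. f j \<in> carrier K)"
  "f \<otimes>\<^bsub>fun_ring K\<^esub> g = (\<lambda>j. f j \<otimes>\<^bsub>K\<^esub> g j)" "f \<oplus>\<^bsub>fun_ring K\<^esub> g = (\<lambda>j. f j \<oplus>\<^bsub>K\<^esub> g j)"
  "\<one>\<^bsub>fun_ring K\<^esub> = (\<lambda>_. \<one>\<^bsub>K\<^esub>)" "\<zero>\<^bsub>fun_ring K\<^esub> = (\<lambda>_. \<zero>\<^bsub>K\<^esub>)"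
  by (simp_all add: fun_ring_def)

lemma fun_ring_pow [simp]: "f [^]\<^bsub>fun_ring K\<^esub> (n::nat) = (\<lambda>j. f j [^]\<^bsub>K\<^esub> n)"
  by (induction n) (simp_all add: nat_pow_def)

lemma (in ring) fun_ring: "ring (fun_ring R)"
proof (rule ringI)
  show "abelian_group (fun_ring R)"
  proof (rule abelian_groupI)
    fix f assume "f \<in> carrier (fun_ring R)"
    then show "\<exists>g\<in>carrier (fun_ring R). g \<oplus>\<^bsub>fun_ring R\<^esub> f = \<zero>\<^bsub>fun_ring R\<^esub>"
      by (intro bexI[of _ "\<lambda>j. \<ominus> f j"]) (auto simp: l_neg)
  qed (auto simp: a_ac)
  show "Group.monoid (fun_ring R)" by (rule monoidI) (auto simp: m_assoc)
qed (auto simp: l_distr r_distr)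

lemma (in ring) fun_ring_uminus:
  assumes "f \<in> carrier (fun_ring R)"
  shows "\<ominus>\<^bsub>fun_ring R\<^esub> f = (\<lambda>j. \<ominus> f j)"
proof -
  interpret W: ring "fun_ring R" by (rule fun_ring)
  show ?thesis by (rule W.minus_equality) (use assms in \<open>auto simp: l_neg\<close>)
qed

lemma (in ring) fun_ring_minus:
  "g \<in> carrier (fun_ring R) \<Longrightarrow> f \<ominus>\<^bsub>fun_ring R\<^esub> g = (\<lambda>j. f j \<ominus> g j)"
  by (simp add: a_minus_def fun_ring_uminus del: fun_ring_simps(1))

definition consts_in :: "('a, 'm) ring_scheme \<Rightarrow> ('i \<Rightarrow> 'a) set" where
  "consts_in K = {\<lambda>_. a | a. a \<in> carrier K}"

lemma (in ring) consts_in_subring: "subring (consts_in R) (fun_ring R)"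
proof -
  interpret W: ring "fun_ring R" by (rule fun_ring)
  show ?thesis
  proof (rule W.subringI)
    fix f g :: "'i \<Rightarrow> 'a" assume "f \<in> consts_in R" "g \<in> consts_in R"
    then obtain a b where ab: "a \<in> carrier R" "b \<in> carrier R" "f = (\<lambda>_. a)" "g = (\<lambda>_. b)"
      by (auto simp: consts_in_def)
    then show "f \<otimes>\<^bsub>fun_ring R\<^esub> g \<in> consts_in R" "f \<oplus>\<^bsub>fun_ring R\<^esub> g \<in> consts_in R"
      unfolding consts_in_def by auto
  next
    fix f :: "'i \<Rightarrow> 'a" assume "f \<in> consts_in R"
    then obtain a where a: "a \<in> carrier R" "f = (\<lambda>_. a)" by (auto simp: consts_in_def)
    then have "\<ominus>\<^bsub>fun_ring R\<^esub> f = (\<lambda>_. \<ominus> a)" by (simp add: fun_ring_uminus)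
    then show "\<ominus>\<^bsub>fun_ring R\<^esub> f \<in> consts_in R" unfolding consts_in_def using a by blast
  qed (auto simp: consts_in_def)
qed

locale central_function = skew_field R for R (structure) +
  fixes v :: "'i \<Rightarrow> 'a"
  assumes v: "v j \<in> center"
begin

abbreviation "V \<equiv> (fun_ring R :: ('i \<Rightarrow> 'a) ring)"
abbreviation "Cst \<equiv> (consts_in R :: ('i \<Rightarrow> 'a) set)"

lemma v_carrier [simp]: "v j \<in> carrier R"
  using v center_carrier by blast

sublocale V: ring V by (rule fun_ring)

sublocale adj: adjoin V Cst v
  by (intro adjoin.intro adjoin_axioms.intro fun_ring consts_in_subring)
    (auto simp: consts_in_def center_comm[OF v])

text \<open>The geometric sum identity at a fixed point \<open>i\<close>. The leading term of the
  cofactor is kept visible for the induction in \<open>finite_zeros\<close>; the factor may stand on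
  the right because the values of \<open>v\<close> are central.\<close>

lemma monomial_factor:
  assumes "a \<in> carrier R"
  shows "\<exists>h\<in>V.pol Cst v n. \<forall>j. a \<otimes> v j [^] Suc n \<ominus> a \<otimes> v i [^] Suc n = (a \<otimes> v j [^] n \<oplus> h j) \<otimes> (v j \<ominus> v i)"
proof (induction n)
  case 0
  have "a \<otimes> v j \<ominus> a \<otimes> v i = a \<otimes> (v j \<ominus> v i)" for j using assms by (simp add: a_minus_def r_distr r_minus)
  then show ?case using assms by auto
next
  case (Suc n)
  then obtain h where h: "h \<in> V.pol Cst v n"
    "\<And>j. a \<otimes> v j [^] Suc n \<ominus> a \<otimes> v i [^] Suc n = (a \<otimes> v j [^] n \<oplus> h j) \<otimes> (v j \<ominus> v i)" by blast
  let ?g = "((\<lambda>_. a) \<otimes>\<^bsub>V\<^esub> v [^]\<^bsub>V\<^esub> n \<oplus>\<^bsub>V\<^esub> h) \<otimes>\<^bsub>V\<^esub> (\<lambda>_. v i)"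
  have hc: "h j \<in> carrier R" for j using adj.pol_carrier[OF h(1)] by simp
  have "?g \<in> V.pol Cst v (Suc n)"
    by (rule adj.pol_rmult[OF _ adj.pol_SucI[OF _ h(1)]]) (use assms in \<open>auto simp: consts_in_def\<close>)
  moreover have "a \<otimes> v j [^] Suc (Suc n) \<ominus> a \<otimes> v i [^] Suc (Suc n) = (a \<otimes> v j [^] Suc n \<oplus> ?g j) \<otimes> (v j \<ominus> v i)" for j
  proof -
    let ?A = "a \<otimes> v j [^] Suc n" and ?B = "a \<otimes> v i [^] Suc n" and ?C = "a \<otimes> v j [^] n \<oplus> h j"
    have c: "?A \<in> carrier R" "?B \<in> carrier R" "?C \<in> carrier R" using assms hc by auto
    have "a \<otimes> v j [^] Suc (Suc n) \<ominus> a \<otimes> v i [^] Suc (Suc n) = ?A \<otimes> v j \<ominus> ?B \<otimes> v i"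
      using assms by (simp add: m_assoc)
    also have "\<dots> = ?A \<otimes> (v j \<ominus> v i) \<oplus> (?A \<ominus> ?B) \<otimes> v i" using c v_carrier[of i] v_carrier[of j] by algebra
    also have "(?A \<ominus> ?B) \<otimes> v i = ?C \<otimes> ((v j \<ominus> v i) \<otimes> v i)" unfolding h(2) using c by (simp add: m_assoc)
    also have "(v j \<ominus> v i) \<otimes> v i = v i \<otimes> (v j \<ominus> v i)" using center_comm[OF v, of "v j \<ominus> v i" i] by simp
    finally show ?thesis using c by (simp add: l_distr m_assoc)
  qed
  ultimately show ?case by blast
qed

lemma factor:
  assumes "b \<in> V.pol Cst v (Suc n)"
  shows "\<exists>h\<in>V.pol Cst v n. \<forall>j. b j \<ominus> b i = h j \<otimes> (v j \<ominus> v i)"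
  using assms
proof (induction n arbitrary: b)
  case 0
  then obtain a where "a \<in> carrier R" "b = (\<lambda>_. a)" by (auto simp: consts_in_def)
  then show ?case by (auto simp: a_minus_def r_neg)
next
  case (Suc n)
  obtain s b' where sb: "s \<in> Cst" "b' \<in> V.pol Cst v (Suc n)" "b = s \<otimes>\<^bsub>V\<^esub> v [^]\<^bsub>V\<^esub> Suc n \<oplus>\<^bsub>V\<^esub> b'"
    using Suc.prems by (subst (asm) V.pol.simps) blast
  obtain a where a: "a \<in> carrier R" "s = (\<lambda>_. a)" using sb(1) by (auto simp: consts_in_def)
  obtain h where h: "h \<in> V.pol Cst v n" "\<And>j. b' j \<ominus> b' i = h j \<otimes> (v j \<ominus> v i)" using Suc.IH[OF sb(2)] by blast
  obtain g where g: "g \<in> V.pol Cst v n"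
    "\<And>j. a \<otimes> v j [^] Suc n \<ominus> a \<otimes> v i [^] Suc n = (a \<otimes> v j [^] n \<oplus> g j) \<otimes> (v j \<ominus> v i)"
    using monomial_factor[OF a(1)] by blast
  have cc: "h j \<in> carrier R" "g j \<in> carrier R" "b' j \<in> carrier R" for j
    using adj.pol_carrier[OF h(1)] adj.pol_carrier[OF g(1)] adj.pol_carrier[OF sb(2)] by auto
  let ?h = "s \<otimes>\<^bsub>V\<^esub> v [^]\<^bsub>V\<^esub> n \<oplus>\<^bsub>V\<^esub> (g \<oplus>\<^bsub>V\<^esub> h)"
  have "?h \<in> V.pol Cst v (Suc n)" by (rule adj.pol_SucI[OF sb(1) adj.pol_add[OF g(1) h(1)]])
  moreover have "b j \<ominus> b i = ?h j \<otimes> (v j \<ominus> v i)" for j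
  proof -
    let ?A = "a \<otimes> v j [^] Suc n" and ?B = "a \<otimes> v i [^] Suc n"
    have "b j \<ominus> b i = (?A \<oplus> b' j) \<ominus> (?B \<oplus> b' i)" unfolding sb(3) a(2) by simp
    also have "\<dots> = (?A \<ominus> ?B) \<oplus> (b' j \<ominus> b' i)"
    proof -
      have "?A \<in> carrier R" "?B \<in> carrier R" using a(1) by auto
      then show ?thesis using cc(3)[of i] cc(3)[of j] by algebra
    qed
    also have "\<dots> = ?h j \<otimes> (v j \<ominus> v i)" unfolding g(2) h(2) a(2) using a(1) cc by (simp add: l_distr a_assoc)
    finally show ?thesis .
  qed
  ultimately show ?case by blast
qed

text \<open>Zeros are split off one at a time as in the commutative case. Central values are
  essential: over the quaternions the square plus one has infinitely many zeros. Values are counted,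
  since \<open>v\<close> may repeat them.\<close>

lemma finite_zeros:
  assumes "a \<in> carrier R" "a \<noteq> \<zero>" "b \<in> V.pol Cst v n"
  shows "finite (v ` {j. a \<otimes> v j [^] n \<oplus> b j = \<zero>})"
  using assms(3)
proof (induction n arbitrary: b)
  case 0
  then show ?case using assms by simp
next
  case (Suc n)
  let ?f = "\<lambda>j. a \<otimes> v j [^] Suc n \<oplus> b j"
  show ?case
  proof (cases "\<exists>i. ?f i = \<zero>")
    case True
    then obtain i where i: "?f i = \<zero>" by blast
    obtain h where h: "h \<in> V.pol Cst v n" "\<And>j. b j \<ominus> b i = h j \<otimes> (v j \<ominus> v i)" using factor[OF Suc.prems] by blast
    obtain g where g: "g \<in> V.pol Cst v n"
      "\<And>j. a \<otimes> v j [^] Suc n \<ominus> a \<otimes> v i [^] Suc n = (a \<otimes> v j [^] n \<oplus> g j) \<otimes> (v j \<ominus> v i)"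
      using monomial_factor[OF assms(1)] by blast
    have cc: "h j \<in> carrier R" "g j \<in> carrier R" "b j \<in> carrier R" for j
      using adj.pol_carrier[OF h(1)] adj.pol_carrier[OF g(1)] adj.pol_carrier[OF Suc.prems] by auto
    \<comment> \<open>Subtracting the zero \<open>?f i\<close> exhibits the factor; the cofactor has
      the same leading coefficient \<open>a\<close> and lower degree.\<close>
    have f: "?f j = (a \<otimes> v j [^] n \<oplus> (g \<oplus>\<^bsub>V\<^esub> h) j) \<otimes> (v j \<ominus> v i)" for j
    proof -
      let ?A = "a \<otimes> v j [^] Suc n" and ?B = "a \<otimes> v i [^] Suc n"
      have "?A \<in> carrier R" "?B \<in> carrier R" using assms(1) by auto
      then have "(?A \<oplus> b j) \<ominus> (?B \<oplus> b i) = (?A \<ominus> ?B) \<oplus> (b j \<ominus> b i)"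
        using cc(3)[of i] cc(3)[of j] by algebra
      also have "\<dots> = (a \<otimes> v j [^] n \<oplus> (g \<oplus>\<^bsub>V\<^esub> h) j) \<otimes> (v j \<ominus> v i)"
        unfolding g(2) h(2) using assms(1) cc by (simp add: l_distr a_assoc)
      finally show ?thesis unfolding i using assms(1) cc by (simp add: a_minus_def)
    qed
    have "v j \<in> insert (v i) (v ` {j. a \<otimes> v j [^] n \<oplus> (g \<oplus>\<^bsub>V\<^esub> h) j = \<zero>})" if "?f j = \<zero>" for j
    proof -
      have "a \<otimes> v j [^] n \<oplus> (g \<oplus>\<^bsub>V\<^esub> h) j = \<zero> \<or> v j \<ominus> v i = \<zero>"
        by (rule prod_zero) (use that f[of j] assms(1) cc in auto)
      then show ?thesis by auto
    qed
    then have sub: "v ` {j. ?f j = \<zero>} \<subseteq> insert (v i) (v ` {j. a \<otimes> v j [^] n \<oplus> (g \<oplus>\<^bsub>V\<^esub> h) j = \<zero>})" by blast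
    show ?thesis
      by (rule finite_subset[OF sub finite.insertI[OF Suc.IH[OF adj.pol_add[OF g(1) h(1)]]]])
  qed simp
qed

lemma polys_finite_zeros:
  assumes "f \<in> V.polys Cst v" "f i \<noteq> \<zero>"
  shows "finite (v ` {j. f j = \<zero>})"
proof -
  obtain n where "f \<in> V.pol Cst v n" using assms unfolding V.polys_def by blast
  moreover have "f \<noteq> \<zero>\<^bsub>V\<^esub>" using assms(2) by auto
  ultimately obtain k s b where *: "s \<in> Cst" "s \<noteq> \<zero>\<^bsub>V\<^esub>" "b \<in> V.pol Cst v k"
    "f = s \<otimes>\<^bsub>V\<^esub> v [^]\<^bsub>V\<^esub> k \<oplus>\<^bsub>V\<^esub> b" using adj.pol_leading by metis
  then obtain a where "a \<in> carrier R" "a \<noteq> \<zero>" "s = (\<lambda>_. a)" by (auto simp: consts_in_def)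
  then show ?thesis using finite_zeros[of a b k] * by simp
qed

text \<open>Each fibre consists of zeros of a monic polynomial of degree \<open>q\<close> and takes
  finitely many values of \<open>v\<close>. So a tower still takes infinitely many values after any
  number of downward steps.\<close>

lemma infinite_pow_image:
  assumes "infinite (range v)" "0 < (q::nat)" "a \<in> carrier R"
  shows "infinite (range (\<lambda>j. v j [^] q \<ominus> a))"
proof
  assume fin: "finite (range (\<lambda>j. v j [^] q \<ominus> a))"
  have sub: "range v \<subseteq> (\<Union>z\<in>range (\<lambda>j. v j [^] q \<ominus> a). v ` {j. v j [^] q \<ominus> a = z})" by auto
  have "finite (v ` {j. v j [^] q \<ominus> a = z})" if z: "z \<in> carrier R" for z
  proof -
    have "(\<lambda>_. \<ominus> (a \<oplus> z)) \<in> V.pol Cst v q"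
      by (rule adj.pol_mono[OF adj.S_pol]) (use assms z in \<open>auto simp: consts_in_def\<close>)
    then have "finite (v ` {j. \<one> \<otimes> v j [^] q \<oplus> \<ominus> (a \<oplus> z) = \<zero>})" using finite_zeros[of \<one>] one_not_zero by blast
    moreover have sub: "{j. v j [^] q \<ominus> a = z} \<subseteq> {j. \<one> \<otimes> v j [^] q \<oplus> \<ominus> (a \<oplus> z) = \<zero>}"
    proof clarsimp
      fix j
      assume "z = v j [^] q \<ominus> a"
      show "v j [^] q \<oplus> \<ominus> (a \<oplus> (v j [^] q \<ominus> a)) = \<zero>"
      proof -
        have "w \<oplus> \<ominus> (a \<oplus> (w \<ominus> a)) = \<zero>" if "w \<in> carrier R" for w using that assms(3) by algebra
        then show ?thesis by simp
      qed
    qed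
    ultimately show ?thesis using finite_subset[OF image_mono[OF sub]] by blast
  qed
  then have "finite (\<Union>z\<in>range (\<lambda>j. v j [^] q \<ominus> a). v ` {j. v j [^] q \<ominus> a = z})"
    using fin assms(3) by (intro finite_UN_I) auto
  then show False using finite_subset[OF sub] assms(1) by blast
qed

end

text \<open>A natural number encodes a level together with a finitely supported sequence of coordinates.\<close>

definition lev :: "nat \<Rightarrow> nat" where
  "lev j = fst (prod_decode j)"

definition pt :: "nat \<Rightarrow> nat \<Rightarrow> nat" where
  "pt j i = (let l = list_decode (snd (prod_decode j)) in if i < length l then l ! i else 0)"

definition mk :: "nat \<Rightarrow> nat \<Rightarrow> (nat \<Rightarrow> nat) \<Rightarrow> nat" where
  "mk N n p = prod_encode (n, list_encode (map p [0..<N]))"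

lemma lev_mk [simp]: "lev (mk N n p) = n"
  by (simp add: lev_def mk_def)

lemma pt_mk: "pt (mk N n p) i = (if i < N then p i else 0)"
  by (simp add: pt_def mk_def Let_def)

text \<open>Only the first \<open>N\<close> coordinates survive the re-encoding, so rewriting a
  coordinate with its own value gives a point that merely agrees with the old one up to
  \<open>N\<close>. Functions are therefore required to satisfy \<open>dep N\<close>.\<close>

definition upd :: "nat \<Rightarrow> nat \<Rightarrow> nat \<Rightarrow> nat \<Rightarrow> nat" where
  "upd N j s e = mk N (lev j) ((pt j)(s := e))"

lemma lev_upd [simp]: "lev (upd N j s e) = lev j"
  by (simp add: upd_def)

lemma pt_upd: "i < N \<Longrightarrow> pt (upd N j s e) i = (if i = s then e else pt j i)"
  by (simp add: upd_def pt_mk)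

definition agree :: "nat \<Rightarrow> nat \<Rightarrow> nat \<Rightarrow> bool" where
  "agree i j j' \<longleftrightarrow> lev j = lev j' \<and> (\<forall>s<i. pt j s = pt j' s)"

lemma agree_mono: "agree i j j' \<Longrightarrow> k \<le> i \<Longrightarrow> agree k j j'"
  by (auto simp: agree_def)

lemma agree_upd: "i \<le> s \<Longrightarrow> i \<le> N \<Longrightarrow> agree i (upd N j s e) j"
  by (auto simp: agree_def pt_upd)

lemma agree_upd_self: "agree N (upd N j s (pt j s)) j"
  by (auto simp: agree_def pt_upd)

definition dep :: "nat \<Rightarrow> (nat \<Rightarrow> 'a) \<Rightarrow> bool" where
  "dep i f \<longleftrightarrow> (\<forall>j j'. agree i j j' \<longrightarrow> f j = f j')"

lemma dep_mono: "dep i f \<Longrightarrow> i \<le> k \<Longrightarrow> dep k f"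
  unfolding dep_def using agree_mono by blast

text \<open>Coordinates of a point are natural numbers and \<open>c\<close> turns them into central
  elements. Infinitely many values per coordinate are enough to detect a non-zero
  polynomial.\<close>

locale generic_points = skew_field R for R (structure) +
  fixes c :: "nat \<Rightarrow> 'a" and N :: nat
  assumes c: "c i \<in> center" and c_inj: "inj c"
begin

abbreviation "W \<equiv> (fun_ring R :: (nat \<Rightarrow> 'a) ring)"

sublocale cf: central_function R c
  by unfold_locales (fact c)

abbreviation "PF \<equiv> cf.V.polys cf.Cst c"

lemma PF_subring: "subring PF W"
  by (rule cf.adj.polys_subring)

lemma PF_const: "a \<in> carrier R \<Longrightarrow> (\<lambda>_. a) \<in> PF"
  by (rule cf.adj.S_polys) (auto simp: consts_in_def)

lemma PF_mult: "f \<in> PF \<Longrightarrow> g \<in> PF \<Longrightarrow> (\<lambda>e. f e \<otimes> g e) \<in> PF"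
  using subringE(6)[OF PF_subring] by fastforce

lemma PF_add: "f \<in> PF \<Longrightarrow> g \<in> PF \<Longrightarrow> (\<lambda>e. f e \<oplus> g e) \<in> PF"
  using subringE(7)[OF PF_subring] by fastforce

lemma PF_carrier: "f \<in> PF \<Longrightarrow> f e \<in> carrier R"
  using subringE(1)[OF PF_subring] by fastforce

lemma PF_neg: "f \<in> PF \<Longrightarrow> (\<lambda>e. \<ominus> f e) \<in> PF"
  using subringE(5)[OF PF_subring, of f] fun_ring_uminus[of f] PF_carrier by fastforce

lemma PF_minus: "f \<in> PF \<Longrightarrow> g \<in> PF \<Longrightarrow> (\<lambda>e. f e \<ominus> g e) \<in> PF"
  unfolding a_minus_def by (intro PF_add PF_neg)

lemma PF_pow: "f \<in> PF \<Longrightarrow> (\<lambda>e. f e [^] (n::nat)) \<in> PF"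
  by (induction n) (auto intro: PF_const PF_mult)

text \<open>At a point of level \<open>n\<close> a tower takes an arbitrary value at height \<open>n\<close>, which determines those below, so its
  recursion is valid at height \<open>k\<close> only at points of level greater than \<open>k\<close>. This is why the finitely many levels
  below any bound are disregarded in \<open>negligible\<close>.\<close>

definition good :: "(nat \<Rightarrow> 'a) set" where
  "good = {f. (\<forall>j. f j \<in> carrier R) \<and> dep N f \<and> (\<forall>j s. s < N \<longrightarrow> (\<lambda>e. f (upd N j s e)) \<in> PF)}"

text \<open>Demanded on every level separately, because any finite number of levels is going to be
  disregarded.\<close>

definition nz :: "(nat \<Rightarrow> 'a) \<Rightarrow> bool" where
  "nz f \<longleftrightarrow> (\<forall>n. \<exists>j. lev j = n \<and> f j \<noteq> \<zero>)"

lemma good_carrier: "f \<in> good \<Longrightarrow> f j \<in> carrier R"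
  by (auto simp: good_def)

lemma good_const: "a \<in> carrier R \<Longrightarrow> (\<lambda>_. a) \<in> good"
  by (auto simp: good_def dep_def PF_const)

lemma good_add: "f \<in> good \<Longrightarrow> g \<in> good \<Longrightarrow> (\<lambda>j. f j \<oplus> g j) \<in> good"
  unfolding good_def dep_def by (auto intro!: PF_add)

lemma good_mult: "f \<in> good \<Longrightarrow> g \<in> good \<Longrightarrow> (\<lambda>j. f j \<otimes> g j) \<in> good"
  unfolding good_def dep_def by (auto intro!: PF_mult)

lemma good_subring: "subring good W"
proof (rule cf.V.subringI)
  fix f assume f: "f \<in> good"
  then have "(\<lambda>j. \<ominus> \<one> \<otimes> f j) \<in> good" by (intro good_mult good_const) auto
  then show "\<ominus>\<^bsub>W\<^esub> f \<in> good" using fun_ring_uminus[of f] good_carrier[OF f] by (simp add: l_minus)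
qed (auto simp: good_carrier good_const good_add good_mult)

text \<open>Two functions that are polynomial in each coordinate and do not vanish identically have a common
  point where neither vanishes: the coordinates of two given points are equalised one after the other.\<close>

lemma good_common_nonzero:
  assumes f: "f \<in> good" "lev a = n" "f a \<noteq> \<zero>" and g: "g \<in> good" "lev b = n" "g b \<noteq> \<zero>"
  shows "\<exists>j. lev j = n \<and> f j \<noteq> \<zero> \<and> g j \<noteq> \<zero>"
proof -
  have cofinite: "finite {e. h (upd N j s e) = \<zero>}" if h: "h \<in> good" "h j \<noteq> \<zero>" "s < N" for h j s
  proof -
    have "h (upd N j s (pt j s)) = h j" using h agree_upd_self unfolding good_def dep_def by blast
    then have "finite (c ` {e. h (upd N j s e) = \<zero>})"
      using cf.polys_finite_zeros[of "\<lambda>e. h (upd N j s e)" "pt j s"] h unfolding good_def by auto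
    then show ?thesis using c_inj by (metis finite_imageD inj_on_subset subset_UNIV)
  qed
  have "\<exists>a b. lev a = n \<and> lev b = n \<and> agree i a b \<and> f a \<noteq> \<zero> \<and> g b \<noteq> \<zero>" if "i \<le> N" for i
    using that
  proof (induction i)
    case 0
    then show ?case using f g by (intro exI[of _ a] exI[of _ b]) (auto simp: agree_def)
  next
    case (Suc i)
    then obtain a b where ab: "lev a = n" "lev b = n" "agree i a b" "f a \<noteq> \<zero>" "g b \<noteq> \<zero>" by auto
    have "finite ({e. f (upd N a i e) = \<zero>} \<union> {e. g (upd N b i e) = \<zero>})"
      using cofinite[OF f(1) ab(4)] cofinite[OF g(1) ab(5)] Suc.prems by simp
    then obtain e where "e \<notin> {e. f (upd N a i e) = \<zero>} \<union> {e. g (upd N b i e) = \<zero>}"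
      using ex_new_if_finite infinite_UNIV_nat by blast
    moreover have "agree (Suc i) (upd N a i e) (upd N b i e)"
      using ab(1-3) Suc.prems by (auto simp: agree_def pt_upd less_Suc_eq)
    ultimately show ?case using ab by (intro exI[of _ "upd N a i e"] exI[of _ "upd N b i e"]) auto
  qed
  then obtain a b where "lev a = n" "lev b = n" "agree N a b" "f a \<noteq> \<zero>" "g b \<noteq> \<zero>" by blast
  moreover then have "g a = g b" using g(1) unfolding good_def dep_def by blast
  ultimately show ?thesis by metis
qed

text \<open>Only the witness \<open>g\<close> has to be polynomial in the coordinates;
  \<open>f\<close> is arbitrary. The ambient ring thus contains pointwise inverses, which become
  honest inverses in the quotient.\<close>

definition negligible :: "(nat \<Rightarrow> 'a) set" where
  "negligible = {f \<in> carrier W. \<exists>g\<in>good. nz g \<and> (\<exists>n0. \<forall>j. lev j \<ge> n0 \<longrightarrow> g j \<noteq> \<zero> \<longrightarrow> f j = \<zero>)}"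

lemma negligibleI:
  assumes "f \<in> carrier W" "g \<in> good" "nz g" "\<And>j. n \<le> lev j \<Longrightarrow> g j \<noteq> \<zero> \<Longrightarrow> f j = \<zero>"
  shows "f \<in> negligible"
  unfolding negligible_def using assms by blast

lemma nz_mult: "f \<in> good \<Longrightarrow> nz f \<Longrightarrow> g \<in> good \<Longrightarrow> nz g \<Longrightarrow> nz (\<lambda>j. f j \<otimes> g j)"
  unfolding nz_def
proof
  fix n
  assume f: "f \<in> good" "\<forall>n. \<exists>j. lev j = n \<and> f j \<noteq> \<zero>" and g: "g \<in> good" "\<forall>n. \<exists>j. lev j = n \<and> g j \<noteq> \<zero>"
  then obtain a b where "lev a = n" "f a \<noteq> \<zero>" "lev b = n" "g b \<noteq> \<zero>" by blast
  then obtain j where "lev j = n" "f j \<noteq> \<zero>" "g j \<noteq> \<zero>" using good_common_nonzero f g by blast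
  then show "\<exists>j. lev j = n \<and> f j \<otimes> g j \<noteq> \<zero>" using prod_zero good_carrier f g by blast
qed

lemma negligible_ideal: "ideal negligible W"
proof (rule idealI)
  show "ring W" by (rule fun_ring)
  have one: "(\<lambda>_. \<one>) \<in> good" "nz (\<lambda>_. \<one>)"
    using good_const one_not_zero by (auto simp: nz_def) (metis lev_mk)
  show "subgroup negligible (add_monoid W)"
  proof (rule cf.V.add.subgroupI)
    have "(\<lambda>_. \<zero>) \<in> negligible" unfolding negligible_def using one by auto
    then show "negligible \<noteq> {}" by blast
  next
    fix f assume f: "f \<in> negligible"
    then have "\<ominus>\<^bsub>W\<^esub> f = (\<lambda>j. \<ominus> f j)" using fun_ring_uminus unfolding negligible_def by blast
    then show "\<ominus>\<^bsub>W\<^esub> f \<in> negligible" using f unfolding negligible_def by fastforce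
  next
    fix f g assume f: "f \<in> negligible" and g: "g \<in> negligible"
    obtain f' n where f': "f' \<in> good" "nz f'" "\<And>j. lev j \<ge> n \<Longrightarrow> f' j \<noteq> \<zero> \<Longrightarrow> f j = \<zero>"
      using f unfolding negligible_def by blast
    obtain g' m where g': "g' \<in> good" "nz g'" "\<And>j. lev j \<ge> m \<Longrightarrow> g' j \<noteq> \<zero> \<Longrightarrow> g j = \<zero>"
      using g unfolding negligible_def by blast
    have "f j \<oplus> g j = \<zero>" if "lev j \<ge> max n m" "f' j \<otimes> g' j \<noteq> \<zero>" for j
    proof -
      have "f' j \<noteq> \<zero>" "g' j \<noteq> \<zero>" using that(2) good_carrier f' g' by auto
      then show ?thesis using that(1) f'(3) g'(3) by simp
    qed
    then show "f \<oplus>\<^bsub>W\<^esub> g \<in> negligible"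
      by (intro negligibleI[OF _ good_mult[OF f'(1) g'(1)] nz_mult[OF f'(1,2) g'(1,2)], where n = "max n m"])
        (use f g in \<open>auto simp: negligible_def\<close>)
  qed (auto simp: negligible_def)
next
  fix f g assume "f \<in> negligible" "g \<in> carrier W"
  then show "g \<otimes>\<^bsub>W\<^esub> f \<in> negligible" "f \<otimes>\<^bsub>W\<^esub> g \<in> negligible"
    unfolding negligible_def by (auto, (metis r_null), (metis l_null))
qed

section \<open>The quotient by the negligible functions\<close>

sublocale I: ideal negligible W
  by (rule negligible_ideal)

abbreviation "P \<equiv> W Quot negligible"

definition cl :: "(nat \<Rightarrow> 'a) \<Rightarrow> (nat \<Rightarrow> 'a) set" where
  "cl f = negligible +>\<^bsub>W\<^esub> f"

sublocale P: ring P
  by (rule I.quotient_is_ring)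

lemma cl_hom: "cl \<in> ring_hom W P"
  using I.rcos_ring_hom unfolding cl_def by (simp add: ring_hom_def)

lemma cl_closed [simp]: "f \<in> carrier W \<Longrightarrow> cl f \<in> carrier P"
  using ring_hom_closed[OF cl_hom] .

lemma cl_surj: "x \<in> carrier P \<Longrightarrow> \<exists>f\<in>carrier W. x = cl f"
  unfolding cl_def FactRing_def A_RCOSETS_def' by auto

lemma cl_mult: "f \<in> carrier W \<Longrightarrow> g \<in> carrier W \<Longrightarrow> cl f \<otimes>\<^bsub>P\<^esub> cl g = cl (\<lambda>j. f j \<otimes> g j)"
  using ring_hom_mult[OF cl_hom, of f g] by simp

lemma cl_add: "f \<in> carrier W \<Longrightarrow> g \<in> carrier W \<Longrightarrow> cl f \<oplus>\<^bsub>P\<^esub> cl g = cl (\<lambda>j. f j \<oplus> g j)"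
  using ring_hom_add[OF cl_hom, of f g] by simp

lemma cl_one: "\<one>\<^bsub>P\<^esub> = cl (\<lambda>_. \<one>)"
  using ring_hom_one[OF cl_hom] by simp

lemma cl_zero: "\<zero>\<^bsub>P\<^esub> = cl (\<lambda>_. \<zero>)"
  using ring_hom_zero[OF cl_hom cf.V.ring_axioms P.ring_axioms] by simp

lemma cl_pow: "f \<in> carrier W \<Longrightarrow> cl f [^]\<^bsub>P\<^esub> (n::nat) = cl (\<lambda>j. f j [^] n)"
proof (induction n)
  case (Suc n)
  then show ?case using cl_mult[of "\<lambda>j. f j [^] n" f] by simp
qed (simp add: cl_one)

lemma cl_eq: "f \<in> carrier W \<Longrightarrow> g \<in> carrier W \<Longrightarrow> cl f = cl g \<longleftrightarrow> (\<lambda>j. f j \<ominus> g j) \<in> negligible"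
  using cf.V.quotient_eq_iff_same_a_r_cos[OF negligible_ideal, of f g] fun_ring_minus[of g f]
  unfolding cl_def by simp

lemma cl_neg: "f \<in> carrier W \<Longrightarrow> \<ominus>\<^bsub>P\<^esub> cl f = cl (\<lambda>j. \<ominus> f j)"
  by (rule P.minus_equality) (auto simp: cl_add cl_zero l_neg)

lemma cl_minus: "f \<in> carrier W \<Longrightarrow> g \<in> carrier W \<Longrightarrow> cl f \<ominus>\<^bsub>P\<^esub> cl g = cl (\<lambda>j. f j \<ominus> g j)"
  unfolding a_minus_def by (simp add: cl_neg cl_add)

lemma cl_eventually_eq:
  assumes "f \<in> carrier W" "g \<in> carrier W" "\<And>j. lev j \<ge> n \<Longrightarrow> f j = g j"
  shows "cl f = cl g"
proof -
  have "(\<lambda>_. \<one>) \<in> good" "nz (\<lambda>_. \<one>)"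
    using good_const one_not_zero by (auto simp: nz_def) (metis lev_mk)
  then have "(\<lambda>j. f j \<ominus> g j) \<in> negligible"
    unfolding negligible_def using assms by (auto intro!: bexI[of _ "\<lambda>_. \<one>"] exI[of _ n])
  then show ?thesis using cl_eq assms by blast
qed

text \<open>The inverse is taken pointwise, with the default zero where \<open>f\<close> vanishes;
  \<open>f\<close> itself witnesses that these places are negligible.\<close>

lemma cl_nz_unit:
  assumes f: "f \<in> good" "nz f"
  shows "cl f \<in> Units P"
proof -
  let ?g = "\<lambda>j. if f j = \<zero> then \<zero> else inv f j"
  have fc: "f \<in> carrier W" and gc: "?g \<in> carrier W" using good_carrier[OF f(1)] nonzero_unit by auto
  have "f j \<otimes> ?g j \<ominus> \<one> = \<zero>" "?g j \<otimes> f j \<ominus> \<one> = \<zero>" if "f j \<noteq> \<zero>" for j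
    using that nonzero_unit good_carrier[OF f(1)] by (auto simp: a_minus_def r_neg)
  then have "(\<lambda>j. f j \<otimes> ?g j \<ominus> \<one>) \<in> negligible" "(\<lambda>j. ?g j \<otimes> f j \<ominus> \<one>) \<in> negligible"
    using fc gc by (auto intro!: negligibleI[OF _ f, of _ 0] simp del: right_minus_eq)
  moreover have "(\<lambda>j. f j \<otimes> ?g j) \<in> carrier W" "(\<lambda>j. ?g j \<otimes> f j) \<in> carrier W" "(\<lambda>_. \<one>) \<in> carrier W"
    using fc gc by (simp_all add: if_split_mem1)
  ultimately have "cl f \<otimes>\<^bsub>P\<^esub> cl ?g = \<one>\<^bsub>P\<^esub>" "cl ?g \<otimes>\<^bsub>P\<^esub> cl f = \<one>\<^bsub>P\<^esub>"
    unfolding cl_mult[OF fc gc] cl_mult[OF gc fc] cl_one by (simp_all only: cl_eq)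
  then show ?thesis unfolding Units_def using cl_closed[OF fc] cl_closed[OF gc] by blast
qed

lemma P_one_not_zero: "\<one>\<^bsub>P\<^esub> \<noteq> \<zero>\<^bsub>P\<^esub>"
proof
  assume "\<one>\<^bsub>P\<^esub> = \<zero>\<^bsub>P\<^esub>"
  then have "(\<lambda>_. \<one> \<ominus> \<zero>) \<in> negligible" using cl_eq[of "\<lambda>_. \<one>" "\<lambda>_. \<zero>"] cl_one cl_zero by simp
  then obtain g n where "nz g" "\<And>j. lev j \<ge> n \<Longrightarrow> g j \<noteq> \<zero> \<Longrightarrow> \<one> \<ominus> \<zero> = \<zero>" unfolding negligible_def by blast
  then have "\<one> \<ominus> \<zero> = \<zero>" unfolding nz_def by (metis le_refl)
  then show False using one_not_zero by (simp add: a_minus_def)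
qed

lemma zero_not_unit: "\<zero>\<^bsub>P\<^esub> \<notin> Units P"
proof
  assume u: "\<zero>\<^bsub>P\<^esub> \<in> Units P"
  have "\<zero>\<^bsub>P\<^esub> \<otimes>\<^bsub>P\<^esub> inv\<^bsub>P\<^esub> \<zero>\<^bsub>P\<^esub> = \<zero>\<^bsub>P\<^esub>" by (rule P.l_null[OF P.Units_inv_closed[OF u]])
  then show False unfolding P.Units_r_inv[OF u] by (rule notE[OF P_one_not_zero])
qed

end

section \<open>Generic towers\<close>

definition period3 :: "'a \<Rightarrow> 'a \<Rightarrow> 'a \<Rightarrow> nat \<Rightarrow> 'a" where
  "period3 a b z k = (if k mod 3 = 0 then a else if k mod 3 = 1 then b else z)"

lemma period3_in: "a \<in> S \<Longrightarrow> b \<in> S \<Longrightarrow> z \<in> S \<Longrightarrow> period3 a b z k \<in> S"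
  by (simp add: period3_def)

lemma (in ring) finsum_in_subring:
  assumes "subring S R" "finite A" "\<And>x. x \<in> A \<Longrightarrow> f x \<in> S"
  shows "(\<Oplus>x\<in>A. f x) \<in> S"
  using assms(2,3)
proof (induction A)
  case (insert x A)
  then have "f \<in> A \<rightarrow> carrier R" "f x \<in> carrier R" using subringE(1)[OF assms(1)] by auto
  then show ?case using insert subringE(7)[OF assms(1)] by simp
qed (simp add: subringE(2)[OF assms(1)])

locale tower_points = generic_points +
  fixes q :: "nat \<Rightarrow> nat" and m :: nat and ex :: "nat \<Rightarrow> nat \<Rightarrow> nat" and \<tau> :: 'a
  assumes q_prime: "prime (q k)" and q_inj: "inj q" and q_char: "add_pow R (q k) \<one> \<noteq> \<zero>"
    and mN: "m \<le> N" and \<tau>: "\<tau> \<in> center" and \<tau>_nonzero: "\<tau> \<noteq> \<zero>"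
begin

text \<open>The value at height \<open>n - d\<close> of a tower whose value at height \<open>n\<close> is \<open>v\<close>.\<close>

primrec descend :: "(nat \<Rightarrow> 'a) \<Rightarrow> 'a \<Rightarrow> nat \<Rightarrow> nat \<Rightarrow> 'a" where
  "descend \<rho> v n 0 = v"
| "descend \<rho> v n (Suc d) = descend \<rho> v n d [^] q (n - Suc d) \<ominus> \<rho> (n - Suc d)"

text \<open>The towers with third parameter one, defined ahead of \<open>th\<close>, which is built
  from their bottoms. For \<open>i < m\<close> they reappear as \<open>t\<close>.\<close>

definition x :: "nat \<Rightarrow> nat \<Rightarrow> nat \<Rightarrow> 'a" where
  "x i k j = descend (period3 \<one> \<tau> \<one>) (c (pt j i)) (lev j) (lev j - k)"

definition th :: "nat \<Rightarrow> nat \<Rightarrow> 'a" where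
  "th i j = (if i < m then \<one> else \<Oplus>s\<in>{..<m}. x s 0 j [^] ex i s)"

definition t :: "nat \<Rightarrow> nat \<Rightarrow> nat \<Rightarrow> 'a" where
  "t i k j = descend (period3 \<one> \<tau> (th i j)) (c (pt j i)) (lev j) (lev j - k)"

lemma t_x: "i < m \<Longrightarrow> t i k = x i k"
  by (simp add: t_def x_def th_def fun_eq_iff)

lemmas center_closed = subringE(2,3,5,6,7)[OF center_subring]

lemma center_minus: "a \<in> center \<Longrightarrow> b \<in> center \<Longrightarrow> a \<ominus> b \<in> center"
  by (simp add: a_minus_def center_closed)

lemma descend_center:
  assumes "v \<in> center" "\<And>k. \<rho> k \<in> center"
  shows "descend \<rho> v n d \<in> center"
  by (induction d) (auto intro: assms center_minus subring_pow[OF center_subring])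

lemma x_center: "x i k j \<in> center"
  unfolding x_def by (intro descend_center c period3_in center_closed \<tau>)

lemma th_center: "th i j \<in> center"
  unfolding th_def using finsum_in_subring[OF center_subring, of "{..<m}"] x_center subring_pow[OF center_subring]
  by (auto intro: center_closed)

lemma t_center: "t i k j \<in> center"
  unfolding t_def by (intro descend_center c period3_in center_closed \<tau> th_center)

lemma t_carrier [simp]: "t i k j \<in> carrier R"
  using t_center center_carrier by blast

lemma th_carrier [simp]: "th i j \<in> carrier R"
  using th_center center_carrier by blast

lemma x_carrier [simp]: "x i k j \<in> carrier R"
  using x_center center_carrier by blast

lemma \<tau>_carrier [simp]: "\<tau> \<in> carrier R"
  using \<tau> center_carrier by blast

lemma t_step:
  assumes "k < lev j"
  shows "t i k j = t i (Suc k) j [^] q k \<ominus> period3 \<one> \<tau> (th i j) k"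
proof -
  have "lev j - k = Suc (lev j - Suc k)" "lev j - Suc (lev j - Suc k) = k" using assms by simp_all
  then show ?thesis unfolding t_def by simp
qed

lemma descend_PF:
  assumes "v \<in> PF" "\<And>k. (\<lambda>e. \<rho> e k) \<in> PF"
  shows "(\<lambda>e. descend (\<rho> e) (v e) n d) \<in> PF"
  by (induction d) (auto intro: assms PF_minus PF_pow)

lemma coord_PF: "s < N \<Longrightarrow> i < N \<Longrightarrow> (\<lambda>e. c (pt (upd N j s e) i)) \<in> PF"
  using cf.adj.y_polys PF_const[of "c (pt j i)"] by (cases "i = s") (auto simp: pt_upd)

lemma x_PF: "s < N \<Longrightarrow> i < N \<Longrightarrow> (\<lambda>e. x i k (upd N j s e)) \<in> PF"
  unfolding x_def lev_upd by (intro descend_PF coord_PF PF_const) (auto intro: period3_in)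

lemma finsum_PF:
  assumes "finite A" "\<And>s. s \<in> A \<Longrightarrow> f s \<in> PF"
  shows "(\<lambda>e. \<Oplus>s\<in>A. f s e) \<in> PF"
  using assms
proof (induction A)
  case (insert a A)
  have "(\<lambda>s. f s e) \<in> A \<rightarrow> carrier R" "f a e \<in> carrier R" for e using insert.prems PF_carrier by auto
  then show ?case using insert PF_add[of "f a"] by simp
qed (simp add: PF_const)

lemma th_PF: "s < N \<Longrightarrow> (\<lambda>e. th i (upd N j s e)) \<in> PF"
  unfolding th_def by (cases "i < m") (use mN in \<open>auto intro!: PF_const finsum_PF PF_pow x_PF\<close>)

lemma period3_PF:
  assumes "f \<in> PF"
  shows "(\<lambda>e. period3 \<one> \<tau> (f e) k) \<in> PF"
  unfolding period3_def using assms by (cases "k mod 3 = 0"; cases "k mod 3 = 1") (auto intro: PF_const)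

lemma t_PF: "s < N \<Longrightarrow> i < N \<Longrightarrow> (\<lambda>e. t i k (upd N j s e)) \<in> PF"
  unfolding t_def lev_upd by (intro descend_PF coord_PF period3_PF th_PF)

lemma x_dep: "dep (Suc i) (x i k)"
  unfolding dep_def x_def agree_def by auto

lemma th_dep: "m \<le> i \<Longrightarrow> dep m (th i)"
  unfolding dep_def th_def
proof (intro allI impI)
  fix j j' assume "m \<le> i" "agree m j j'"
  then have "x s 0 j = x s 0 j'" if "s < m" for s
    using x_dep[of s 0] agree_mono[of m j j' "Suc s"] that unfolding dep_def by simp
  then show "(if i < m then \<one> else \<Oplus>s\<in>{..<m}. x s 0 j [^] ex i s) =
      (if i < m then \<one> else \<Oplus>s\<in>{..<m}. x s 0 j' [^] ex i s)" by (auto intro!: finsum_cong')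
qed

lemma th_dep': "dep i (th i)"
proof (cases "i < m")
  case True
  then show ?thesis by (simp add: dep_def th_def)
qed (use dep_mono[OF th_dep, of i i] in simp)

lemma t_dep: "dep (Suc i) (t i k)"
proof -
  have thj: "th i j = th i j'" if "agree (Suc i) j j'" for j j'
    using th_dep'[of i] agree_mono[OF that, of i] unfolding dep_def by simp
  have "t i k j = t i k j'" if "agree (Suc i) j j'" for j j'
    using that thj[OF that] unfolding t_def by (simp add: agree_def)
  then show ?thesis unfolding dep_def by blast
qed

text \<open>The function-level counterpart of the stage formed by the first \<open>i\<close> towers;
  coordinate \<open>i\<close> is still free over it.\<close>

definition D :: "nat \<Rightarrow> (nat \<Rightarrow> 'a) set" where
  "D i = {f \<in> good. dep i f}"

lemma D_subring: "subring (D i) W"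
proof (rule cf.V.subringI)
  fix f assume f: "f \<in> D i"
  then have "f \<in> carrier W" unfolding D_def good_def by simp
  then show "\<ominus>\<^bsub>W\<^esub> f \<in> D i" using f subringE(5)[OF good_subring, of f] fun_ring_uminus[of f]
    unfolding D_def dep_def by auto
qed (use subringE[OF good_subring] in \<open>auto simp: D_def dep_def\<close>)

lemma t_D: "i < N \<Longrightarrow> t i k \<in> D (Suc i)"
  unfolding D_def good_def using t_dep[of i k] dep_mono[OF t_dep, of i N k] t_PF by auto

sublocale DA: adjoin W "D i" "t i k" for i k
  by (intro adjoin.intro adjoin_axioms.intro fun_ring D_subring)
    (auto simp: D_def good_def center_comm[OF t_center])

lemma pol_D:
  assumes "i < N" "h \<in> cf.V.pol (D i) (t i k) n"
  shows "h \<in> D (Suc i)"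
proof -
  have "D i \<subseteq> D (Suc i)" unfolding D_def using dep_mono[of i _ "Suc i"] by auto
  then show ?thesis using DA.polys_minimal[OF D_subring _ t_D[OF assms(1)]] DA.polysI[OF assms(2)] by blast
qed

text \<open>Fixing all coordinates but the \<open>i\<close>-th leaves a polynomial in the finite-to-one function \<open>t i k\<close>
  with constant coefficients.\<close>

lemma lead_nz:
  assumes i: "i < N" and g: "g \<in> D i" "nz g" and h: "h \<in> cf.V.pol (D i) (t i k) n"
  shows "nz (\<lambda>j. g j \<otimes> t i k j [^] n \<oplus> h j)"
  unfolding nz_def
proof
  fix l
  obtain j where j: "lev j = l" "g j \<noteq> \<zero>" using g(2) unfolding nz_def by blast
  let ?v = "\<lambda>e. t i k (upd N j i e)"
  interpret v: central_function R ?v by unfold_locales (rule t_center)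
  \<comment> \<open>Along the line through \<open>j\<close> in direction \<open>i\<close>,
    everything that depends on earlier coordinates only is constant; in particular \<open>g\<close>
    stays non-zero.\<close>
  have const: "f (upd N j i e) = f j" if "dep i f" for f :: "nat \<Rightarrow> 'a" and e
    using that agree_upd[of i i N j e] i unfolding dep_def by simp
  have *: "(\<lambda>e. b (upd N j i e)) \<in> cf.V.pol cf.Cst ?v n" if "b \<in> cf.V.pol (D i) (t i k) n" for b n
    using that
  proof (induction n arbitrary: b)
    case (Suc n)
    then obtain s b' where sb: "s \<in> D i" "b' \<in> cf.V.pol (D i) (t i k) n"
      "b = s \<otimes>\<^bsub>W\<^esub> t i k [^]\<^bsub>W\<^esub> n \<oplus>\<^bsub>W\<^esub> b'" by auto
    have "(\<lambda>e. b (upd N j i e)) = (\<lambda>_. s j) \<otimes>\<^bsub>W\<^esub> ?v [^]\<^bsub>W\<^esub> n \<oplus>\<^bsub>W\<^esub> (\<lambda>e. b' (upd N j i e))"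
      unfolding sb(3) using const[of s] sb(1) unfolding D_def by simp
    moreover have "(\<lambda>_. s j) \<in> cf.Cst" using sb(1) unfolding D_def good_def consts_in_def by auto
    ultimately show ?case using v.adj.pol_SucI Suc.IH[OF sb(2)] by presburger
  qed simp
  have "finite (?v ` {e. g j \<otimes> ?v e [^] n \<oplus> h (upd N j i e) = \<zero>})"
    using v.finite_zeros[OF _ j(2) *[OF h]] g(1) unfolding D_def good_def by blast
  moreover have "infinite (range ?v)"
  proof -
    let ?\<rho> = "period3 \<one> \<tau> (th i j)"
    have \<rho>: "?\<rho> k \<in> center" for k by (intro period3_in center_closed \<tau> th_center)
    \<comment> \<open>The top value \<open>c e\<close> is arbitrary, and each of the downward steps
      is finite-to-one.\<close>
    have "infinite (range (\<lambda>e. descend ?\<rho> (c e) l d))" for d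
    proof (induction d)
      case 0
      then show ?case using c_inj finite_imageD infinite_UNIV_nat by auto
    next
      case (Suc d)
      interpret w: central_function R "\<lambda>e. descend ?\<rho> (c e) l d"
        by unfold_locales (intro descend_center c \<rho>)
      show ?case using w.infinite_pow_image[OF Suc] prime_gt_0_nat[OF q_prime] \<rho> center_carrier by simp
    qed
    moreover have "?v e = descend ?\<rho> (c e) l (l - k)" for e
      unfolding t_def using const[OF th_dep'] i j(1) by (simp add: pt_upd)
    ultimately show ?thesis by simp
  qed
  ultimately obtain e where "g j \<otimes> ?v e [^] n \<oplus> h (upd N j i e) \<noteq> \<zero>"
    by (metis (mono_tags, lifting) UNIV_eq_I mem_Collect_eq)
  then have "g (upd N j i e) \<otimes> t i k (upd N j i e) [^] n \<oplus> h (upd N j i e) \<noteq> \<zero>"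
    using const[of g] g(1) unfolding D_def by simp
  then show "\<exists>j. lev j = l \<and> g j \<otimes> t i k j [^] n \<oplus> h j \<noteq> \<zero>" using j(1) by (intro exI[of _ "upd N j i e"]) simp
qed

definition T :: "nat \<Rightarrow> nat \<Rightarrow> (nat \<Rightarrow> 'a) set" where
  "T i k = cl (t i k)"

definition Th :: "nat \<Rightarrow> (nat \<Rightarrow> 'a) set" where
  "Th i = cl (th i)"

definition param :: "nat \<Rightarrow> nat \<Rightarrow> (nat \<Rightarrow> 'a) set" where
  "param i = period3 \<one>\<^bsub>P\<^esub> (cl (\<lambda>_. \<tau>)) (Th i)"

lemma T_closed [simp]: "T i k \<in> carrier P"
  unfolding T_def by simp

lemma cl_center:
  assumes "\<And>j. f j \<in> center" "a \<in> carrier P"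
  shows "cl f \<otimes>\<^bsub>P\<^esub> a = a \<otimes>\<^bsub>P\<^esub> cl f"
proof -
  obtain g where g: "g \<in> carrier W" "a = cl g" using cl_surj assms(2) by blast
  moreover have "f \<in> carrier W" using assms(1) center_carrier by simp
  ultimately show ?thesis using center_comm[OF assms(1)] by (simp add: cl_mult)
qed

lemma T_central: "a \<in> carrier P \<Longrightarrow> T i k \<otimes>\<^bsub>P\<^esub> a = a \<otimes>\<^bsub>P\<^esub> T i k"
  unfolding T_def by (rule cl_center[OF t_center])

lemma param_cl: "param i k = cl (\<lambda>j. period3 \<one> \<tau> (th i j) k)"
  unfolding param_def Th_def period3_def cl_one by simp

lemma param_central: "a \<in> carrier P \<Longrightarrow> param i k \<otimes>\<^bsub>P\<^esub> a = a \<otimes>\<^bsub>P\<^esub> param i k"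
  unfolding param_cl by (intro cl_center period3_in center_closed \<tau> th_center)

text \<open>For functions the recursion may fail at levels up to \<open>k\<close>; these are
  finitely many and disappear in the quotient.\<close>

lemma T_step: "T i k = T i (Suc k) [^]\<^bsub>P\<^esub> q k \<ominus>\<^bsub>P\<^esub> param i k"
proof -
  have "(\<lambda>j. period3 \<one> \<tau> (th i j) k) \<in> carrier W" by (auto intro!: period3_in)
  moreover from this have "cl (t i k) = cl (\<lambda>j. t i (Suc k) j [^] q k \<ominus> period3 \<one> \<tau> (th i j) k)"
    by (intro cl_eventually_eq[where n = "Suc k"]) (simp_all add: t_step)
  ultimately show ?thesis unfolding T_def param_cl by (simp add: cl_pow cl_minus)
qed

lemma Th_eq: "Th i = (if i < m then \<one>\<^bsub>P\<^esub> else \<Oplus>\<^bsub>P\<^esub>s\<in>{..<m}. T s 0 [^]\<^bsub>P\<^esub> ex i s)"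
proof (cases "i < m")
  case True
  then have "th i = (\<lambda>_. \<one>)" by (simp add: th_def fun_eq_iff)
  then show ?thesis using True by (simp add: Th_def cl_one)
next
  case False
  have *: "cl (\<lambda>j. \<Oplus>s\<in>A. x s 0 j [^] ex i s) = (\<Oplus>\<^bsub>P\<^esub>s\<in>A. T s 0 [^]\<^bsub>P\<^esub> ex i s)"
    if "finite A" "A \<subseteq> {..<m}" for A
    using that
  proof (induction A)
    case (insert a A)
    have "x a 0 = t a 0" using insert.prems t_x by simp
    then have "T a 0 [^]\<^bsub>P\<^esub> ex i a = cl (\<lambda>j. x a 0 j [^] ex i a)" unfolding T_def by (simp add: cl_pow)
    moreover have "(\<lambda>j. \<Oplus>s\<in>A. x s 0 j [^] ex i s) \<in> carrier W" "(\<lambda>j. x a 0 j [^] ex i a) \<in> carrier W"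
      by (simp_all add: Pi_def)
    ultimately show ?case using insert cl_add[of "\<lambda>j. x a 0 j [^] ex i a" "\<lambda>j. \<Oplus>s\<in>A. x s 0 j [^] ex i s"]
      by (simp add: Pi_def)
  qed (simp add: cl_zero)
  have "th i = (\<lambda>j. \<Oplus>s\<in>{..<m}. x s 0 j [^] ex i s)" using False by (simp add: th_def fun_eq_iff)
  then show ?thesis using False *[of "{..<m}"] by (simp add: Th_def)
qed

section \<open>The rings generated by the constants and the first towers\<close>

primrec Rg :: "nat \<Rightarrow> (nat \<Rightarrow> 'a) set set" where
  "Rg 0 = cl ` consts_in R"
| "Rg (Suc i) = (\<Union>k. P.polys (Rg i) (T i k))"

lemma consts_carrier: "f \<in> (consts_in R :: (nat \<Rightarrow> 'a) set) \<Longrightarrow> f \<in> carrier W"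
  by (auto simp: consts_in_def)

lemma Rg_SucI: "a \<in> P.polys (Rg i) (T i k) \<Longrightarrow> a \<in> Rg (Suc i)"
  by auto

lemma cl_Rg0: "a \<in> carrier R \<Longrightarrow> cl (\<lambda>_. a) \<in> Rg 0"
  unfolding Rg.simps consts_in_def by blast

lemma Rg0_subring: "subring (Rg 0) P"
proof (rule P.subringI)
  note cs = subringE[OF consts_in_subring]
  fix a assume "a \<in> Rg 0"
  then obtain f where f: "f \<in> consts_in R" "a = cl f" by auto
  then have "\<ominus>\<^bsub>P\<^esub> a = cl (\<ominus>\<^bsub>W\<^esub> f)" using fun_ring_uminus[OF consts_carrier[OF f(1)]] consts_carrier by (simp add: cl_neg)
  then show "\<ominus>\<^bsub>P\<^esub> a \<in> Rg 0" using cs(5)[OF f(1)] by simp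
  fix b assume "b \<in> Rg 0"
  then obtain g where g: "g \<in> consts_in R" "b = cl g" by auto
  show "a \<otimes>\<^bsub>P\<^esub> b \<in> Rg 0" "a \<oplus>\<^bsub>P\<^esub> b \<in> Rg 0"
    using cs(6)[OF f(1) g(1)] cs(7)[OF f(1) g(1)] f g consts_carrier
    by (simp_all add: cl_mult cl_add image_iff) blast+
next
  show "Rg 0 \<subseteq> carrier P" using consts_carrier by auto
  show "\<one>\<^bsub>P\<^esub> \<in> Rg 0" using cl_one by (auto simp: consts_in_def)
qed

lemma adjoin_Rg: "subring (Rg i) P \<Longrightarrow> adjoin P (Rg i) (T i k)"
proof (intro adjoin.intro adjoin_axioms.intro P.ring_axioms T_closed)
  fix a assume "subring (Rg i) P" "a \<in> Rg i"
  then have "a \<in> carrier P" using subringE(1) by blast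
  then show "a \<otimes>\<^bsub>P\<^esub> T i k = T i k \<otimes>\<^bsub>P\<^esub> a" using T_central by simp
qed

text \<open>Relative to a chain up to \<open>i\<close>, so that \<open>Rg_chain\<close> can use it
  within its induction: \<open>Th i\<close> involves earlier bottoms, and it must lie in
  \<open>Rg i\<close> for the polynomial rings over \<open>Rg i\<close> to grow with the
  height.\<close>

lemma Rg_tower:
  assumes "\<And>s. s \<le> i \<Longrightarrow> subring (Rg s) P \<and> Rg s \<subseteq> Rg i"
  shows "Th i \<in> Rg i" "P.polys (Rg i) (T i k) \<subseteq> P.polys (Rg i) (T i (Suc k))"
proof -
  have sub: "subring (Rg i) P" using assms by blast
  show th: "Th i \<in> Rg i"
  proof (cases "i < m")
    case True
    then show ?thesis using subringE(3)[OF sub] by (simp add: Th_eq)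
  next
    case False
    have "T s 0 \<in> Rg i" if "s < m" for s
    proof -
      have "T s 0 \<in> P.polys (Rg s) (T s 0)"
        by (rule adjoin.y_polys[OF adjoin_Rg]) (use assms False that in auto)
      then have "T s 0 \<in> Rg (Suc s)" by auto
      then show ?thesis using assms[of "Suc s"] False that by auto
    qed
    then have "(\<Oplus>\<^bsub>P\<^esub>s\<in>{..<m}. T s 0 [^]\<^bsub>P\<^esub> ex i s) \<in> Rg i"
      using P.subring_pow[OF sub] by (intro P.finsum_in_subring[OF sub]) auto
    then show ?thesis using False by (simp add: Th_eq)
  qed
  have "cl (\<lambda>_. \<tau>) \<in> Rg 0" by (rule cl_Rg0) simp
  then have "cl (\<lambda>_. \<tau>) \<in> Rg i" using assms[of 0] by blast
  then have "param i k \<in> Rg i" unfolding param_def using th subringE(3)[OF sub] by (intro period3_in)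
  interpret a: adjoin P "Rg i" "T i k" using adjoin_Rg[OF sub] .
  interpret b: adjoin P "Rg i" "T i (Suc k)" using adjoin_Rg[OF sub] .
  have "T i (Suc k) [^]\<^bsub>P\<^esub> q k \<ominus>\<^bsub>P\<^esub> param i k \<in> P.polys (Rg i) (T i (Suc k))"
    unfolding a_minus_def
    by (intro subringE(5,7)[OF b.polys_subring] P.subring_pow[OF b.polys_subring] b.y_polys b.S_polys) fact
  then have "T i k \<in> P.polys (Rg i) (T i (Suc k))" using T_step[of i k] by simp
  then show "P.polys (Rg i) (T i k) \<subseteq> P.polys (Rg i) (T i (Suc k))"
    using b.S_polys by (intro a.polys_minimal b.polys_subring) auto
qed

lemma Rg_chain: "s \<le> i \<Longrightarrow> subring (Rg s) P \<and> Rg s \<subseteq> Rg i"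
proof (induction i arbitrary: s)
  case 0
  then show ?case using Rg0_subring by simp
next
  case (Suc i)
  have IH: "\<And>s. s \<le> i \<Longrightarrow> subring (Rg s) P \<and> Rg s \<subseteq> Rg i" using Suc.IH by blast
  interpret a: adjoin P "Rg i" "T i k" for k using adjoin_Rg IH by blast
  have mono: "P.polys (Rg i) (T i k) \<subseteq> P.polys (Rg i) (T i l)" if "k \<le> l" for k l
    using that by (induction rule: dec_induct) (use Rg_tower(2)[OF IH] in blast)+
  have two: "\<exists>k. a \<in> P.polys (Rg i) (T i k) \<and> b \<in> P.polys (Rg i) (T i k)"
    if ab: "a \<in> Rg (Suc i)" "b \<in> Rg (Suc i)" for a b
  proof -
    obtain k l where "a \<in> P.polys (Rg i) (T i k)" "b \<in> P.polys (Rg i) (T i l)" using ab by auto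
    then show ?thesis using mono[of k "max k l"] mono[of l "max k l"] by (meson max.cobounded1 max.cobounded2 subsetD)
  qed
  note ps = subringE[OF a.polys_subring]
  have "subring (Rg (Suc i)) P"
  proof (rule P.subringI)
    show "Rg (Suc i) \<subseteq> carrier P" using ps(1) by auto
    show "\<one>\<^bsub>P\<^esub> \<in> Rg (Suc i)" using Rg_SucI[OF ps(3)] .
    fix a assume a: "a \<in> Rg (Suc i)"
    then obtain k where "a \<in> P.polys (Rg i) (T i k)" by auto
    then show "\<ominus>\<^bsub>P\<^esub> a \<in> Rg (Suc i)" using Rg_SucI[OF ps(5)] by blast
    fix b assume "b \<in> Rg (Suc i)"
    then obtain k where k: "a \<in> P.polys (Rg i) (T i k)" "b \<in> P.polys (Rg i) (T i k)" using two a by blast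
    show "a \<otimes>\<^bsub>P\<^esub> b \<in> Rg (Suc i)" using Rg_SucI[OF ps(6)[OF k]] .
    show "a \<oplus>\<^bsub>P\<^esub> b \<in> Rg (Suc i)" using Rg_SucI[OF ps(7)[OF k]] .
  qed
  moreover have "Rg i \<subseteq> Rg (Suc i)" using Rg_SucI[OF a.S_polys] by blast
  ultimately show ?case using IH Suc.prems by (metis le_Suc_eq order_refl subset_trans)
qed

lemma Rg_subring: "subring (Rg i) P"
  using Rg_chain by blast

lemma Rg_mono: "s \<le> i \<Longrightarrow> Rg s \<subseteq> Rg i"
  using Rg_chain by blast

lemma Th_Rg: "Th i \<in> Rg i"
  using Rg_tower(1) Rg_chain by blast

sublocale RA: adjoin P "Rg i" "T i k" for i k
  using adjoin_Rg Rg_subring by blast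

lemma polys_Rg_mono: "k \<le> l \<Longrightarrow> P.polys (Rg i) (T i k) \<subseteq> P.polys (Rg i) (T i l)"
  by (induction rule: dec_induct) (use Rg_tower(2) Rg_chain in blast)+

lemma T_Rg: "T i k \<in> Rg (Suc i)"
  using RA.y_polys by auto

lemma param_Rg: "param i k \<in> Rg i"
proof -
  have "cl (\<lambda>_. \<tau>) \<in> Rg 0" by (rule cl_Rg0) simp
  then show ?thesis unfolding param_def
    using Rg_mono[of 0 i] Th_Rg subringE(3)[OF Rg_subring] by (intro period3_in) auto
qed

lemma pol_lift:
  assumes "Rg i \<subseteq> cl ` D i" "b \<in> P.pol (Rg i) (T i k) n"
  shows "\<exists>h\<in>cf.V.pol (D i) (t i k) n. cl h = b"
  using assms(2)
proof (induction n arbitrary: b)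
  case 0
  then show ?case using cl_zero by simp
next
  case (Suc n)
  then obtain s b' where sb: "s \<in> Rg i" "b' \<in> P.pol (Rg i) (T i k) n"
    "b = s \<otimes>\<^bsub>P\<^esub> T i k [^]\<^bsub>P\<^esub> n \<oplus>\<^bsub>P\<^esub> b'" by auto
  obtain h where h: "h \<in> cf.V.pol (D i) (t i k) n" "cl h = b'" using Suc.IH sb(2) by blast
  obtain f where f: "f \<in> D i" "cl f = s" using assms(1) sb(1) by blast
  have c: "f \<in> carrier W" "h \<in> carrier W" "t i k \<in> carrier W"
    using f(1) DA.S_carrier DA.pol_carrier[OF h(1)] by auto
  have "cl (f \<otimes>\<^bsub>W\<^esub> t i k [^]\<^bsub>W\<^esub> n \<oplus>\<^bsub>W\<^esub> h) = b"
    unfolding sb(3) T_def f(2)[symmetric] h(2)[symmetric] using c by (simp add: cl_pow cl_mult cl_add)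
  then show ?case using DA.pol_SucI[OF f(1) h(1)] by blast
qed

text \<open>The quotient has zero divisors, such as the indicator of the even levels, so a non-zero
  class need not be a unit. On \<open>Rg i\<close> this cannot happen: a representative is lifted
  from the leading coefficient, which is \<open>nz\<close> by induction, and \<open>lead_nz\<close>
  passes this on.\<close>

lemma Rg_rep:
  assumes "i \<le> N" "a \<in> Rg i"
  shows "\<exists>f\<in>D i. cl f = a \<and> (a = \<zero>\<^bsub>P\<^esub> \<or> nz f)"
  using assms
proof (induction i arbitrary: a)
  case 0
  then obtain s where s: "s \<in> carrier R" "a = cl (\<lambda>_. s)" by (auto simp: consts_in_def)
  have "(\<lambda>_. s) \<in> D 0" using good_const[OF s(1)] by (simp add: D_def dep_def)
  moreover have "nz (\<lambda>_. s)" if "s \<noteq> \<zero>" using that by (auto simp: nz_def) (metis lev_mk)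
  ultimately show ?case using s(2) cl_zero by (cases "s = \<zero>") auto
next
  case (Suc i)
  then have i: "i < N" by simp
  have lift: "Rg i \<subseteq> cl ` D i" using Suc.IH i by fastforce
  obtain k n where a: "a \<in> P.pol (Rg i) (T i k) n" using Suc.prems(2) by (auto simp: P.polys_def)
  show ?case
  proof (cases "a = \<zero>\<^bsub>P\<^esub>")
    case True
    then show ?thesis using subringE(2)[OF D_subring] cl_zero by auto
  next
    case False
    then obtain l s b where sb: "s \<in> Rg i" "s \<noteq> \<zero>\<^bsub>P\<^esub>" "b \<in> P.pol (Rg i) (T i k) l"
      "a = s \<otimes>\<^bsub>P\<^esub> T i k [^]\<^bsub>P\<^esub> l \<oplus>\<^bsub>P\<^esub> b" using RA.pol_leading[OF a] by metis
    obtain g where g: "g \<in> D i" "cl g = s" "nz g" using Suc.IH[OF _ sb(1)] i sb(2) by auto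
    obtain h where h: "h \<in> cf.V.pol (D i) (t i k) l" "cl h = b" using pol_lift[OF lift sb(3)] by blast
    have c: "g \<in> carrier W" "h \<in> carrier W" "t i k \<in> carrier W"
      using g(1) DA.S_carrier DA.pol_carrier[OF h(1)] by auto
    let ?f = "\<lambda>j. g j \<otimes> t i k j [^] l \<oplus> h j"
    have "?f \<in> cf.V.pol (D i) (t i k) (Suc l)" using DA.pol_SucI[OF g(1) h(1)] by simp
    then have "?f \<in> D (Suc i)" by (rule pol_D[OF i])
    moreover have "cl ?f = a" unfolding sb(4) T_def g(2)[symmetric] h(2)[symmetric] using c
      by (simp add: cl_pow cl_mult cl_add)
    ultimately show ?thesis using lead_nz[OF i g(1,3) h(1)] by blast
  qed
qed

lemma Rg_lift:
  assumes "i \<le> N"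
  shows "Rg i \<subseteq> cl ` D i"
proof
  fix s assume "s \<in> Rg i"
  then obtain f where "f \<in> D i" "cl f = s" using Rg_rep[OF assms] by blast
  then show "s \<in> cl ` D i" by (metis imageI)
qed

lemma Rg_unit: "i \<le> N \<Longrightarrow> a \<in> Rg i \<Longrightarrow> a \<noteq> \<zero>\<^bsub>P\<^esub> \<Longrightarrow> a \<in> Units P"
  using Rg_rep[of i a] cl_nz_unit unfolding D_def by blast

text \<open>A non-zero leading coefficient would make the polynomial the class of an
  \<open>nz\<close> function, hence a unit and not zero.\<close>

lemma Rg_transc:
  assumes i: "i < N" and "a \<in> Rg i" "b \<in> P.pol (Rg i) (T i k) n" "a \<otimes>\<^bsub>P\<^esub> T i k [^]\<^bsub>P\<^esub> n \<oplus>\<^bsub>P\<^esub> b = \<zero>\<^bsub>P\<^esub>"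
  shows "a = \<zero>\<^bsub>P\<^esub>"
proof (rule ccontr)
  assume "a \<noteq> \<zero>\<^bsub>P\<^esub>"
  then obtain g where g: "g \<in> D i" "cl g = a" "nz g" using Rg_rep[OF less_imp_le[OF i] assms(2)] by blast
  from pol_lift[OF Rg_lift[OF less_imp_le[OF i]] assms(3)]
  obtain h where h: "h \<in> cf.V.pol (D i) (t i k) n" "cl h = b" by (elim bexE)
  let ?f = "\<lambda>j. g j \<otimes> t i k j [^] n \<oplus> h j"
  have c: "g \<in> carrier W" "h \<in> carrier W" "t i k \<in> carrier W"
    using g(1) DA.S_carrier DA.pol_carrier[OF h(1)] by auto
  have "?f \<in> cf.V.pol (D i) (t i k) (Suc n)" using DA.pol_SucI[OF g(1) h(1)] by simp
  then have "?f \<in> good" using pol_D[OF i] unfolding D_def by blast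
  then have "cl ?f \<in> Units P" using cl_nz_unit lead_nz[OF i g(1,3) h(1)] by blast
  moreover have "cl ?f = cl g \<otimes>\<^bsub>P\<^esub> T i k [^]\<^bsub>P\<^esub> n \<oplus>\<^bsub>P\<^esub> cl h"
    unfolding T_def using c by (simp add: cl_pow cl_mult cl_add)
  then have "cl ?f = \<zero>\<^bsub>P\<^esub>" by (simp only: g(2) h(2) assms(4))
  ultimately show False using zero_not_unit by simp
qed

text \<open>The constants form a division ring. At each further stage any two elements lie in one
  polynomial ring, where \<open>ore_polys\<close> applies because non-zero elements are units of the
  quotient.\<close>

lemma Rg_ore: "i \<le> N \<Longrightarrow> P.left_ore (Rg i)"
proof (induction i)
  case 0
  show ?case unfolding P.left_ore_def
  proof (intro ballI)
    fix a b assume "a \<in> Rg 0" "b \<in> Rg 0"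
    then obtain r s where rs: "r \<in> carrier R" "s \<in> carrier R" "a = cl (\<lambda>_. r)" "b = cl (\<lambda>_. s)"
      by (auto simp: consts_in_def)
    have "\<exists>c d. c \<in> carrier R \<and> d \<in> carrier R \<and> (c = \<one> \<or> d = \<one>) \<and> c \<otimes> r = d \<otimes> s"
    proof (cases "r = \<zero>")
      case True
      then show ?thesis using rs by (intro exI[of _ \<one>] exI[of _ \<zero>]) auto
    next
      case False
      then show ?thesis using rs nonzero_unit[of r]
        by (intro exI[of _ "s \<otimes> inv r"] exI[of _ \<one>]) (auto simp: m_assoc)
    qed
    then obtain c d where cd: "c \<in> carrier R" "d \<in> carrier R" "c = \<one> \<or> d = \<one>" "c \<otimes> r = d \<otimes> s" by blast
    have "cl (\<lambda>_. c) \<in> Rg 0" "cl (\<lambda>_. d) \<in> Rg 0" using cd by (auto simp: consts_in_def)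
    moreover have "cl (\<lambda>_. c) \<otimes>\<^bsub>P\<^esub> a = cl (\<lambda>_. d) \<otimes>\<^bsub>P\<^esub> b" using cd rs by (simp add: cl_mult)
    moreover have "cl (\<lambda>_. c) \<noteq> \<zero>\<^bsub>P\<^esub> \<or> cl (\<lambda>_. d) \<noteq> \<zero>\<^bsub>P\<^esub>" using cd(3) P_one_not_zero cl_one by metis
    ultimately show "\<exists>c\<in>Rg 0. \<exists>d\<in>Rg 0. (c \<noteq> \<zero>\<^bsub>P\<^esub> \<or> d \<noteq> \<zero>\<^bsub>P\<^esub>) \<and> c \<otimes>\<^bsub>P\<^esub> a = d \<otimes>\<^bsub>P\<^esub> b" by blast
  qed
next
  case (Suc i)
  have ore: "P.left_ore (P.polys (Rg i) (T i k))" for k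
  proof (rule RA.ore_polys)
    show "P.left_ore (Rg i)" using Suc by simp
    show "P.polys (Rg i) (T i k) - {\<zero>\<^bsub>P\<^esub>} \<subseteq> Units P" using Rg_unit[OF Suc.prems] by auto
  qed (rule P_one_not_zero)
  show ?case unfolding P.left_ore_def
  proof (intro ballI)
    fix a b assume "a \<in> Rg (Suc i)" "b \<in> Rg (Suc i)"
    then obtain k l where "a \<in> P.polys (Rg i) (T i k)" "b \<in> P.polys (Rg i) (T i l)" by auto
    then have "a \<in> P.polys (Rg i) (T i (max k l))" "b \<in> P.polys (Rg i) (T i (max k l))"
      using polys_Rg_mono by (meson max.cobounded1 max.cobounded2 subsetD)+
    then obtain c d where "c \<in> P.polys (Rg i) (T i (max k l))" "d \<in> P.polys (Rg i) (T i (max k l))"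
      "c \<noteq> \<zero>\<^bsub>P\<^esub> \<or> d \<noteq> \<zero>\<^bsub>P\<^esub>" "c \<otimes>\<^bsub>P\<^esub> a = d \<otimes>\<^bsub>P\<^esub> b"
      using ore unfolding P.left_ore_def by meson
    then show "\<exists>c\<in>Rg (Suc i). \<exists>d\<in>Rg (Suc i). (c \<noteq> \<zero>\<^bsub>P\<^esub> \<or> d \<noteq> \<zero>\<^bsub>P\<^esub>) \<and> c \<otimes>\<^bsub>P\<^esub> a = d \<otimes>\<^bsub>P\<^esub> b"
      unfolding Rg.simps by blast
  qed
qed

lemma ore_Rg:
  assumes "i \<le> N"
  shows "ore_set P (Rg i)"
proof (intro ore_set.intro ore_set_axioms.intro P.ring_axioms Rg_subring P_one_not_zero)
  show "P.left_ore (Rg i)" using assms by (rule Rg_ore)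
  show "a \<in> Units P" if "a \<in> Rg i" "a \<noteq> \<zero>\<^bsub>P\<^esub>" for a using assms that by (rule Rg_unit)
qed

end

section \<open>The division rings of the stages\<close>

context tower_points
begin

definition A :: "nat \<Rightarrow> (nat \<Rightarrow> 'a) set set" where
  "A i = P.fracs (Rg i)"

abbreviation "E i \<equiv> P\<lparr>carrier := A i\<rparr>"

lemma A_subring: "i \<le> N \<Longrightarrow> subring (A i) P"
  unfolding A_def by (rule ore_set.fracs_subring[OF ore_Rg])

lemma A_carrier: "a \<in> A i \<Longrightarrow> a \<in> carrier P"
  unfolding A_def P.fracs_def by blast

lemma Rg_A: "i \<le> N \<Longrightarrow> Rg i \<subseteq> A i"
  unfolding A_def using ore_set.S_fracs[OF ore_Rg] by blast

lemma A_mono: "i \<le> k \<Longrightarrow> A i \<subseteq> A k"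
  unfolding A_def P.fracs_def using Rg_mono by blast

lemma E_skew_field: "i \<le> N \<Longrightarrow> skew_field (E i)"
  unfolding A_def by (rule ore_set.fracs_skew_field[OF ore_Rg])

lemma A_inv: "i \<le> N \<Longrightarrow> a \<in> A i \<Longrightarrow> a \<noteq> \<zero>\<^bsub>P\<^esub> \<Longrightarrow> a \<in> Units P \<and> inv\<^bsub>P\<^esub> a \<in> A i \<and> inv\<^bsub>E i\<^esub> a = inv\<^bsub>P\<^esub> a"
  unfolding A_def using ore_set.fracs_unit[OF ore_Rg] ore_set.fracs_inv(1)[OF ore_Rg] by blast

lemma T_A: "i < k \<Longrightarrow> k \<le> N \<Longrightarrow> T i l \<in> A k"
  using T_Rg[of i l] Rg_mono[of "Suc i" k] Rg_A[of k] by auto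

lemma Th_A: "i \<le> N \<Longrightarrow> Th i \<in> A i"
  using Th_Rg Rg_A by blast

lemma adjoin_A: "i < N \<Longrightarrow> adjoin P (A i) (T i k)"
  by (intro adjoin.intro adjoin_axioms.intro P.ring_axioms A_subring T_closed)
    (use T_central A_carrier in simp_all)

text \<open>Left denominators are cleared, first of \<open>b\<close> and then of the new leading
  coefficient; \<open>Rg_transc\<close> applies and the denominators cancel again.\<close>

lemma A_transc:
  assumes i: "i < N" and a: "a \<in> A i" and b: "b \<in> P.pol (A i) (T i k) n"
    and eq: "a \<otimes>\<^bsub>P\<^esub> T i k [^]\<^bsub>P\<^esub> n \<oplus>\<^bsub>P\<^esub> b = \<zero>\<^bsub>P\<^esub>"
  shows "a = \<zero>\<^bsub>P\<^esub>"
proof -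
  interpret O: ore_set P "Rg i" using ore_Rg i by simp
  have "a \<otimes>\<^bsub>P\<^esub> T i k [^]\<^bsub>P\<^esub> n \<oplus>\<^bsub>P\<^esub> b \<in> P.pol (A i) (T i k) (Suc n)" using a b by auto
  obtain s where s: "s \<in> Rg i" "s \<noteq> \<zero>\<^bsub>P\<^esub>" "s \<otimes>\<^bsub>P\<^esub> b \<in> P.pol (Rg i) (T i k) n"
    using O.pol_denominator[OF RA.adjoin_axioms] b unfolding A_def by blast
  have ac: "a \<in> carrier P" using a A_carrier by blast
  interpret AA: adjoin P "A i" "T i k"
    by (rule adjoin_A[OF i])
  have bc: "b \<in> carrier P" using AA.pol_carrier[OF b] .
  have "s \<otimes>\<^bsub>P\<^esub> a \<in> A i" using subringE(6)[OF A_subring] Rg_A s(1) a i by (meson less_imp_le subsetD)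
  then obtain r where r: "r \<in> Rg i" "r \<noteq> \<zero>\<^bsub>P\<^esub>" "r \<otimes>\<^bsub>P\<^esub> (s \<otimes>\<^bsub>P\<^esub> a) \<in> Rg i" unfolding A_def P.fracs_def by blast
  have rc: "r \<in> carrier P" "s \<in> carrier P" using r(1) s(1) RA.S_carrier by auto
  have "(r \<otimes>\<^bsub>P\<^esub> (s \<otimes>\<^bsub>P\<^esub> a)) \<otimes>\<^bsub>P\<^esub> T i k [^]\<^bsub>P\<^esub> n \<oplus>\<^bsub>P\<^esub> r \<otimes>\<^bsub>P\<^esub> (s \<otimes>\<^bsub>P\<^esub> b) =
      r \<otimes>\<^bsub>P\<^esub> (s \<otimes>\<^bsub>P\<^esub> (a \<otimes>\<^bsub>P\<^esub> T i k [^]\<^bsub>P\<^esub> n \<oplus>\<^bsub>P\<^esub> b))"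
    using rc ac bc by (simp add: P.r_distr P.m_assoc)
  also have "\<dots> = \<zero>\<^bsub>P\<^esub>" unfolding eq using rc by simp
  finally have "r \<otimes>\<^bsub>P\<^esub> (s \<otimes>\<^bsub>P\<^esub> a) = \<zero>\<^bsub>P\<^esub>"
    using Rg_transc[OF i r(3) RA.pol_lmult[OF r(1) s(3)]] by blast
  then have "s \<otimes>\<^bsub>P\<^esub> a = \<zero>\<^bsub>P\<^esub>" using O.cancel_zero[OF r(1,2)] rc ac P.m_closed by blast
  then show ?thesis using O.cancel_zero[OF s(1,2)] ac by blast
qed

lemma T_notin_A:
  assumes "i < N"
  shows "T i k \<notin> A i"
proof
  assume T: "T i k \<in> A i"
  note cl = subringE[OF A_subring[OF less_imp_le[OF assms]]]
  interpret AA: adjoin P "A i" "T i k"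
    by (rule adjoin_A[OF assms])
  have "\<one>\<^bsub>P\<^esub> \<otimes>\<^bsub>P\<^esub> T i k [^]\<^bsub>P\<^esub> (1::nat) \<oplus>\<^bsub>P\<^esub> \<ominus>\<^bsub>P\<^esub> T i k = \<zero>\<^bsub>P\<^esub>" by (simp add: P.r_neg)
  moreover have "\<ominus>\<^bsub>P\<^esub> T i k \<in> P.pol (A i) (T i k) 1" using AA.S_pol[OF cl(5)[OF T]] by simp
  ultimately show False using A_transc[OF assms cl(3)] P_one_not_zero by blast
qed

text \<open>Of two towers with different indices, the earlier already lies in the stage over which
  the later is transcendental.\<close>

lemma T_inj:
  assumes "i < N" "i' < N" "T i k = T i' k"
  shows "i = i'"
proof -
  have "\<not> i < i'" if "i' < N" "T i k = T i' k" for i i'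
    using T_notin_A[OF that(1)] T_A[of i i' k] that by auto
  then show ?thesis using assms by (metis linorder_neqE_nat)
qed

lemma cl_const_zero: "a \<in> carrier R \<Longrightarrow> cl (\<lambda>_. a) = \<zero>\<^bsub>P\<^esub> \<Longrightarrow> a = \<zero>"
proof (rule ccontr)
  assume a: "a \<in> carrier R" "cl (\<lambda>_. a) = \<zero>\<^bsub>P\<^esub>" "a \<noteq> \<zero>"
  then have "nz (\<lambda>_. a)" unfolding nz_def by (metis lev_mk)
  then show False using cl_nz_unit[OF good_const[OF a(1)]] a(2) zero_not_unit by simp
qed

lemma add_pow_P: "add_pow P (n::nat) \<one>\<^bsub>P\<^esub> = cl (\<lambda>_. add_pow R n \<one>)"
proof (induction n)
  case 0
  then show ?case by (simp add: add_pow_def cl_zero nat_pow_def)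
next
  case (Suc n)
  then show ?case using cl_add[of "\<lambda>_. add_pow R n \<one>" "\<lambda>_. \<one>"] by (simp add: cl_one)
qed

lemma param_nonzero:
  assumes "Th i \<noteq> \<zero>\<^bsub>P\<^esub>"
  shows "param i k \<noteq> \<zero>\<^bsub>P\<^esub>"
  using assms P_one_not_zero cl_const_zero[OF \<tau>_carrier] \<tau>_nonzero
  unfolding param_def period3_def by metis

text \<open>The bridge from the construction to the rigidity theorem: adjoining one tower and
  forming fractions is a \<open>skew_tower\<close> over the previous stage. The condition on
  \<open>Th i\<close> makes the parameters non-zero.\<close>

lemma stage:
  assumes i: "i < N" and th: "Th i \<noteq> \<zero>\<^bsub>P\<^esub>"
  shows "skew_tower (E (Suc i)) (A i) (T i) q (param i)"
proof -
  have iN: "i \<le> N" "Suc i \<le> N" using i by auto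
  interpret F: skew_field "E (Suc i)" using E_skew_field iN by blast
  note sub = A_subring[OF iN(2)]
  have central: "z \<in> F.center" if "z \<in> A (Suc i)" "\<And>a. a \<in> carrier P \<Longrightarrow> z \<otimes>\<^bsub>P\<^esub> a = a \<otimes>\<^bsub>P\<^esub> z" for z
    unfolding F.center_def using that A_carrier by simp
  have par: "param i k \<in> A i" for k using param_Rg Rg_A iN by blast
  show ?thesis
  proof (intro skew_tower.intro skew_tower_axioms.intro F.skew_field_axioms)
    show "subring (A i) (E (Suc i))"
      using P.restrict_subring[OF sub A_subring[OF iN(1)]] A_mono[of i "Suc i"] by simp
    show "inv\<^bsub>E (Suc i)\<^esub> a \<in> A i" if "a \<in> A i" "a \<noteq> \<zero>\<^bsub>E (Suc i)\<^esub>" for a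
    proof -
      have "a \<noteq> \<zero>\<^bsub>P\<^esub>" "a \<in> A (Suc i)" using that A_mono[of i "Suc i"] by auto
      then show ?thesis using A_inv[OF iN(2)] A_inv[OF iN(1) that(1)] by metis
    qed
    show "T i k \<in> F.center" for k by (rule central) (use T_A iN T_central in auto)
    show "param i k \<in> A i" for k by (rule par)
    show "param i k \<in> F.center" for k by (rule central) (use par A_mono[of i "Suc i"] param_central in auto)
    show "param i k \<noteq> \<zero>\<^bsub>E (Suc i)\<^esub>" for k using param_nonzero[OF th] by simp
    show "T i k = T i (Suc k) [^]\<^bsub>E (Suc i)\<^esub> q k \<ominus>\<^bsub>E (Suc i)\<^esub> param i k" for k
    proof -
      have "param i k \<in> A (Suc i)" using par A_mono[of i "Suc i"] by auto
      then show ?thesis using T_step[of i k] by (simp only: P.restrict_pow P.restrict_minus[OF sub])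
    qed
    show "prime (q k)" "inj q" for k by (rule q_prime, rule q_inj)
    show "add_pow (E (Suc i)) (q k) \<one>\<^bsub>E (Suc i)\<^esub> \<noteq> \<zero>\<^bsub>E (Suc i)\<^esub>" for k
    proof -
      have "add_pow P (q k) \<one>\<^bsub>P\<^esub> \<noteq> \<zero>\<^bsub>P\<^esub>" unfolding add_pow_P using cl_const_zero q_char by blast
      then show ?thesis by (simp add: P.restrict_add_pow)
    qed
    show "a = \<zero>\<^bsub>E (Suc i)\<^esub>" if "a \<in> A i" "b \<in> F.pol (A i) (T i k) n"
      "a \<otimes>\<^bsub>E (Suc i)\<^esub> T i k [^]\<^bsub>E (Suc i)\<^esub> n \<oplus>\<^bsub>E (Suc i)\<^esub> b = \<zero>\<^bsub>E (Suc i)\<^esub>" for a b k n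
      using A_transc[OF i that(1), of b k n] that(2,3)
      by (simp only: P.restrict_pow P.restrict_pol[OF sub]) simp
    show "\<exists>k. \<exists>a\<in>F.polys (A i) (T i k). a \<noteq> \<zero>\<^bsub>E (Suc i)\<^esub> \<and> a \<otimes>\<^bsub>E (Suc i)\<^esub> x \<in> F.polys (A i) (T i k)"
      if x: "x \<in> carrier (E (Suc i))" for x
    proof -
      obtain a where a: "a \<in> Rg (Suc i)" "a \<noteq> \<zero>\<^bsub>P\<^esub>" "a \<otimes>\<^bsub>P\<^esub> x \<in> Rg (Suc i)"
        using x unfolding A_def P.fracs_def by auto
      then obtain k l where kl: "a \<in> P.polys (Rg i) (T i k)" "a \<otimes>\<^bsub>P\<^esub> x \<in> P.polys (Rg i) (T i l)" by auto
      have "P.polys (Rg i) (T i j) \<subseteq> P.polys (A i) (T i j)" for j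
        unfolding P.polys_def using P.pol_subset[OF Rg_A[OF iN(1)]] by blast
      then have "a \<in> P.polys (A i) (T i (max k l))" "a \<otimes>\<^bsub>P\<^esub> x \<in> P.polys (A i) (T i (max k l))"
        using kl polys_Rg_mono by (meson max.cobounded1 max.cobounded2 subsetD)+
      then show ?thesis unfolding P.restrict_polys[OF sub] using a(2) by auto
    qed
  qed
qed

section \<open>The action of permutations of the towers\<close>

definition act :: "(nat \<Rightarrow> nat) \<Rightarrow> nat \<Rightarrow> nat" where
  "act p j = mk N (lev j) (\<lambda>i. pt j (p i))"

lemma lev_act [simp]: "lev (act p j) = lev j"
  by (simp add: act_def)

lemma pt_act: "i < N \<Longrightarrow> pt (act p j) i = pt j (p i)"
  by (simp add: act_def pt_mk)

text \<open>Exactly the compatibility that carries the third parameter of tower \<open>i\<close> to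
  that of tower \<open>p i\<close>: the first \<open>m\<close> towers are preserved as a set, and so
  are the exponents.\<close>

definition symmetry :: "(nat \<Rightarrow> nat) \<Rightarrow> bool" where
  "symmetry p \<longleftrightarrow> p permutes {..<N} \<and> (\<forall>i<m. p i < m) \<and>
    (\<forall>i s. m \<le> i \<longrightarrow> i < N \<longrightarrow> s < m \<longrightarrow> ex (p i) (p s) = ex i s)"

lemma symmetry_lt: "symmetry p \<Longrightarrow> i < N \<Longrightarrow> p i < N"
  unfolding symmetry_def using permutes_in_image[of p "{..<N}" i] by simp

lemma symmetry_inj: "symmetry p \<Longrightarrow> inj p"
  unfolding symmetry_def using permutes_inj by blast

lemma symmetry_image:
  assumes "symmetry p"
  shows "p ` {..<m} = {..<m}"
proof (rule endo_inj_surj)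
  show "p ` {..<m} \<subseteq> {..<m}" using assms unfolding symmetry_def by auto
  show "inj_on p {..<m}" using symmetry_inj[OF assms] inj_on_subset by blast
qed simp

lemma symmetry_ge:
  assumes "symmetry p" "m \<le> i"
  shows "m \<le> p i"
proof (rule ccontr)
  assume "\<not> m \<le> p i"
  then obtain s where "s < m" "p s = p i" using symmetry_image[OF assms(1)] by (metis imageE lessThan_iff not_le)
  then show False using symmetry_inj[OF assms(1)] assms(2) by (metis injD not_le)
qed

lemma x_act: "s < N \<Longrightarrow> x s k (act p j) = x (p s) k j"
  unfolding x_def by (simp add: pt_act)

text \<open>Invariance of the exponents allows the defining sum to be reindexed along
  \<open>p\<close>, which maps the first \<open>m\<close> indices onto themselves.\<close>

lemma th_act:
  assumes p: "symmetry p" and i: "i < N"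
  shows "th i (act p j) = th (p i) j"
proof (cases "i < m")
  case True
  then show ?thesis using p unfolding th_def symmetry_def by simp
next
  case False
  have "(\<Oplus>s\<in>{..<m}. x s 0 (act p j) [^] ex i s) = (\<Oplus>s\<in>{..<m}. x (p s) 0 j [^] ex (p i) (p s))"
    by (rule finsum_cong') (use False i p mN in \<open>auto simp: x_act symmetry_def\<close>)
  also have "\<dots> = (\<Oplus>s\<in>p ` {..<m}. x s 0 j [^] ex (p i) s)"
    by (rule finsum_reindex[symmetric]) (use symmetry_inj[OF p] inj_on_subset in auto)
  finally show ?thesis using False symmetry_ge[OF p, of i] symmetry_image[OF p] by (simp add: th_def)
qed

lemma t_act: "symmetry p \<Longrightarrow> i < N \<Longrightarrow> t i k (act p j) = t (p i) k j"
  unfolding t_def by (simp add: pt_act th_act)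

lemma good_act:
  assumes p: "symmetry p" and f: "f \<in> good"
  shows "(\<lambda>j. f (act p j)) \<in> good"
  unfolding good_def
proof (intro CollectI conjI allI impI)
  show "f (act p j) \<in> carrier R" for j using good_carrier[OF f] .
  show "dep N (\<lambda>j. f (act p j))" unfolding dep_def
  proof (intro allI impI)
    fix j j' assume "agree N j j'"
    then have "agree N (act p j) (act p j')" using symmetry_lt[OF p] by (auto simp: agree_def pt_act)
    then show "f (act p j) = f (act p j')" using f unfolding good_def dep_def by blast
  qed
  fix j s assume s: "s < N"
  have p': "p permutes {..<N}" using p unfolding symmetry_def by blast
  note inv = permutes_inverses[OF p']
  have invs: "inv_into UNIV p s < N" using permutes_in_image[OF permutes_inv[OF p'], of s] s by simp
  \<comment> \<open>Changing coordinate \<open>s\<close> before permuting amounts to changing the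
    coordinate at the preimage of \<open>s\<close> afterwards.\<close>
  have "f (act p (upd N j s e)) = f (upd N (act p j) (inv_into UNIV p s) e)" for e
  proof -
    have "agree N (act p (upd N j s e)) (upd N (act p j) (inv_into UNIV p s) e)"
      unfolding agree_def using symmetry_lt[OF p] inv by (auto simp: pt_act pt_upd)
    then show ?thesis using f unfolding good_def dep_def by blast
  qed
  then show "(\<lambda>e. f (act p (upd N j s e))) \<in> PF" using f invs unfolding good_def by simp
qed

lemma nz_act:
  assumes p: "symmetry p" and f: "f \<in> good" "nz f"
  shows "nz (\<lambda>j. f (act p j))"
  unfolding nz_def
proof
  fix n
  obtain j where j: "lev j = n" "f j \<noteq> \<zero>" using f(2) unfolding nz_def by blast
  have p': "p permutes {..<N}" using p unfolding symmetry_def by blast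
  note inv = permutes_inverses(2)[OF p']
  \<comment> \<open>Permuting the coordinates by the inverse gives a preimage of \<open>j\<close>,
    up to agreement on the first \<open>N\<close> coordinates.\<close>
  let ?j = "mk N n (\<lambda>i. pt j (inv_into UNIV p i))"
  have "agree N (act p ?j) j" using j(1) symmetry_lt[OF p] inv by (auto simp: agree_def pt_act pt_mk)
  then have "f (act p ?j) = f j" using f(1) unfolding good_def dep_def by blast
  then show "\<exists>j. lev j = n \<and> f (act p j) \<noteq> \<zero>" using j(2) by (intro exI[of _ ?j]) simp
qed

lemma negligible_act:
  assumes p: "symmetry p" and f: "f \<in> negligible"
  shows "(\<lambda>j. f (act p j)) \<in> negligible"
proof -
  obtain g n where g: "g \<in> good" "nz g" "\<And>j. n \<le> lev j \<Longrightarrow> g j \<noteq> \<zero> \<Longrightarrow> f j = \<zero>" and fc: "f \<in> carrier W"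
    using f unfolding negligible_def by blast
  show ?thesis
    by (rule negligibleI[OF _ good_act[OF p g(1)] nz_act[OF p g(1,2)], of _ n]) (use g(3) fc in auto)
qed

text \<open>Pullback of functions along \<open>act p\<close>. The chosen representative does not
  matter, because \<open>negligible_act\<close> makes the pullback well defined on classes.\<close>

definition psi :: "(nat \<Rightarrow> nat) \<Rightarrow> (nat \<Rightarrow> 'a) set \<Rightarrow> (nat \<Rightarrow> 'a) set" where
  "psi p X = cl (\<lambda>j. (SOME f. f \<in> carrier W \<and> cl f = X) (act p j))"

lemma psi_cl:
  assumes p: "symmetry p" and f: "f \<in> carrier W"
  shows "psi p (cl f) = cl (\<lambda>j. f (act p j))"
proof -
  let ?g = "SOME g. g \<in> carrier W \<and> cl g = cl f"
  have g: "?g \<in> carrier W \<and> cl ?g = cl f" by (rule someI[of _ f]) (use f in simp)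
  then have "(\<lambda>j. ?g j \<ominus> f j) \<in> negligible" using cl_eq f by blast
  from negligible_act[OF p this] show ?thesis unfolding psi_def using g f by (subst cl_eq) auto
qed

lemma psi_hom:
  assumes p: "symmetry p"
  shows "psi p \<in> ring_hom P P"
proof (rule ring_hom_memI)
  fix X Y assume "X \<in> carrier P" "Y \<in> carrier P"
  then obtain f g where fg: "f \<in> carrier W" "X = cl f" "g \<in> carrier W" "Y = cl g" using cl_surj by meson
  then have c: "(\<lambda>j. f (act p j)) \<in> carrier W" "(\<lambda>j. g (act p j)) \<in> carrier W"
    "(\<lambda>j. f j \<otimes> g j) \<in> carrier W" "(\<lambda>j. f j \<oplus> g j) \<in> carrier W" by auto
  show "psi p X \<in> carrier P" unfolding fg(2) psi_cl[OF p fg(1)] by (rule cl_closed[OF c(1)])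
  show "psi p (X \<otimes>\<^bsub>P\<^esub> Y) = psi p X \<otimes>\<^bsub>P\<^esub> psi p Y"
    unfolding fg(2,4) cl_mult[OF fg(1,3)] psi_cl[OF p fg(1)] psi_cl[OF p fg(3)] psi_cl[OF p c(3)] cl_mult[OF c(1,2)] ..
  show "psi p (X \<oplus>\<^bsub>P\<^esub> Y) = psi p X \<oplus>\<^bsub>P\<^esub> psi p Y"
    unfolding fg(2,4) cl_add[OF fg(1,3)] psi_cl[OF p fg(1)] psi_cl[OF p fg(3)] psi_cl[OF p c(4)] cl_add[OF c(1,2)] ..
next
  show "psi p \<one>\<^bsub>P\<^esub> = \<one>\<^bsub>P\<^esub>" unfolding cl_one by (rule psi_cl[OF p]) simp
qed

lemma psi_const: "symmetry p \<Longrightarrow> a \<in> Rg 0 \<Longrightarrow> psi p a = a"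
  using psi_cl by (auto simp: consts_in_def)

lemma psi_T: "symmetry p \<Longrightarrow> i < N \<Longrightarrow> psi p (T i k) = T (p i) k"
  unfolding T_def by (subst psi_cl) (simp_all add: t_act)

section \<open>Homomorphisms determined by the towers\<close>

lemma Rg_minimal:
  assumes U: "subring U P" "Rg 0 \<subseteq> U" and T: "\<And>s k. s < i \<Longrightarrow> T s k \<in> U"
  shows "Rg i \<subseteq> U"
  using T
proof (induction i)
  case 0
  then show ?case using U by blast
next
  case (Suc i)
  then have "Rg i \<subseteq> U" "\<And>k. T i k \<in> U" by simp_all
  then have "P.polys (Rg i) (T i k) \<subseteq> U" for k by (intro RA.polys_minimal U)
  then show ?case by auto
qed

lemma E_hom_ring: "n \<le> N \<Longrightarrow> h \<in> ring_hom (E n) P \<Longrightarrow> ring_hom_ring (E n) P h"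
  by (intro ring_hom_ringI2 P.ring_axioms P.subring_is_ring A_subring)

lemma hom_simps:
  assumes n: "n \<le> N" and h: "h \<in> ring_hom (E n) P"
  shows "a \<in> A n \<Longrightarrow> h a \<in> carrier P" "a \<in> A n \<Longrightarrow> b \<in> A n \<Longrightarrow> h (a \<otimes>\<^bsub>P\<^esub> b) = h a \<otimes>\<^bsub>P\<^esub> h b"
    "a \<in> A n \<Longrightarrow> b \<in> A n \<Longrightarrow> h (a \<oplus>\<^bsub>P\<^esub> b) = h a \<oplus>\<^bsub>P\<^esub> h b" "h \<one>\<^bsub>P\<^esub> = \<one>\<^bsub>P\<^esub>" "h \<zero>\<^bsub>P\<^esub> = \<zero>\<^bsub>P\<^esub>"
    "a \<in> A n \<Longrightarrow> h (\<ominus>\<^bsub>P\<^esub> a) = \<ominus>\<^bsub>P\<^esub> h a"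
proof -
  interpret h: ring_hom_ring "E n" P h using E_hom_ring[OF n h] .
  show "a \<in> A n \<Longrightarrow> h a \<in> carrier P" using h.hom_closed[of a] by simp
  show "a \<in> A n \<Longrightarrow> b \<in> A n \<Longrightarrow> h (a \<otimes>\<^bsub>P\<^esub> b) = h a \<otimes>\<^bsub>P\<^esub> h b" using h.hom_mult[of a b] by simp
  show "a \<in> A n \<Longrightarrow> b \<in> A n \<Longrightarrow> h (a \<oplus>\<^bsub>P\<^esub> b) = h a \<oplus>\<^bsub>P\<^esub> h b" using h.hom_add[of a b] by simp
  show "h \<one>\<^bsub>P\<^esub> = \<one>\<^bsub>P\<^esub>" using h.hom_one by simp
  show "h \<zero>\<^bsub>P\<^esub> = \<zero>\<^bsub>P\<^esub>" using h.hom_zero by simp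
  show "a \<in> A n \<Longrightarrow> h (\<ominus>\<^bsub>P\<^esub> a) = \<ominus>\<^bsub>P\<^esub> h a"
    using h.hom_a_inv[of a] P.restrict_uminus[OF A_subring[OF n]] by simp
qed

lemma hom_nonzero:
  assumes n: "n \<le> N" and h: "h \<in> ring_hom (E n) P" and a: "a \<in> A n" "a \<noteq> \<zero>\<^bsub>P\<^esub>"
  shows "h a \<in> Units P"
proof -
  have *: "a \<in> Units P" "inv\<^bsub>P\<^esub> a \<in> A n" using A_inv[OF n a] by auto
  have "h a \<otimes>\<^bsub>P\<^esub> h (inv\<^bsub>P\<^esub> a) = \<one>\<^bsub>P\<^esub>" "h (inv\<^bsub>P\<^esub> a) \<otimes>\<^bsub>P\<^esub> h a = \<one>\<^bsub>P\<^esub>"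
    using hom_simps(2)[OF n h a(1) *(2)] hom_simps(2)[OF n h *(2) a(1)] *(1) hom_simps(4)[OF n h]
    by (simp_all only: P.Units_r_inv P.Units_l_inv)
  then show ?thesis unfolding Units_def using hom_simps(1)[OF n h] a(1) *(2) by blast
qed

text \<open>The elements sent into \<open>A l\<close> form a subring, so for \<open>Rg i\<close> the
  generators suffice. Fractions follow because the image of a non-zero denominator is
  invertible.\<close>

lemma hom_in_A:
  assumes n: "n \<le> N" and h: "h \<in> ring_hom (E n) P" and i: "i \<le> n" and l: "l \<le> N"
    and const: "\<And>a. a \<in> Rg 0 \<Longrightarrow> h a \<in> A l" and T: "\<And>s k. s < i \<Longrightarrow> h (T s k) \<in> A l"
    and a: "a \<in> A i"
  shows "h a \<in> A l"
proof -
  note An = subringE[OF A_subring[OF n]] and Al = subringE[OF A_subring[OF l]]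
  have "subring {a \<in> A n. h a \<in> A l} P"
    by (rule P.subringI) (use An(1,3,5,6,7) Al(3,5,6,7) hom_simps[OF n h] in auto)
  then have R: "Rg i \<subseteq> {a \<in> A n. h a \<in> A l}"
    by (rule Rg_minimal) (use const T Rg_A[OF n] Rg_mono[of 0 n] T_A[OF _ n] i in auto)
  obtain b where b: "b \<in> Rg i" "b \<noteq> \<zero>\<^bsub>P\<^esub>" "b \<otimes>\<^bsub>P\<^esub> a \<in> Rg i" using a unfolding A_def P.fracs_def by blast
  have bn: "b \<in> A n" "h b \<in> A l" "h (b \<otimes>\<^bsub>P\<^esub> a) \<in> A l" and an: "a \<in> A n" using R b A_mono[OF i] a by auto
  have u: "h b \<in> Units P" by (rule hom_nonzero[OF n h bn(1) b(2)])
  then have "h b \<noteq> \<zero>\<^bsub>P\<^esub>" using zero_not_unit by metis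
  then have "inv\<^bsub>P\<^esub> (h b) \<in> A l" using A_inv[OF l bn(2)] by blast
  moreover have "h a = inv\<^bsub>P\<^esub> (h b) \<otimes>\<^bsub>P\<^esub> h (b \<otimes>\<^bsub>P\<^esub> a)"
  proof -
    have "inv\<^bsub>P\<^esub> (h b) \<otimes>\<^bsub>P\<^esub> h (b \<otimes>\<^bsub>P\<^esub> a) = (inv\<^bsub>P\<^esub> (h b) \<otimes>\<^bsub>P\<^esub> h b) \<otimes>\<^bsub>P\<^esub> h a"
      unfolding hom_simps(2)[OF n h bn(1) an]
      by (rule P.m_assoc[symmetric]) (use u hom_simps(1)[OF n h] bn an in auto)
    also have "\<dots> = h a" unfolding P.Units_l_inv[OF u] by (rule P.l_one[OF hom_simps(1)[OF n h an]])
    finally show ?thesis by (rule sym)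
  qed
  ultimately show ?thesis using Al(6) bn(3) by metis
qed

text \<open>The equaliser is a subring containing the generators; for a fraction, the common image
  of the denominator is a unit and cancels.\<close>

lemma hom_eq:
  assumes n: "n \<le> N" and h: "h \<in> ring_hom (E n) P" and g: "g \<in> ring_hom (E n) P"
    and const: "\<And>a. a \<in> Rg 0 \<Longrightarrow> h a = g a" and T: "\<And>s k. s < n \<Longrightarrow> h (T s k) = g (T s k)"
    and a: "a \<in> A n"
  shows "h a = g a"
proof -
  note An = subringE[OF A_subring[OF n]]
  have "subring {a \<in> A n. h a = g a} P"
  proof (rule P.subringI)
    show "{a \<in> A n. h a = g a} \<subseteq> carrier P" using An(1) by blast
    show "\<one>\<^bsub>P\<^esub> \<in> {a \<in> A n. h a = g a}" using An(3) hom_simps(4)[OF n h] hom_simps(4)[OF n g] by simp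
    show "\<ominus>\<^bsub>P\<^esub> a \<in> {a \<in> A n. h a = g a}" if "a \<in> {a \<in> A n. h a = g a}" for a
      using that An(5) hom_simps(6)[OF n h, of a] hom_simps(6)[OF n g, of a] by simp
    show "a \<otimes>\<^bsub>P\<^esub> b \<in> {a \<in> A n. h a = g a}" if "a \<in> {a \<in> A n. h a = g a}" "b \<in> {a \<in> A n. h a = g a}" for a b
      using that An(6) hom_simps(2)[OF n h, of a b] hom_simps(2)[OF n g, of a b] by simp
    show "a \<oplus>\<^bsub>P\<^esub> b \<in> {a \<in> A n. h a = g a}" if "a \<in> {a \<in> A n. h a = g a}" "b \<in> {a \<in> A n. h a = g a}" for a b
      using that An(7) hom_simps(3)[OF n h, of a b] hom_simps(3)[OF n g, of a b] by simp
  qed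
  then have R: "Rg n \<subseteq> {a \<in> A n. h a = g a}"
    by (rule Rg_minimal) (use const T Rg_A[OF n] Rg_mono[of 0 n] T_A[OF _ n] in blast)+
  obtain b where b: "b \<in> Rg n" "b \<noteq> \<zero>\<^bsub>P\<^esub>" "b \<otimes>\<^bsub>P\<^esub> a \<in> Rg n" using a unfolding A_def P.fracs_def by blast
  have bn: "b \<in> A n" "h b = g b" "h (b \<otimes>\<^bsub>P\<^esub> a) = g (b \<otimes>\<^bsub>P\<^esub> a)" using R b(1,3) by blast+
  have "h b \<otimes>\<^bsub>P\<^esub> h a = h b \<otimes>\<^bsub>P\<^esub> g a"
    using bn(3) unfolding hom_simps(2)[OF n h bn(1) a] hom_simps(2)[OF n g bn(1) a] bn(2) .
  then show ?thesis
    by (subst (asm) P.Units_l_cancel[OF hom_nonzero[OF n h bn(1) b(2)] hom_simps(1)[OF n h a] hom_simps(1)[OF n g a]])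
qed

end

section \<open>Automorphisms of the generic towers\<close>

lemma (in ring) add_left_cancel:
  assumes "a \<in> carrier R" "b \<in> carrier R" "d \<in> carrier R" "a \<oplus> b = a \<oplus> d"
  shows "b = d"
  using assms by (metis r_neg1)

lemma (in ring) diff_sums:
  assumes "a \<in> carrier R" "b \<in> carrier R" "d \<in> carrier R" "e \<in> carrier R"
  shows "a \<oplus> ((b \<ominus> d) \<ominus> e) = (a \<oplus> b) \<ominus> (e \<oplus> d)"
  using assms by algebra

locale rigid_points = tower_points +
  assumes m_pos: "0 < m" and ex_pos: "0 < ex i s" and \<tau>_order: "0 < n \<Longrightarrow> \<tau> [^] (n::nat) \<noteq> \<one>"
begin

abbreviation "\<tau>P \<equiv> cl (\<lambda>_. \<tau>)"

lemma \<tau>P_order: "0 < n \<Longrightarrow> \<tau>P [^]\<^bsub>P\<^esub> (n::nat) \<noteq> \<one>\<^bsub>P\<^esub>"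
proof
  assume n: "0 < n" "\<tau>P [^]\<^bsub>P\<^esub> n = \<one>\<^bsub>P\<^esub>"
  then have "cl (\<lambda>_. \<tau> [^] n) \<ominus>\<^bsub>P\<^esub> cl (\<lambda>_. \<one>) = \<zero>\<^bsub>P\<^esub>"
    by (simp add: cl_pow cl_one)
  then have "cl (\<lambda>_. \<tau> [^] n \<ominus> \<one>) = \<zero>\<^bsub>P\<^esub>" by (simp add: cl_minus)
  then have "\<tau> [^] n \<ominus> \<one> = \<zero>" by (intro cl_const_zero) simp_all
  then show False using \<tau>_order[OF n(1)] by simp
qed

section \<open>Power sums of the bottoms\<close>

abbreviation psum :: "nat \<Rightarrow> (nat \<Rightarrow> nat) \<Rightarrow> (nat \<Rightarrow> 'a) set" where
  "psum n e \<equiv> \<Oplus>\<^bsub>P\<^esub>s\<in>{..<n}. T s 0 [^]\<^bsub>P\<^esub> e s"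

lemma psum_Suc: "psum (Suc n) e = T n 0 [^]\<^bsub>P\<^esub> e n \<oplus>\<^bsub>P\<^esub> psum n e"
  unfolding lessThan_Suc by (rule P.finsum_insert) auto

lemma psum_A: "n \<le> N \<Longrightarrow> psum n e \<in> A n"
  using P.subring_pow[OF A_subring] T_A by (intro P.finsum_in_subring[OF A_subring]) auto

lemma T_pow_pol: "i < N \<Longrightarrow> e < n \<Longrightarrow> T i k [^]\<^bsub>P\<^esub> e \<in> P.pol (A i) (T i k) n"
proof -
  assume i: "i < N" and e: "e < n"
  interpret AA: adjoin P "A i" "T i k" by (rule adjoin_A[OF i])
  have "\<one>\<^bsub>P\<^esub> \<otimes>\<^bsub>P\<^esub> T i k [^]\<^bsub>P\<^esub> e \<oplus>\<^bsub>P\<^esub> \<zero>\<^bsub>P\<^esub> \<in> P.pol (A i) (T i k) (Suc e)"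
    by (rule AA.pol_SucI) simp_all
  then have "T i k [^]\<^bsub>P\<^esub> e \<in> P.pol (A i) (T i k) (Suc e)" by (simp del: P.pol.simps)
  then show ?thesis using AA.pol_mono e by (metis Suc_leI)
qed

lemma T_pow_lead:
  assumes i: "i < N" and b: "b \<in> P.pol (A i) (T i k) e"
  shows "T i k [^]\<^bsub>P\<^esub> e \<oplus>\<^bsub>P\<^esub> b \<noteq> \<zero>\<^bsub>P\<^esub>"
proof
  assume "T i k [^]\<^bsub>P\<^esub> e \<oplus>\<^bsub>P\<^esub> b = \<zero>\<^bsub>P\<^esub>"
  then have "\<one>\<^bsub>P\<^esub> \<otimes>\<^bsub>P\<^esub> T i k [^]\<^bsub>P\<^esub> e \<oplus>\<^bsub>P\<^esub> b = \<zero>\<^bsub>P\<^esub>" by simp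
  then have "\<one>\<^bsub>P\<^esub> = \<zero>\<^bsub>P\<^esub>" using A_transc[OF i _ b] subringE(3)[OF A_subring] i by simp
  then show False by (rule notE[OF P_one_not_zero])
qed

text \<open>The last bottom \<open>T n 0\<close> occurs with positive exponent, whereas the rest of
  the sum and \<open>a\<close> lie in the stage over which it is transcendental.\<close>

lemma psum_const:
  assumes "n < N" "0 < e n" "a \<in> A n"
  shows "psum (Suc n) e \<noteq> a"
proof
  assume eq: "psum (Suc n) e = a"
  interpret AA: adjoin P "A n" "T n 0" by (rule adjoin_A[OF assms(1)])
  have pA: "psum n e \<in> A n" using psum_A assms(1) by simp
  have c: "psum n e \<in> carrier P" "a \<in> carrier P" using pA assms(3) A_carrier by auto
  have "psum n e \<ominus>\<^bsub>P\<^esub> a \<in> P.pol (A n) (T n 0) (Suc 0)"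
    by (rule AA.S_pol) (use pA assms(3) in \<open>simp add: a_minus_def\<close>)
  then have "psum n e \<ominus>\<^bsub>P\<^esub> a \<in> P.pol (A n) (T n 0) (e n)"
    by (rule AA.pol_mono) (use assms(2) in simp)
  from T_pow_lead[OF assms(1) this] have "T n 0 [^]\<^bsub>P\<^esub> e n \<oplus>\<^bsub>P\<^esub> (psum n e \<ominus>\<^bsub>P\<^esub> a) \<noteq> \<zero>\<^bsub>P\<^esub>" .
  moreover have "T n 0 [^]\<^bsub>P\<^esub> e n \<oplus>\<^bsub>P\<^esub> (psum n e \<ominus>\<^bsub>P\<^esub> a) = psum (Suc n) e \<ominus>\<^bsub>P\<^esub> a"
    unfolding psum_Suc a_minus_def by (rule P.a_assoc[symmetric]) (use c in simp_all)
  moreover have "psum (Suc n) e \<ominus>\<^bsub>P\<^esub> a = \<zero>\<^bsub>P\<^esub>" unfolding eq using c by simp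
  ultimately show False by metis
qed

text \<open>The exponent of the last bottom is recovered as a degree over the stage below; its power
  is then cancelled and the sum shortened.\<close>

lemma psum_unique:
  assumes "n \<le> N" "\<And>s. 0 < e s" "\<And>s. 0 < e' s" "psum n e = psum n e'" "s < n"
  shows "e s = e' s"
  using assms(1,4,5)
proof (induction n arbitrary: s)
  case (Suc n)
  then have n: "n < N" "n \<le> N" by auto
  interpret AA: adjoin P "A n" "T n 0" by (rule adjoin_A[OF n(1)])
  have not_less: "\<not> e' n < e n" if eq: "psum (Suc n) e = psum (Suc n) e'" for e e'
  proof
    assume lt: "e' n < e n"
    have pA: "psum n e \<in> A n" "psum n e' \<in> A n" using psum_A n by auto
    have c: "psum n e \<in> carrier P" "psum n e' \<in> carrier P" using pA A_carrier by auto
    let ?T = "T n 0 [^]\<^bsub>P\<^esub> e n" and ?T' = "T n 0 [^]\<^bsub>P\<^esub> e' n"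
    have "psum n e \<ominus>\<^bsub>P\<^esub> psum n e' \<in> P.pol (A n) (T n 0) (Suc 0)"
      by (rule AA.S_pol) (use pA in \<open>simp add: a_minus_def\<close>)
    then have "psum n e \<ominus>\<^bsub>P\<^esub> psum n e' \<in> P.pol (A n) (T n 0) (e n)"
      by (rule AA.pol_mono) (use lt in simp)
    then have b: "(psum n e \<ominus>\<^bsub>P\<^esub> psum n e') \<ominus>\<^bsub>P\<^esub> ?T' \<in> P.pol (A n) (T n 0) (e n)"
      using T_pow_pol[OF n(1) lt] by (rule AA.pol_minus)
    have cT: "?T \<in> carrier P" "?T' \<in> carrier P" by simp_all
    have "?T \<oplus>\<^bsub>P\<^esub> ((psum n e \<ominus>\<^bsub>P\<^esub> psum n e') \<ominus>\<^bsub>P\<^esub> ?T') = (?T \<oplus>\<^bsub>P\<^esub> psum n e) \<ominus>\<^bsub>P\<^esub> (?T' \<oplus>\<^bsub>P\<^esub> psum n e')"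
      by (rule P.diff_sums) (use c cT in simp_all)
    also have "\<dots> = \<zero>\<^bsub>P\<^esub>" using eq c cT unfolding psum_Suc by simp
    finally show False using T_pow_lead[OF n(1) b] by blast
  qed
  have en: "e n = e' n" using not_less[of e e'] not_less[of e' e] Suc.prems(2) by (metis linorder_neqE_nat)
  have "psum n e \<in> carrier P" "psum n e' \<in> carrier P" using psum_A[OF n(2)] A_carrier by blast+
  then have "psum n e = psum n e'"
    using Suc.prems(2) unfolding psum_Suc en by (rule P.add_left_cancel[OF P.nat_pow_closed[OF T_closed]])
  show ?case
  proof (cases "s = n")
    case False
    then have "s < n" using Suc.prems(3) by simp
    with \<open>psum n e = psum n e'\<close> show ?thesis by (rule Suc.IH[OF n(2)])
  qed (simp add: en)
qed simp

lemma Th_psum: "m \<le> i \<Longrightarrow> Th i = psum m (ex i)"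
  by (simp add: Th_eq)

text \<open>Besides giving \<open>Th_nonzero\<close>, this separates the two kinds of towers: a
  third parameter equal to one occurs only below \<open>m\<close>.\<close>

lemma Th_not_const:
  assumes "m \<le> i" "a \<in> Rg 0"
  shows "Th i \<noteq> a"
proof -
  obtain n where n: "m = Suc n" using m_pos gr0_implies_Suc by blast
  then have nN: "n < N" using mN by simp
  have "a \<in> A n" using assms(2) Rg_mono[of 0 n] Rg_A[OF less_imp_le[OF nN]] by blast
  from psum_const[of n "ex i" a, OF nN ex_pos this, folded n] show ?thesis unfolding Th_psum[OF assms(1)] .
qed

lemma Th_nonzero: "Th i \<noteq> \<zero>\<^bsub>P\<^esub>"
proof (cases "i < m")
  case True
  then show ?thesis using P_one_not_zero by (simp add: Th_eq)
next
  case False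
  then show ?thesis by (intro Th_not_const subringE(2)[OF Rg_subring]) simp
qed

text \<open>At the last stage rigidity leaves two possibilities: the sequence is the last tower, or
  it lies one stage lower. The parameters come from \<open>A l\<close>, so the descent can continue
  down to \<open>l\<close>. It is used with \<open>l = 0\<close> for the first kind of towers and
  \<open>l = m\<close> for the second.\<close>

lemma tower_sequences:
  assumes "l \<le> i" "i \<le> N" and u: "\<And>k. u k \<in> A i"
    and uc: "\<And>k a. a \<in> A N \<Longrightarrow> u k \<otimes>\<^bsub>P\<^esub> a = a \<otimes>\<^bsub>P\<^esub> u k"
    and h: "h \<in> A l" and hc: "\<And>a. a \<in> A N \<Longrightarrow> h \<otimes>\<^bsub>P\<^esub> a = a \<otimes>\<^bsub>P\<^esub> h"
    and u_rec: "\<And>k. u k = u (Suc k) [^]\<^bsub>P\<^esub> q k \<ominus>\<^bsub>P\<^esub> period3 \<one>\<^bsub>P\<^esub> \<tau>P h k"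
  shows "(\<forall>k. u k \<in> A l) \<or> (\<exists>s. l \<le> s \<and> s < i \<and> (\<forall>k. u k = T s k) \<and> h = Th s)"
  using assms(1,2) u
proof (induction i rule: dec_induct)
  case base
  then show ?case by blast
next
  case (step i)
  have i: "i < N" "i \<le> N" "Suc i \<le> N" using step.prems(1) by auto
  let ?\<eta> = "period3 \<one>\<^bsub>P\<^esub> \<tau>P h"
  interpret S: skew_tower "E (Suc i)" "A i" "T i" q "param i" by (rule stage[OF i(1) Th_nonzero])
  note sub = A_subring[OF i(3)]
  have sub_N: "a \<in> A N" if "a \<in> A (Suc i)" for a using that A_mono[OF i(3)] by blast
  have \<tau>i: "\<tau>P \<in> A i" using cl_Rg0[OF \<tau>_carrier] Rg_mono[of 0 i] Rg_A[OF i(2)] by auto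
  have hi: "h \<in> A i" using h A_mono[OF step.hyps(1)] by blast
  have \<eta>i: "?\<eta> k \<in> A i" for k by (intro period3_in hi \<tau>i subringE(3)[OF A_subring[OF i(2)]])
  have \<eta>i': "?\<eta> k \<in> A (Suc i)" for k using \<eta>i A_mono[of i "Suc i"] by auto
  have \<eta>c: "?\<eta> k \<otimes>\<^bsub>P\<^esub> a = a \<otimes>\<^bsub>P\<^esub> ?\<eta> k" if "a \<in> A N" for a k
  proof -
    have "\<tau>P \<otimes>\<^bsub>P\<^esub> a = a \<otimes>\<^bsub>P\<^esub> \<tau>P" by (rule cl_center) (use \<tau> A_carrier that in auto)
    then show ?thesis using hc[OF that] A_carrier[OF that] unfolding period3_def by simp
  qed
  have "(\<forall>k. u k \<in> A i) \<or> (\<forall>k. u k = T i k \<and> ?\<eta> k = param i k)"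
  proof (rule S.root_sequence_unique[where \<tau> = \<tau>P])
    show "u k \<in> S.center" for k unfolding S.center_def using step.prems(2) uc sub_N by simp
    show "?\<eta> k \<in> A i" for k by (rule \<eta>i)
    show "?\<eta> k \<in> S.center" for k unfolding S.center_def using \<eta>i' \<eta>c sub_N by simp
    show "u k = u (Suc k) [^]\<^bsub>E (Suc i)\<^esub> q k \<ominus>\<^bsub>E (Suc i)\<^esub> ?\<eta> k" for k
      using u_rec[of k] by (simp only: P.restrict_pow P.restrict_minus[OF sub \<eta>i'])
    show "param i k = \<one>\<^bsub>E (Suc i)\<^esub> \<and> ?\<eta> k = \<one>\<^bsub>E (Suc i)\<^esub>" if "k mod 3 = 0" for k
      using that unfolding param_def period3_def by simp
    show "param i k = \<tau>P \<and> ?\<eta> k = \<tau>P" if "k mod 3 = 1" for k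
      using that unfolding param_def period3_def by simp
    show "param i (k + 3) = param i k" "?\<eta> (k + 3) = ?\<eta> k" for k unfolding param_def period3_def by simp_all
    show "\<tau>P [^]\<^bsub>E (Suc i)\<^esub> n \<noteq> \<one>\<^bsub>E (Suc i)\<^esub>" if "n > 0" for n :: nat
      using \<tau>P_order[OF that] by (simp only: P.restrict_pow) simp
  qed
  then show ?case
  proof
    assume "\<forall>k. u k \<in> A i"
    then have "(\<forall>k. u k \<in> A l) \<or> (\<exists>s. l \<le> s \<and> s < i \<and> (\<forall>k. u k = T s k) \<and> h = Th s)"
      using step.IH i(2) by blast
    then show ?thesis using less_SucI by blast
  next
    assume *: "\<forall>k. u k = T i k \<and> ?\<eta> k = param i k"
    \<comment> \<open>Height 2 is the first one that carries the third parameter.\<close>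
    then have "?\<eta> 2 = param i 2" by blast
    then have "h = Th i" unfolding param_def period3_def by simp
    then show ?thesis using * step.hyps(1) by blast
  qed
qed

end

text \<open>Both blocks of \<open>m\<close> towers are labelled by \<open>G\<close> through
  \<open>b\<close>: tower \<open>i\<close> plays the role of the element \<open>s = b i\<close>,
  tower \<open>m + i\<close> that of \<open>g = b i\<close>. The successor makes the exponents
  positive.\<close>

locale group_points = rigid_points + G: group G for G +
  fixes b :: "nat \<Rightarrow> _"
  assumes b: "bij_betw b {..<m} (carrier G)" and N_eq: "N = 2 * m"
    and ex_eq: "i < m \<Longrightarrow> s < m \<Longrightarrow>
      ex (m + i) s = Suc (inv_into {..<m} b (inv\<^bsub>G\<^esub> (b i) \<otimes>\<^bsub>G\<^esub> b s))"
begin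

abbreviation "idx \<equiv> inv_into {..<m} b"

lemma b_closed [simp]: "i < m \<Longrightarrow> b i \<in> carrier G"
  using bij_betwE[OF b] by simp

lemma idx_lt [simp]: "a \<in> carrier G \<Longrightarrow> idx a < m"
  using bij_betwE[OF bij_betw_inv_into[OF b]] by simp

lemma b_idx [simp]: "a \<in> carrier G \<Longrightarrow> b (idx a) = a"
  using bij_betw_inv_into_right[OF b] .

lemma idx_b [simp]: "i < m \<Longrightarrow> idx (b i) = i"
  using bij_betw_inv_into_left[OF b] by simp

lemma idx_eq: "a \<in> carrier G \<Longrightarrow> a' \<in> carrier G \<Longrightarrow> idx a = idx a' \<Longrightarrow> a = a'"
  using b_idx by metis

definition perm :: "_ \<Rightarrow> nat \<Rightarrow> nat" where
  "perm a i = (if i < m then idx (a \<otimes>\<^bsub>G\<^esub> b i) else if i < N then m + idx (a \<otimes>\<^bsub>G\<^esub> b (i - m)) else i)"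

lemma perm_lt:
  assumes "a \<in> carrier G" "i < N"
  shows "perm a i < N"
proof (cases "i < m")
  case True
  then have "perm a i < m" unfolding perm_def using assms by simp
  then show ?thesis using mN by simp
next
  case False
  then have "i - m < m" using assms(2) N_eq by arith
  then have "idx (a \<otimes>\<^bsub>G\<^esub> b (i - m)) < m" using assms by simp
  then have "m + idx (a \<otimes>\<^bsub>G\<^esub> b (i - m)) < N" using N_eq by linarith
  then show ?thesis unfolding perm_def using False assms(2) by simp
qed

lemma perm_ge: "N \<le> i \<Longrightarrow> perm a i = i"
  unfolding perm_def using mN by auto

lemma perm_mult:
  assumes "a \<in> carrier G" "a' \<in> carrier G"
  shows "perm a (perm a' i) = perm (a \<otimes>\<^bsub>G\<^esub> a') i"
  unfolding perm_def using assms N_eq by (auto simp: G.m_assoc)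

lemma perm_one: "perm \<one>\<^bsub>G\<^esub> i = i"
  unfolding perm_def using N_eq by auto

text \<open>Left translation by \<open>a\<close> does not change the quotient of \<open>b l\<close>
  and \<open>b s\<close> that the exponents encode.\<close>

lemma perm_symmetry:
  assumes a: "a \<in> carrier G"
  shows "symmetry (perm a)"
  unfolding symmetry_def
proof (intro conjI allI impI)
  show "perm a permutes {..<N}"
  proof (rule bij_imp_permutes)
    show "bij_betw (perm a) {..<N} {..<N}"
      by (rule bij_betw_byWitness[where f' = "perm (inv\<^bsub>G\<^esub> a)"])
        (use a perm_lt in \<open>auto simp: perm_mult perm_one\<close>)
  qed (simp add: perm_ge)
  show "perm a i < m" if "i < m" for i using a that by (simp add: perm_def)
  fix i s assume i: "m \<le> i" "i < N" and s: "s < m"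
  define l where "l = i - m"
  have l: "l < m" "i = m + l" using i N_eq unfolding l_def by auto
  let ?l = "idx (a \<otimes>\<^bsub>G\<^esub> b l)" and ?s = "idx (a \<otimes>\<^bsub>G\<^esub> b s)"
  have p: "perm a i = m + ?l" "perm a s = ?s" using i s l by (auto simp: perm_def)
  have "ex (m + ?l) ?s = Suc (idx (inv\<^bsub>G\<^esub> (b ?l) \<otimes>\<^bsub>G\<^esub> b ?s))" using a l s by (intro ex_eq) simp_all
  also have "inv\<^bsub>G\<^esub> (b ?l) \<otimes>\<^bsub>G\<^esub> b ?s = inv\<^bsub>G\<^esub> (b l) \<otimes>\<^bsub>G\<^esub> b s"
  proof -
    have "inv\<^bsub>G\<^esub> (a \<otimes>\<^bsub>G\<^esub> b l) \<otimes>\<^bsub>G\<^esub> (a \<otimes>\<^bsub>G\<^esub> b s) = inv\<^bsub>G\<^esub> (b l) \<otimes>\<^bsub>G\<^esub> (inv\<^bsub>G\<^esub> a \<otimes>\<^bsub>G\<^esub> (a \<otimes>\<^bsub>G\<^esub> b s))"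
      using a l s by (simp add: G.inv_mult_group G.m_assoc)
    also have "\<dots> = inv\<^bsub>G\<^esub> (b l) \<otimes>\<^bsub>G\<^esub> b s" using a l s by (simp flip: G.m_assoc)
    finally show ?thesis using a l s by simp
  qed
  finally show "ex (perm a i) (perm a s) = ex i s" unfolding p unfolding l(2) using ex_eq[OF l(1) s] by simp
qed

lemma hom_E: "h \<in> ring_hom P P \<Longrightarrow> h \<in> ring_hom (E N) P"
  using A_carrier by (auto simp: ring_hom_def)

lemma hom_pow:
  assumes f: "f \<in> ring_hom (E N) P" and X: "X \<in> A N"
  shows "f (X [^]\<^bsub>P\<^esub> (n::nat)) = f X [^]\<^bsub>P\<^esub> n"
proof (induction n)
  case (Suc n)
  have "X [^]\<^bsub>P\<^esub> n \<in> A N" by (rule P.subring_pow[OF A_subring[OF order_refl] X])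
  then show ?case using Suc hom_simps(2)[OF order_refl f, of "X [^]\<^bsub>P\<^esub> n" X] X by simp
qed (simp only: P.nat_pow_0 hom_simps(4)[OF order_refl f])

lemma psi_A:
  assumes a: "a \<in> carrier G" and x: "X \<in> A N"
  shows "psi (perm a) X \<in> A N"
proof (rule hom_in_A[OF order_refl hom_E[OF psi_hom[OF perm_symmetry[OF a]]] order_refl order_refl _ _ x])
  show "psi (perm a) X \<in> A N" if "X \<in> Rg 0" for X
    using psi_const[OF perm_symmetry[OF a] that] that Rg_A[of 0] A_mono[of 0 N] by auto
  show "psi (perm a) (T s k) \<in> A N" if "s < N" for s k
    unfolding psi_T[OF perm_symmetry[OF a] that] using T_A perm_lt[OF a that] by simp
qed

text \<open>Pullback acts covariantly on the indices of the towers: \<open>T i\<close> goes to tower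
  \<open>perm a' i\<close> and then to tower \<open>perm a (perm a' i)\<close>. Composition
  therefore matches multiplication in \<open>G\<close> without reversal.\<close>

lemma psi_psi:
  assumes a: "a \<in> carrier G" "a' \<in> carrier G" and X: "X \<in> A N"
  shows "psi (perm a) (psi (perm a') X) = psi (perm (a \<otimes>\<^bsub>G\<^esub> a')) X"
proof -
  note s = perm_symmetry[OF a(1)] perm_symmetry[OF a(2)]
  have aa: "a \<otimes>\<^bsub>G\<^esub> a' \<in> carrier G" using a by simp
  have h: "psi (perm a) \<circ> psi (perm a') \<in> ring_hom (E N) P"
    by (rule hom_E) (rule ring_hom_trans[OF psi_hom[OF s(2)] psi_hom[OF s(1)]])
  have "(psi (perm a) \<circ> psi (perm a')) X = psi (perm (a \<otimes>\<^bsub>G\<^esub> a')) X"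
  proof (rule hom_eq[OF order_refl h hom_E[OF psi_hom[OF perm_symmetry[OF aa]]] _ _ X])
    show "(psi (perm a) \<circ> psi (perm a')) Y = psi (perm (a \<otimes>\<^bsub>G\<^esub> a')) Y" if "Y \<in> Rg 0" for Y
      by (simp only: comp_apply psi_const[OF s(1) that] psi_const[OF s(2) that] psi_const[OF perm_symmetry[OF aa] that])
    show "(psi (perm a) \<circ> psi (perm a')) (T i k) = psi (perm (a \<otimes>\<^bsub>G\<^esub> a')) (T i k)" if "i < N" for i k
      by (simp only: comp_apply psi_T[OF s(2) that] psi_T[OF s(1) perm_lt[OF a(2) that]]
          psi_T[OF perm_symmetry[OF aa] that] perm_mult[OF a])
  qed
  then show ?thesis by simp
qed

lemma psi_one:
  assumes X: "X \<in> A N"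
  shows "psi (perm \<one>\<^bsub>G\<^esub>) X = X"
proof -
  have s: "symmetry (perm \<one>\<^bsub>G\<^esub>)" by (rule perm_symmetry) simp
  have i: "(\<lambda>X. X) \<in> ring_hom (E N) P" by (rule hom_E) (simp add: ring_hom_def)
  show ?thesis
    by (rule hom_eq[OF order_refl hom_E[OF psi_hom[OF s]] i _ _ X])
      (simp_all only: psi_const[OF s] psi_T[OF s] perm_one)
qed

section \<open>Automorphisms over the constants permute the towers\<close>

lemma auts_hom: "f \<in> relative_auts (E N) (Rg 0) \<Longrightarrow> f \<in> ring_hom (E N) P"
  unfolding relative_auts_def ring_iso_def using A_carrier by (auto simp: ring_hom_def)

lemma auts_bij: "f \<in> relative_auts (E N) (Rg 0) \<Longrightarrow> bij_betw f (A N) (A N)"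
  unfolding relative_auts_def ring_iso_def by simp

lemma auts_fix: "f \<in> relative_auts (E N) (Rg 0) \<Longrightarrow> X \<in> Rg 0 \<Longrightarrow> f X = X"
  unfolding relative_auts_def by blast

lemma auts_ext: "f \<in> relative_auts (E N) (Rg 0) \<Longrightarrow> f \<in> extensional (A N)"
  unfolding relative_auts_def Bij_def by simp

lemma auts_inverse:
  assumes f: "f \<in> relative_auts (E N) (Rg 0)"
  shows "restrict (inv_into (A N) f) (A N) \<in> relative_auts (E N) (Rg 0)"
proof -
  let ?g = "restrict (inv_into (A N) f) (A N)"
  have fb: "bij_betw f (A N) (A N)" using auts_bij[OF f] .
  have iso: "inv_into (A N) f \<in> ring_iso (E N) (E N)"
    using ring_iso_set_sym[of "E N" f "E N"] P.subring_is_ring[OF A_subring[of N]] f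
    unfolding relative_auts_def by simp
  have "?g \<in> ring_iso (E N) (E N)"
  proof -
    have r: "ring (E N)" using P.subring_is_ring[OF A_subring[of N]] by simp
    show ?thesis by (rule ring.ring_iso_restrict[OF r iso]) simp
  qed
  moreover have "?g \<in> Bij (A N)" unfolding Bij_def
    using bij_betw_inv_into[OF fb] by (auto cong: bij_betw_cong)
  moreover have "?g X = X" if X: "X \<in> Rg 0" for X
  proof -
    have "X \<in> A N" using X Rg_A[of 0] A_mono[of 0 N] by blast
    then show ?thesis using bij_betw_inv_into_left[OF fb, of X] auts_fix[OF f X] by simp
  qed
  ultimately show ?thesis unfolding relative_auts_def by simp
qed

text \<open>An automorphism fixes one and \<tau>, so the image of a tower obeys the same recursion
  with \<open>f (Th i)\<close> as third parameter, and \<open>tower_sequences\<close>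
  applies.\<close>

lemma auts_tower:
  assumes f: "f \<in> relative_auts (E N) (Rg 0)" and i: "i < N" and l: "l \<le> N"
    and h: "f (Th i) \<in> A l"
  shows "(\<forall>k. f (T i k) \<in> A l) \<or> (\<exists>s. l \<le> s \<and> s < N \<and> (\<forall>k. f (T i k) = T s k) \<and> f (Th i) = Th s)"
proof (rule tower_sequences[OF l order_refl _ _ h])
  note hom = hom_simps[OF order_refl auts_hom[OF f]]
  have fb: "bij_betw f (A N) (A N)" using auts_bij[OF f] .
  have TA: "T i k \<in> A N" for k using T_A i by simp
  have ThA: "Th i \<in> A N" using Th_A[of i] A_mono[of i N] i by auto
  show "f (T i k) \<in> A N" for k using bij_betwE[OF fb] TA by blast
  \<comment> \<open>Surjectivity of \<open>f\<close>: everything that the image has to commute with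
    is itself an image.\<close>
  have central: "f z \<otimes>\<^bsub>P\<^esub> X = X \<otimes>\<^bsub>P\<^esub> f z"
    if z: "z \<in> A N" "\<And>Y. Y \<in> carrier P \<Longrightarrow> z \<otimes>\<^bsub>P\<^esub> Y = Y \<otimes>\<^bsub>P\<^esub> z" and X: "X \<in> A N" for z X
  proof -
    obtain Y where Y: "Y \<in> A N" "X = f Y" using fb X unfolding bij_betw_def by blast
    show ?thesis unfolding Y(2) using hom(2)[OF z(1) Y(1)] hom(2)[OF Y(1) z(1)] z(2)[OF A_carrier[OF Y(1)]] by metis
  qed
  show "f (T i k) \<otimes>\<^bsub>P\<^esub> X = X \<otimes>\<^bsub>P\<^esub> f (T i k)" if "X \<in> A N" for k X
    by (rule central[OF TA T_central that])
  show "f (Th i) \<otimes>\<^bsub>P\<^esub> X = X \<otimes>\<^bsub>P\<^esub> f (Th i)" if "X \<in> A N" for X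
    by (rule central[OF ThA _ that]) (unfold Th_def, rule cl_center[OF th_center])
  note pow = hom_pow[OF auts_hom[OF f]]
  show "f (T i k) = f (T i (Suc k)) [^]\<^bsub>P\<^esub> q k \<ominus>\<^bsub>P\<^esub> period3 \<one>\<^bsub>P\<^esub> \<tau>P (f (Th i)) k" for k
  proof -
    have par: "param i k \<in> A N" using param_Rg[of i k] Rg_mono[of i N] Rg_A[of N] i by auto
    have "f (param i k) = period3 \<one>\<^bsub>P\<^esub> \<tau>P (f (Th i)) k"
      using hom(4) auts_fix[OF f cl_Rg0[OF \<tau>_carrier]] unfolding param_def period3_def by simp
    moreover have "f (T i k) = f (T i (Suc k)) [^]\<^bsub>P\<^esub> q k \<oplus>\<^bsub>P\<^esub> \<ominus>\<^bsub>P\<^esub> f (param i k)"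
    proof -
      have "f (T i k) = f (T i (Suc k) [^]\<^bsub>P\<^esub> q k \<oplus>\<^bsub>P\<^esub> \<ominus>\<^bsub>P\<^esub> param i k)"
        using T_step[of i k] unfolding a_minus_def by simp
      also have "\<dots> = f (T i (Suc k) [^]\<^bsub>P\<^esub> q k) \<oplus>\<^bsub>P\<^esub> f (\<ominus>\<^bsub>P\<^esub> param i k)"
        using P.subring_pow[OF A_subring[of N] TA] subringE(5)[OF A_subring[of N] par] by (intro hom(3)) simp_all
      finally show ?thesis unfolding pow[OF TA] hom(6)[OF par] .
    qed
    ultimately show ?thesis unfolding a_minus_def by simp
  qed
qed

text \<open>The third parameter one is fixed, so the image is a constant sequence or a whole tower.
  A constant is excluded because \<open>f\<close> is injective and fixes constants; the tower is of
  the first kind because only there the third parameter is constant.\<close>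

lemma auts_low:
  assumes f: "f \<in> relative_auts (E N) (Rg 0)" and i: "i < m"
  shows "\<exists>s<m. \<forall>k. f (T i k) = T s k"
proof -
  have iN: "i < N" using i mN by simp
  have Th1: "Th i = \<one>\<^bsub>P\<^esub>" using i by (simp add: Th_eq)
  have fTh: "f (Th i) = \<one>\<^bsub>P\<^esub>" unfolding Th1 by (rule hom_simps(4)[OF order_refl auts_hom[OF f]])
  have one: "\<one>\<^bsub>P\<^esub> \<in> Rg 0" using subringE(3)[OF Rg_subring] .
  have "f (Th i) \<in> A 0" unfolding fTh using one Rg_A[of 0] by blast
  from auts_tower[OF f iN le0 this] show ?thesis
  proof
    assume "\<forall>k. f (T i k) \<in> A 0"
    then obtain c where c: "c \<in> Rg 0" "c \<noteq> \<zero>\<^bsub>P\<^esub>" "c \<otimes>\<^bsub>P\<^esub> f (T i 0) \<in> Rg 0" unfolding A_def P.fracs_def by blast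
    note hom = hom_simps[OF order_refl auts_hom[OF f]]
    have cA: "c \<in> A N" using c(1) Rg_mono[of 0 N] Rg_A[of N] by blast
    have TA: "T i 0 \<in> A N" using T_A iN by simp
    \<comment> \<open>Multiplied by \<open>c\<close>, both \<open>T i 0\<close> and its image have
      the same value under \<open>f\<close>; injectivity would make \<open>T i 0\<close> a fraction
      of constants.\<close>
    have "f (c \<otimes>\<^bsub>P\<^esub> T i 0) = c \<otimes>\<^bsub>P\<^esub> f (T i 0)" unfolding hom(2)[OF cA TA] auts_fix[OF f c(1)] ..
    also have "\<dots> = f (c \<otimes>\<^bsub>P\<^esub> f (T i 0))" unfolding auts_fix[OF f c(3)] ..
    finally have "c \<otimes>\<^bsub>P\<^esub> T i 0 = c \<otimes>\<^bsub>P\<^esub> f (T i 0)"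
      by (rule inj_onD[OF bij_betw_imp_inj_on[OF auts_bij[OF f]]])
        (use cA TA c(3) Rg_mono[of 0 N] Rg_A[of N] subringE(6)[OF A_subring[of N]] in auto)
    then have "c \<otimes>\<^bsub>P\<^esub> T i 0 \<in> Rg 0" using c(3) by simp
    then have "T i 0 \<in> A 0" unfolding A_def P.fracs_def using c(1,2) by auto
    then have False using T_notin_A[OF iN] A_mono[of 0 i] by blast
    then show ?thesis by blast
  next
    assume "\<exists>s. 0 \<le> s \<and> s < N \<and> (\<forall>k. f (T i k) = T s k) \<and> f (Th i) = Th s"
    then obtain s where s: "s < N" "\<forall>k. f (T i k) = T s k" "Th s = \<one>\<^bsub>P\<^esub>" using fTh by metis
    have "s < m" using Th_not_const[OF _ one, of s] s(3) by (meson not_le)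
    then show ?thesis using s by blast
  qed
qed

lemma auts_A_m:
  assumes f: "f \<in> relative_auts (E N) (Rg 0)" and X: "X \<in> A m"
  shows "f X \<in> A m"
proof (rule hom_in_A[OF order_refl auts_hom[OF f] mN mN _ _ X])
  show "f Y \<in> A m" if "Y \<in> Rg 0" for Y using auts_fix[OF f that] that Rg_mono[of 0 m] Rg_A[OF mN] by auto
  show "f (T s k) \<in> A m" if "s < m" for s k using auts_low[OF f that] T_A[OF _ mN] by metis
qed

text \<open>The parameter \<open>Th (m + i)\<close> lies in \<open>A m\<close>, which
  \<open>f\<close> preserves, so the sequences are classified over \<open>A m\<close> instead of
  over the constants.\<close>

lemma auts_high:
  assumes f: "f \<in> relative_auts (E N) (Rg 0)" and i: "i < m"
  shows "\<exists>s<m. (\<forall>k. f (T (m + i) k) = T (m + s) k) \<and> f (Th (m + i)) = Th (m + s)"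
proof -
  have iN: "m + i < N" using i N_eq by simp
  have "Th (m + i) \<in> A m" unfolding Th_psum[OF le_add1] by (rule psum_A[OF mN])
  from auts_tower[OF f iN mN auts_A_m[OF f this]] show ?thesis
  proof
    assume "\<forall>k. f (T (m + i) k) \<in> A m"
    \<comment> \<open>The inverse automorphism preserves \<open>A m\<close> too and would bring the
      tower itself into \<open>A m\<close>.\<close>
    then have "restrict (inv_into (A N) f) (A N) (f (T (m + i) 0)) \<in> A m" using auts_A_m[OF auts_inverse[OF f]] by blast
    moreover have TA: "T (m + i) 0 \<in> A N" using T_A iN by simp
    moreover have "f (T (m + i) 0) \<in> A N" using bij_betwE[OF auts_bij[OF f]] TA by blast
    ultimately have "T (m + i) 0 \<in> A m" using bij_betw_inv_into_left[OF auts_bij[OF f] TA] by simp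
    then have False using T_notin_A[OF iN] A_mono[of m "m + i"] by auto
    then show ?thesis by blast
  next
    assume "\<exists>s. m \<le> s \<and> s < N \<and> (\<forall>k. f (T (m + i) k) = T s k) \<and> f (Th (m + i)) = Th s"
    then obtain s where "m \<le> s" "s < N" "\<forall>k. f (T (m + i) k) = T s k" "f (Th (m + i)) = Th s" by blast
    then show ?thesis using N_eq by (intro exI[of _ "s - m"]) simp
  qed
qed

lemma hom_psum:
  assumes f: "f \<in> ring_hom (E N) P" and "n \<le> N"
  shows "f (psum n e) = (\<Oplus>\<^bsub>P\<^esub>s\<in>{..<n}. f (T s 0) [^]\<^bsub>P\<^esub> e s)"
  using assms(2)
proof (induction n)
  case 0
  then show ?case using hom_simps(5)[OF order_refl f] by simp
next
  case (Suc n)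
  note hom = hom_simps[OF order_refl f]
  have TA: "T s 0 \<in> A N" if "s \<le> n" for s using T_A that Suc.prems by simp
  have fT: "f (T s 0) \<in> carrier P" if "s \<le> n" for s using hom(1)[OF TA[OF that]] .
  have pA: "psum n e \<in> A N" using psum_A[of n e] A_mono[of n N] Suc.prems by auto
  have powA: "T n 0 [^]\<^bsub>P\<^esub> e n \<in> A N" by (rule P.subring_pow[OF A_subring[OF order_refl] TA]) simp
  have "f (psum (Suc n) e) = f (T n 0) [^]\<^bsub>P\<^esub> e n \<oplus>\<^bsub>P\<^esub> (\<Oplus>\<^bsub>P\<^esub>s\<in>{..<n}. f (T s 0) [^]\<^bsub>P\<^esub> e s)"
    unfolding psum_Suc hom(3)[OF powA pA] hom_pow[OF f TA[OF order_refl]] using Suc.IH Suc.prems by simp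
  also have "\<dots> = (\<Oplus>\<^bsub>P\<^esub>s\<in>{..<Suc n}. f (T s 0) [^]\<^bsub>P\<^esub> e s)"
    unfolding lessThan_Suc by (rule P.finsum_insert[symmetric]) (use fT in \<open>auto simp: Pi_def\<close>)
  finally show ?case .
qed

text \<open>The two index maps \<open>p\<close> and \<open>r\<close> are coupled by the images of
  the power sums: unique exponents and the injective code give equality of the corresponding
  quotients in \<open>G\<close>. Evaluating these at the identity shows that both maps are left
  translation by one element.\<close>

lemma auts_psi:
  assumes f: "f \<in> relative_auts (E N) (Rg 0)"
  obtains a where "a \<in> carrier G" "\<And>X. X \<in> A N \<Longrightarrow> f X = psi (perm a) X"
proof -
  note fhom = auts_hom[OF f]
  obtain p where p: "\<And>i. i < m \<Longrightarrow> p i < m" "\<And>i k. i < m \<Longrightarrow> f (T i k) = T (p i) k" using auts_low[OF f] by metis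
  obtain r where r: "\<And>i. i < m \<Longrightarrow> r i < m" "\<And>i k. i < m \<Longrightarrow> f (T (m + i) k) = T (m + r i) k"
    "\<And>i. i < m \<Longrightarrow> f (Th (m + i)) = Th (m + r i)" using auts_high[OF f] by metis
  have p_inj: "inj_on p {..<m}"
  proof (rule inj_onI)
    fix i i' assume i: "i \<in> {..<m}" "i' \<in> {..<m}" "p i = p i'"
    then have "i < N" "i' < N" using mN by auto
    moreover have "f (T i 0) = f (T i' 0)" using p(2) i by simp
    then have "T i 0 = T i' 0"
      by (rule inj_onD[OF bij_betw_imp_inj_on[OF auts_bij[OF f]]]) (use T_A \<open>i < N\<close> \<open>i' < N\<close> in simp_all)
    ultimately show "i = i'" using T_inj by blast
  qed
  have p_img: "p ` {..<m} = {..<m}" by (rule endo_inj_surj) (use p(1) p_inj in auto)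
  have exponents: "ex (m + i) s = ex (m + r i) (p s)" if i: "i < m" and s: "s < m" for i s
  proof -
    \<comment> \<open>The exponents rewritten as a function of the target index, so that the image
      becomes a \<open>psum\<close> again.\<close>
    let ?e = "\<lambda>t. ex (m + i) (inv_into {..<m} p t)"
    have "f (Th (m + i)) = (\<Oplus>\<^bsub>P\<^esub>s\<in>{..<m}. f (T s 0) [^]\<^bsub>P\<^esub> ex (m + i) s)"
      unfolding Th_psum[OF le_add1] by (rule hom_psum[OF fhom mN])
    also have "\<dots> = (\<Oplus>\<^bsub>P\<^esub>s\<in>{..<m}. T (p s) 0 [^]\<^bsub>P\<^esub> ?e (p s))"
      by (rule P.finsum_cong') (use p p_inj in \<open>auto simp: Pi_def\<close>)
    also have "\<dots> = (\<Oplus>\<^bsub>P\<^esub>s\<in>p ` {..<m}. T s 0 [^]\<^bsub>P\<^esub> ?e s)"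
      by (rule P.finsum_reindex[symmetric, OF _ p_inj]) simp
    finally have "f (Th (m + i)) = psum m ?e" unfolding p_img .
    then have "Th (m + r i) = psum m ?e" by (simp only: r(3)[OF i])
    then have "psum m ?e = psum m (ex (m + r i))" by (simp only: Th_psum[OF le_add1])
    then have "?e (p s) = ex (m + r i) (p s)"
      by (intro psum_unique[OF mN, of ?e "ex (m + r i)"]) (use ex_pos p(1) s in simp_all)
    then show ?thesis using p_inj s by simp
  qed
  have rel: "inv\<^bsub>G\<^esub> (b i) \<otimes>\<^bsub>G\<^esub> b s = inv\<^bsub>G\<^esub> (b (r i)) \<otimes>\<^bsub>G\<^esub> b (p s)" if "i < m" "s < m" for i s
    using exponents[OF that] ex_eq[OF that] ex_eq[OF r(1)[OF that(1)] p(1)[OF that(2)]] that r(1) p(1)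
    by (intro idx_eq) simp_all
  define s0 where "s0 = idx \<one>\<^bsub>G\<^esub>"
  have s0: "s0 < m" "b s0 = \<one>\<^bsub>G\<^esub>" unfolding s0_def by simp_all
  \<comment> \<open>The translation is found as the image of the identity label under
    \<open>p\<close>.\<close>
  define a where "a = b (p s0)"
  have a: "a \<in> carrier G" unfolding a_def using p(1) s0 by simp
  have br: "b (r i) = a \<otimes>\<^bsub>G\<^esub> b i" if i: "i < m" for i
  proof -
    have c: "b i \<in> carrier G" "b (r i) \<in> carrier G" using i r(1) by simp_all
    have "inv\<^bsub>G\<^esub> (b i) = inv\<^bsub>G\<^esub> (b (r i)) \<otimes>\<^bsub>G\<^esub> a" using rel[OF i s0(1)] c unfolding s0(2) a_def by simp
    then have "b (r i) \<otimes>\<^bsub>G\<^esub> inv\<^bsub>G\<^esub> (b i) = a" using c a by (simp flip: G.m_assoc)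
    then show ?thesis using c a by (simp add: G.m_assoc flip: \<open>_ = a\<close>)
  qed
  have bp: "b (p s) = a \<otimes>\<^bsub>G\<^esub> b s" if s: "s < m" for s
  proof -
    have c: "b s \<in> carrier G" "b (p s) \<in> carrier G" using s p(1) by simp_all
    \<comment> \<open>Now the identity label is inserted for \<open>i\<close>, where
      \<open>br\<close> gives the value \<open>a\<close>.\<close>
    have "b s = inv\<^bsub>G\<^esub> a \<otimes>\<^bsub>G\<^esub> b (p s)" using rel[OF s0(1) s] br[OF s0(1)] c a unfolding s0(2) by simp
    then show ?thesis using c a by (simp flip: G.m_assoc)
  qed
  have "f X = psi (perm a) X" if X: "X \<in> A N" for X
  proof (rule hom_eq[OF order_refl fhom hom_E[OF psi_hom[OF perm_symmetry[OF a]]] _ _ X])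
    show "f Y = psi (perm a) Y" if "Y \<in> Rg 0" for Y
      unfolding auts_fix[OF f that] psi_const[OF perm_symmetry[OF a] that] ..
    show "f (T i k) = psi (perm a) (T i k)" if i: "i < N" for i k
    proof (cases "i < m")
      case True
      have "idx (b (p i)) = p i" using p(1)[OF True] by simp
      then have "perm a i = p i" unfolding perm_def using True bp[OF True] by simp
      then show ?thesis unfolding psi_T[OF perm_symmetry[OF a] i] using p(2)[OF True] by simp
    next
      case False
      define l where "l = i - m"
      have l: "l < m" "i = m + l" using False i N_eq unfolding l_def by auto
      have "idx (b (r l)) = r l" using r(1)[OF l(1)] by simp
      then have "perm a i = m + r l" unfolding perm_def using False i br[OF l(1)] by (simp add: l_def)
      then show ?thesis unfolding psi_T[OF perm_symmetry[OF a] i] using r(2)[OF l(1)] l(2) by simp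
    qed
  qed
  then show ?thesis using that a by blast
qed

definition aut :: "_ \<Rightarrow> (nat \<Rightarrow> 'a) set \<Rightarrow> (nat \<Rightarrow> 'a) set" where
  "aut a = restrict (psi (perm a)) (A N)"

lemma aut_auts:
  assumes a: "a \<in> carrier G"
  shows "aut a \<in> relative_auts (E N) (Rg 0)"
proof -
  note h = hom_E[OF psi_hom[OF perm_symmetry[OF a]]]
  have i: "inv\<^bsub>G\<^esub> a \<in> carrier G" using a by simp
  have "psi (perm (inv\<^bsub>G\<^esub> a)) (psi (perm a) X) = X" "psi (perm a) (psi (perm (inv\<^bsub>G\<^esub> a)) X) = X"
    if X: "X \<in> A N" for X
    unfolding psi_psi[OF a i X] psi_psi[OF i a X] using a psi_one[OF X] by simp_all
  then have bij: "bij_betw (psi (perm a)) (A N) (A N)"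
    using psi_A[OF a] psi_A[OF i] by (intro bij_betw_byWitness[where f' = "psi (perm (inv\<^bsub>G\<^esub> a))"]) auto
  have hom: "psi (perm a) \<in> ring_hom (E N) (E N)"
    using h psi_A[OF a] unfolding ring_hom_def by simp
  have r: "ring (E N)" by (rule P.subring_is_ring[OF A_subring[OF order_refl]])
  have "psi (perm a) \<in> ring_iso (E N) (E N)" unfolding ring_iso_def using hom bij by simp
  then have "aut a \<in> ring_iso (E N) (E N)" unfolding aut_def by (rule ring.ring_iso_restrict[OF r]) simp
  moreover have "aut a \<in> Bij (A N)" unfolding Bij_def aut_def using bij by (simp cong: bij_betw_cong)
  moreover have "aut a X = X" if X: "X \<in> Rg 0" for X
  proof -
    have "X \<in> A N" using X Rg_A[of 0] A_mono[of 0 N] by blast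
    then show ?thesis unfolding aut_def using psi_const[OF perm_symmetry[OF a] X] by simp
  qed
  ultimately show ?thesis unfolding relative_auts_def by simp
qed

theorem aut_group_iso: "aut \<in> iso G (relative_aut_group (E N) (Rg 0))"
  unfolding iso_def
proof (intro CollectI conjI)
  have carr: "carrier (relative_aut_group (E N) (Rg 0)) = relative_auts (E N) (Rg 0)"
    by (simp add: relative_aut_group_def)
  show "aut \<in> hom G (relative_aut_group (E N) (Rg 0))"
  proof (rule homI)
    show "aut a \<in> carrier (relative_aut_group (E N) (Rg 0))" if "a \<in> carrier G" for a
      unfolding carr using aut_auts that .
    fix a a' assume a: "a \<in> carrier G" "a' \<in> carrier G"
    have "aut a \<in> Bij (A N)" "aut a' \<in> Bij (A N)" using aut_auts a unfolding relative_auts_def by auto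
    then have "aut a \<otimes>\<^bsub>relative_aut_group (E N) (Rg 0)\<^esub> aut a' = compose (A N) (aut a) (aut a')"
      by (simp add: relative_aut_group_def BijGroup_def)
    also have "\<dots> = aut (a \<otimes>\<^bsub>G\<^esub> a')"
    proof
      fix X
      show "compose (A N) (aut a) (aut a') X = aut (a \<otimes>\<^bsub>G\<^esub> a') X"
      proof (cases "X \<in> A N")
        case True
        then show ?thesis unfolding compose_def aut_def
          using psi_psi[OF a True] psi_A[OF a(2) True] by simp
      qed (simp add: compose_def aut_def)
    qed
    finally show "aut (a \<otimes>\<^bsub>G\<^esub> a') = aut a \<otimes>\<^bsub>relative_aut_group (E N) (Rg 0)\<^esub> aut a'" by (rule sym)
  qed
  show "bij_betw aut (carrier G) (carrier (relative_aut_group (E N) (Rg 0)))"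
    unfolding carr bij_betw_def
  proof (intro conjI inj_onI)
    fix a a' assume a: "a \<in> carrier G" "a' \<in> carrier G" "aut a = aut a'"
    define s0 where "s0 = idx \<one>\<^bsub>G\<^esub>"
    have s0: "s0 < m" "b s0 = \<one>\<^bsub>G\<^esub>" unfolding s0_def by simp_all
    have s0N: "s0 < N" using less_le_trans[OF s0(1) mN] .
    \<comment> \<open>The bottom labelled by the identity is sent to the bottom labelled by
      \<open>c\<close>, which reveals \<open>c\<close>.\<close>
    have "aut c (T s0 0) = T (idx c) 0" if c: "c \<in> carrier G" for c
    proof -
      have "T s0 0 \<in> A N" using T_A s0N by simp
      moreover have "perm c s0 = idx c" unfolding perm_def using s0 c by simp
      ultimately show ?thesis unfolding aut_def using psi_T[OF perm_symmetry[OF c] s0N] by simp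
    qed
    then have "T (idx a) 0 = T (idx a') 0" using a by metis
    then have "idx a = idx a'" by (rule T_inj[rotated 2]) (use idx_lt[OF a(1)] idx_lt[OF a(2)] mN in simp_all)
    then show "a = a'" using idx_eq a by blast
  next
    show "aut ` carrier G = relative_auts (E N) (Rg 0)"
    proof
      show "aut ` carrier G \<subseteq> relative_auts (E N) (Rg 0)" using aut_auts by blast
      show "relative_auts (E N) (Rg 0) \<subseteq> aut ` carrier G"
      proof
        fix f assume f: "f \<in> relative_auts (E N) (Rg 0)"
        obtain a where a: "a \<in> carrier G" "\<And>X. X \<in> A N \<Longrightarrow> f X = psi (perm a) X" using auts_psi[OF f] by blast
        have "f = aut a" unfolding aut_def
          using a(2) auts_ext[OF f] by (intro extensionalityI[of _ "A N"]) auto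
        then show "f \<in> aut ` carrier G" using a(1) by blast
      qed
    qed
  qed
qed

end

section \<open>Extensions of the twisted rational functions\<close>

text \<open>At most one prime can vanish in the ring, since a Bezout relation between two of them
  would give \<open>\<one> = \<zero>\<close>.\<close>

lemma (in skew_field) infinite_invertible_primes:
  "infinite {p::nat. prime p \<and> add_pow R p \<one> \<noteq> \<zero>}"
proof -
  have "p = p'" if p: "prime p" "add_pow R p \<one> = \<zero>" "prime p'" "add_pow R p' \<one> = \<zero>" for p p' :: nat
  proof (rule ccontr)
    assume "p \<noteq> p'"
    then have "gcd p p' = 1" using primes_coprime[OF p(1,3)] by simp
    then obtain k l where "p * k = p' * l + 1" using bezout_nat[of p p'] prime_gt_0_nat[OF p(1)] by auto
    then have "add_pow R (p * k) \<one> = add_pow R (p' * l) \<one> \<oplus> \<one>" by simp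
    then have "add_pow R k (add_pow R p \<one>) = add_pow R l (add_pow R p' \<one>) \<oplus> \<one>"
      by (simp add: add.nat_pow_pow)
    then show False using p(2,4) one_not_zero by simp
  qed
  then have "\<exists>p. {p::nat. prime p \<and> add_pow R p \<one> = \<zero>} \<subseteq> {p}" by blast
  then have "finite {p::nat. prime p \<and> add_pow R p \<one> = \<zero>}" using finite_subset by blast
  moreover have "{p::nat. prime p} \<subseteq> {p. prime p \<and> add_pow R p \<one> \<noteq> \<zero>} \<union> {p. prime p \<and> add_pow R p \<one> = \<zero>}"
    by blast
  ultimately show ?thesis using primes_infinite finite_subset finite_UnI by blast
qed

theorem (in skew_field) extension_with_automorphism_group:
  assumes \<tau>: "\<tau> \<in> center" and inj: "inj (\<lambda>i::nat. \<tau> [^] i)"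
    and "group G" and fin: "finite (carrier G)"
  shows "\<exists>(E :: (nat \<Rightarrow> 'a) set ring) j.
    skew_field E \<and> j \<in> ring_hom R E \<and> inj_on j (carrier R) \<and> relative_aut_group E (j ` carrier R) \<cong> G"
proof -
  interpret G: group G by fact
  define Q where "Q = {p::nat. prime p \<and> add_pow R p \<one> \<noteq> \<zero>}"
  have Q: "infinite Q" unfolding Q_def by (rule infinite_invertible_primes)
  have q: "enumerate Q k \<in> Q" for k by (rule enumerate_in_set[OF Q])
  have q_inj: "inj (enumerate Q)" by (rule inj_enumerate[OF Q])
  define m where "m = card (carrier G)"
  have m_pos: "0 < m" unfolding m_def using fin G.one_closed card_gt_0_iff by blast
  obtain b where b: "bij_betw b {..<m} (carrier G)"
    using ex_bij_betw_nat_finite[OF fin] unfolding m_def lessThan_atLeast0 by blast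
  have \<tau>_carrier [simp]: "\<tau> \<in> carrier R" using \<tau> unfolding center_def by blast
  have \<tau>_pow: "\<tau> [^] i \<in> center" for i :: nat by (rule subring_pow[OF center_subring \<tau>])
  have \<tau>_nonzero: "\<tau> \<noteq> \<zero>" using injD[OF inj, of 1 2] by (auto simp: numeral_2_eq_2)
  have \<tau>_order: "\<tau> [^] n \<noteq> \<one>" if "0 < n" for n :: nat using injD[OF inj, of n 0] that by auto
  \<comment> \<open>The coordinates take the powers of \<tau> as values, which are central and
    pairwise distinct. Subtracting \<open>m\<close> undoes the shift of the second block, whose
    towers have the indices \<open>m + i\<close>.\<close>
  interpret group_points R "\<lambda>i. \<tau> [^] i" "2 * m" "enumerate Q" m
    "\<lambda>i s. Suc (inv_into {..<m} b (inv\<^bsub>G\<^esub> (b (i - m)) \<otimes>\<^bsub>G\<^esub> b s))" \<tau> G b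
    by unfold_locales
      (use q q_inj m_pos b \<tau> \<tau>_nonzero \<tau>_order inj in \<open>simp_all add: Q_def \<tau>_pow\<close>)
  define j where "j = (\<lambda>a. cl (\<lambda>_::nat. a))"
  have img: "j ` carrier R = Rg 0" unfolding Rg.simps consts_in_def j_def by blast
  have ring: "ring (E (2 * m))" and sf: "skew_field (E (2 * m))"
    using E_skew_field[of "2 * m"] unfolding skew_field_def by simp_all
  have "j \<in> ring_hom R (E (2 * m))"
  proof (rule ring_hom_memI)
    fix a assume "a \<in> carrier R"
    then have "j a \<in> Rg 0" using img by blast
    then show "j a \<in> carrier (E (2 * m))" using Rg_A[of 0] A_mono[of 0 "2 * m"] by auto
  qed (simp_all add: j_def cl_mult cl_add cl_one)
  moreover have "inj_on j (carrier R)"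
  proof (rule inj_onI)
    fix a a' assume a: "a \<in> carrier R" "a' \<in> carrier R" "j a = j a'"
    then have "cl (\<lambda>_. a) \<ominus>\<^bsub>P\<^esub> cl (\<lambda>_. a') = \<zero>\<^bsub>P\<^esub>" unfolding j_def by simp
    then have "cl (\<lambda>_. a \<ominus> a') = \<zero>\<^bsub>P\<^esub>" using a by (simp add: cl_minus)
    then have "a \<ominus> a' = \<zero>" by (intro cl_const_zero) (simp_all add: a)
    then show "a = a'" using a by simp
  qed
  moreover have "relative_aut_group (E (2 * m)) (j ` carrier R) \<cong> G"
    unfolding img using G.iso_sym aut_group_iso unfolding is_iso_def by blast
  ultimately show ?thesis using sf by blast
qed

text \<open>Commuting with a denominator implies commuting with its inverse, so it suffices to
  commute with the subring.\<close>

lemma fractions_centralize: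
  assumes "division_ring_of_fractions S \<iota> K" "ring S" and z: "z \<in> carrier S"
    and comm: "\<And>r. r \<in> carrier S \<Longrightarrow> z \<otimes>\<^bsub>S\<^esub> r = r \<otimes>\<^bsub>S\<^esub> z"
  shows "\<iota> z \<in> skew_field.center K"
proof -
  interpret S: ring S by fact
  interpret K: skew_field K using assms(1) unfolding division_ring_of_fractions_def by blast
  have hom: "\<iota> \<in> ring_hom S K" and inj: "inj_on \<iota> (carrier S)"
    and fracs: "\<And>x. x \<in> carrier K \<Longrightarrow> \<exists>r\<in>carrier S. \<exists>s\<in>carrier S - {\<zero>\<^bsub>S\<^esub>}. x = \<iota> r \<otimes>\<^bsub>K\<^esub> inv\<^bsub>K\<^esub> \<iota> s"
    using assms(1) unfolding division_ring_of_fractions_def by blast+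
  have cl: "\<iota> r \<in> carrier K" if "r \<in> carrier S" for r using ring_hom_closed[OF hom that] .
  have c: "\<iota> z \<otimes>\<^bsub>K\<^esub> \<iota> r = \<iota> r \<otimes>\<^bsub>K\<^esub> \<iota> z" if "r \<in> carrier S" for r
    using comm[OF that] ring_hom_mult[OF hom] z that by metis
  have "\<iota> z \<otimes>\<^bsub>K\<^esub> x = x \<otimes>\<^bsub>K\<^esub> \<iota> z" if x: "x \<in> carrier K" for x
  proof -
    obtain r s where rs: "r \<in> carrier S" "s \<in> carrier S" "s \<noteq> \<zero>\<^bsub>S\<^esub>" "x = \<iota> r \<otimes>\<^bsub>K\<^esub> inv\<^bsub>K\<^esub> \<iota> s"
      using fracs[OF x] by blast
    have "\<iota> s \<noteq> \<zero>\<^bsub>K\<^esub>"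
      using ring_hom_zero[OF hom S.ring_axioms K.ring_axioms] inj_onD[OF inj, of s "\<zero>\<^bsub>S\<^esub>"] rs by auto
    then have u: "\<iota> s \<in> Units K" using cl rs(2) K.nonzero_unit by blast
    have i: "inv\<^bsub>K\<^esub> \<iota> s \<in> carrier K" using u by simp
    have ci: "inv\<^bsub>K\<^esub> \<iota> s \<otimes>\<^bsub>K\<^esub> \<iota> z = \<iota> z \<otimes>\<^bsub>K\<^esub> inv\<^bsub>K\<^esub> \<iota> s"
      using c[OF rs(2)] u cl z by (intro K.inv_commutes) simp_all
    have "\<iota> z \<otimes>\<^bsub>K\<^esub> x = \<iota> r \<otimes>\<^bsub>K\<^esub> (\<iota> z \<otimes>\<^bsub>K\<^esub> inv\<^bsub>K\<^esub> \<iota> s)"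
      unfolding rs(4) using c[OF rs(1)] i cl z rs(1) by (simp flip: K.m_assoc)
    then show ?thesis unfolding ci[symmetric] rs(4) using i cl z rs(1) by (simp add: K.m_assoc)
  qed
  then show ?thesis unfolding K.center_def using cl z by blast
qed

text \<open>\<open>X k\<close> is the \<open>k\<close>-th power of the indeterminate. Multiplication
  by it from the right only shifts coefficients, whereas from the left it also twists them by the
  \<open>k\<close>-th iterate of \<sigma>.\<close>

lemma (in ring) twisted_monom_mult:
  assumes "\<sigma> \<in> ring_iso R R" and p: "p \<in> up R"
  defines "X \<equiv> \<lambda>(k::nat) i. if i = k then \<one> else \<zero>"
  shows "X k \<in> up R"
    and "X k \<otimes>\<^bsub>twisted_poly R \<sigma>\<^esub> p = (\<lambda>i. if k \<le> i then (\<sigma> ^^ k) (p (i - k)) else \<zero>)"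
    and "p \<otimes>\<^bsub>twisted_poly R \<sigma>\<^esub> X k = (\<lambda>i. if k \<le> i then p (i - k) else \<zero>)"
proof -
  have hom: "\<sigma> ^^ i \<in> ring_hom R R" for i using funpow_ring_iso[OF assms(1)] .
  have cl: "(\<sigma> ^^ i) a \<in> carrier R" if "a \<in> carrier R" for i a using ring_hom_closed[OF hom that] .
  have on: "(\<sigma> ^^ i) \<one> = \<one>" and ze: "(\<sigma> ^^ i) \<zero> = \<zero>" for i
    using ring_hom_one[OF hom] ring_hom_zero[OF hom ring_axioms ring_axioms] by simp_all
  have pc: "p i \<in> carrier R" for i using p mem_upD by metis
  show up: "X k \<in> up R"
    by (rule mem_upI) (auto simp: X_def intro!: exI[of _ k] bound.intro)
  have mult: "f \<otimes>\<^bsub>twisted_poly R \<sigma>\<^esub> g = (\<lambda>n. \<Oplus>i\<in>{..n}. f i \<otimes> (\<sigma> ^^ i) (g (n - i)))"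
    if "f \<in> up R" "g \<in> up R" for f g
    using that by (simp add: twisted_poly_def)
  show "X k \<otimes>\<^bsub>twisted_poly R \<sigma>\<^esub> p = (\<lambda>i. if k \<le> i then (\<sigma> ^^ k) (p (i - k)) else \<zero>)"
  proof
    fix n
    have "(X k \<otimes>\<^bsub>twisted_poly R \<sigma>\<^esub> p) n = (\<Oplus>i\<in>{..n}. if k = i then (\<sigma> ^^ k) (p (n - k)) else \<zero>)"
      unfolding mult[OF up p] by (rule finsum_cong') (auto simp: X_def Pi_def pc cl)
    also have "\<dots> = (if k \<le> n then (\<sigma> ^^ k) (p (n - k)) else \<zero>)"
    proof (cases "k \<le> n")
      case True
      then show ?thesis using add.finprod_singleton[of k "{..n}" "\<lambda>_. (\<sigma> ^^ k) (p (n - k))"] cl pc by simp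
    next
      case False
      then show ?thesis by (auto intro!: add.finprod_one_eqI)
    qed
    finally show "(X k \<otimes>\<^bsub>twisted_poly R \<sigma>\<^esub> p) n = (if k \<le> n then (\<sigma> ^^ k) (p (n - k)) else \<zero>)" .
  qed
  show "p \<otimes>\<^bsub>twisted_poly R \<sigma>\<^esub> X k = (\<lambda>i. if k \<le> i then p (i - k) else \<zero>)"
  proof
    fix n
    have "(p \<otimes>\<^bsub>twisted_poly R \<sigma>\<^esub> X k) n = (\<Oplus>i\<in>{..n}. if k \<le> n \<and> n - k = i then p (n - k) else \<zero>)"
      unfolding mult[OF p up] by (rule finsum_cong') (auto simp: X_def Pi_def pc cl on ze)
    also have "\<dots> = (if k \<le> n then p (n - k) else \<zero>)"
    proof (cases "k \<le> n")
      case True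
      then show ?thesis using add.finprod_singleton[of "n - k" "{..n}" "\<lambda>_. p (n - k)"] pc by simp
    qed (simp add: Pi_def)
    finally show "(p \<otimes>\<^bsub>twisted_poly R \<sigma>\<^esub> X k) n = (if k \<le> n then p (n - k) else \<zero>)" .
  qed
qed

theorem theorem1p2:
  fixes H :: "('h, 'm) ring_scheme"
    and \<sigma> :: "'h \<Rightarrow> 'h"
    and G :: "('g, 'n) monoid_scheme"
    and K :: "('k, 'l) ring_scheme"
    and \<iota> :: "(nat \<Rightarrow> 'h) \<Rightarrow> 'k"
  assumes "skew_field H"
    and "\<sigma> \<in> ring_iso H H" and "finite_order_on (carrier H) \<sigma>"
    and "group G" and "finite (carrier G)"
    and "division_ring_of_fractions (twisted_poly H \<sigma>) \<iota> K"
  shows "\<exists>(E :: (nat \<Rightarrow> 'k) set ring) j.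
           skew_field E \<and> j \<in> ring_hom K E \<and> inj_on j (carrier K) \<and>
           relative_aut_group E (j ` carrier K) \<cong> G"
proof -
  interpret H: skew_field H by fact
  interpret S: ring "twisted_poly H \<sigma>" by (rule twisted_poly_ring[OF H.ring_axioms assms(2)])
  interpret K: skew_field K using assms(6) unfolding division_ring_of_fractions_def by blast
  have hom: "\<iota> \<in> ring_hom (twisted_poly H \<sigma>) K" and inj: "inj_on \<iota> (carrier (twisted_poly H \<sigma>))"
    using assms(6) unfolding division_ring_of_fractions_def by blast+
  obtain n where n: "0 < n" "\<And>a. a \<in> carrier H \<Longrightarrow> (\<sigma> ^^ n) a = a"
    using assms(3) unfolding finite_order_on_def by blast
  define X where "X k = (\<lambda>i. if i = k then \<one>\<^bsub>H\<^esub> else \<zero>\<^bsub>H\<^esub>)" for k :: nat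
  note mult = H.twisted_monom_mult[OF assms(2), folded X_def]
  have carr: "carrier (twisted_poly H \<sigma>) = up H" by (simp add: twisted_poly_def)
  have zero_up: "(\<lambda>_. \<zero>\<^bsub>H\<^esub>) \<in> up H" using S.zero_closed unfolding carr by (simp add: twisted_poly_def)
  have X: "X k \<in> carrier (twisted_poly H \<sigma>)" for k unfolding carr by (rule mult(1)[OF zero_up])
  \<comment> \<open>The \<open>n\<close>-th iterate of \<sigma> is the identity on coefficients, so
    the left and right products agree.\<close>
  have "X n \<otimes>\<^bsub>twisted_poly H \<sigma>\<^esub> p = p \<otimes>\<^bsub>twisted_poly H \<sigma>\<^esub> X n" if "p \<in> carrier (twisted_poly H \<sigma>)" for p
    using that n(2) unfolding carr by (simp add: mult mem_upD cong: if_cong)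
  then have center: "\<iota> (X n) \<in> K.center"
    by (rule fractions_centralize[OF assms(6) S.ring_axioms X])
  have pow: "X n [^]\<^bsub>twisted_poly H \<sigma>\<^esub> i = X (n * i)" for i
  proof (induction i)
    case 0
    show ?case by (simp add: twisted_poly_def X_def)
  next
    case (Suc i)
    have "X (n * i) \<in> up H" using X carr by simp
    then have "X (n * i) \<otimes>\<^bsub>twisted_poly H \<sigma>\<^esub> X n = X (n * Suc i)"
      by (simp add: mult(3)) (auto simp: X_def fun_eq_iff)
    then show ?case using Suc by simp
  qed
  have inj_X: "i = i'" if "X (n * i) = X (n * i')" for i i'
    using fun_cong[OF that, of "n * i"] H.one_not_zero n(1) by (auto simp: X_def split: if_splits)
  \<comment> \<open>Powers of the central element correspond to \<open>X (n * i)\<close>, which are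
    distinct because \<open>n > 0\<close>; injectivity of \<iota> preserves this.\<close>
  have "inj (\<lambda>i::nat. \<iota> (X n) [^]\<^bsub>K\<^esub> i)"
  proof (rule injI)
    fix i i' :: nat assume "\<iota> (X n) [^]\<^bsub>K\<^esub> i = \<iota> (X n) [^]\<^bsub>K\<^esub> i'"
    moreover interpret ring_hom_ring "twisted_poly H \<sigma>" K \<iota>
      using hom by (intro ring_hom_ringI2 S.ring_axioms K.ring_axioms)
    have "\<iota> (X n) [^]\<^bsub>K\<^esub> i = \<iota> (X (n * i))" for i :: nat
      using hom_nat_pow[OF X, of n i] pow by simp
    ultimately have "\<iota> (X (n * i)) = \<iota> (X (n * i'))" by simp
    then show "i = i'" using inj_X inj_onD[OF inj] X by blast
  qed
  then show ?thesis by (rule K.extension_with_automorphism_group[OF center _ assms(4,5)])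
qed

end
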